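(* Algorithm MaxLeaves-12MIS, using Square$^+$Imp as its independent-set subroutine, is a $7/5$-approximation algorithm for the Maximum Leaf Spanning Arborescence problem on rooted directed acyclic graphs.
   Context: Digraphs: a node $r$ of a digraph $D$ is a root if $D$ has a directed path from $r$ to every node; $D$ is rooted if it has a root. A dag is a digraph with no directed cycle. An arborescence is an $r$-rooted digraph with a unique directed path from $r$ to every node. A branching is a collection of vertex-disjoint arborescences; spanning if it contains every node. A leaf is a node of out-degree 0. Maximum Leaf Spanning Arborescence: given a rooted digraph $D$, find a spanning arborescence with maximum number of leaves. A $\beta$-approximation algorithm runs in polynomial time and outputs a feasible solution of value at least $1/\beta$ times the optimum. Square$^+$Imp$(G,w)$, for a multigraph $G$ arising from a family $\{U_v:v\in V\}$ of 2- and 3-sets (with $|U_x\cap U_y|$ parallel edges between distinct $x,y$) and weights $w_v=|U_v|-1$: a $d$-claw is an induced subgraph consisting of an independent set $T_C$ of $d$ vertices and a center adjacent to all (a single vertex is a 1-claw); $N(S)$ = vertices adjacent to some vertex of $S$; $w_+^2(S)=\sum_{v\in S}(w_v+1)^2$; $C$ improves $w_+^2(A)$ if $w_+^2(A)<w_+^2((A\cup T_C)\setminus N(T_C))$. Start with $A=\emptyset$. Repeat: (a) while some claw $C$ improves $w_+^2(A)$, set $A\leftarrow(A\cup T_C)\setminus N(T_C)$; (b) $X=\bigcup\{U_v:v\in A,w_v=2\}$; $H$ := graph on $V'=\bigcup\{U_v:w_v=1,U_v\cap X=\emptyset\}$ with edge $xy$ whenever some $v$ has $U_v=\{x,y\}\subseteq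 V'$; $M=\{xy\in E(H):$ some $v\in A$ has $U_v=\{x,y\}\}$; (c) if $H$ has an $M$-augmenting path $P$ (alternating path between two $M$-uncovered vertices), replace $A$ by removing the vertices of $A$ whose sets are $M$-edges of $P$ and adding, for each non-$M$ edge $xy$ of $P$, a vertex $v$ with $U_v=\{x,y\}$; until no augmenting path exists. Return $A$. GreedyExpand$(D,t,F)$: set $F'\leftarrow F$; go through the nodes $v$ in arbitrary order; for each $v$ with out-degree 0 in the current $F'$, let $A_v$ be the arcs $vu$ of $D$ with $u$ of in-degree 0 in $F'$; if $|A_v|\ge t$ add $A_v$ to $F'$. Return $F'$. MaxLeaves-12MIS$(D)$ (input: rooted dag $D$): (1) $F_1$ := GreedyExpand$(D,4,F_0)$ where $F_0$ is the spanning branching with no arcs. (2) For each node $v$ with out-degree 0 in $F_1$, $U_v$ := nodes $u$ with in-degree 0 in $F_1$ and $vu\in A(D)$. (3) Candidates := nodes $v$ with out-degree 0 in $F_1$ and $2\le|U_v|\le3$; for each such $v$ with $|U_v|=3$ and each $u\in U_v$ add a new element $v_u$ with $U_{v_u}=U_v\setminus\{u\}$ and underlying node $v$ (nodes are their own underlying node). (4) $G$ := intersection multigraph on Candidates, weights $w_x=|U_x|-1$. (5) $I$ := Square$^+$Imp$(G,w)$. (6) $F_2$ := $F_1$ plus, for each $x\in I$ with underlying node $v$, the arcs $\{vu:u\in U_x\}$. (7) Return GreedyExpand$(D,1,F_2)$. *)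

theory Defs
  imports "Graph_Theory.Graph_Theory" "HOL-Computational_Algebra.Polynomial"
begin

section \<open>Rooted dags, arborescences, leaves\<close>

definition is_root :: "'a pair_pre_digraph \<Rightarrow> 'a \<Rightarrow> bool" where
  "is_root D r \<longleftrightarrow> r \<in> pverts D \<and> (\<forall>v \<in> pverts D. \<exists>p. pre_digraph.apath D r p v)"

definition rooted_dag :: "'a pair_pre_digraph \<Rightarrow> bool" where
  "rooted_dag D \<longleftrightarrow> pair_digraph D \<and> (\<nexists>p. pre_digraph.cycle D p) \<and> (\<exists>r. is_root D r)"

definition arborescence :: "'a pair_pre_digraph \<Rightarrow> bool" where
  "arborescence T \<longleftrightarrow> pair_digraph T \<and>
     (\<exists>r. is_root T r \<and> (\<forall>v \<in> pverts T. \<exists>!p. pre_digraph.apath T r p v))"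

definition spanning_arborescence :: "'a pair_pre_digraph \<Rightarrow> 'a pair_pre_digraph \<Rightarrow> bool" where
  "spanning_arborescence T D \<longleftrightarrow> arborescence T \<and> spanning T D"

definition num_leaves :: "'a pair_pre_digraph \<Rightarrow> nat" where
  "num_leaves T = card {v \<in> pverts T. out_degree T v = 0}"

definition max_leaves :: "'a pair_pre_digraph \<Rightarrow> nat" where
  "max_leaves D = Max (num_leaves ` {T. spanning_arborescence T D})"


section \<open>Independent sets in the intersection multigraph of a set family\<close>

text \<open>
  A family of sets is given by an index set \<open>V\<close> and a function \<open>U\<close>. An edge of the intersection
  multigraph is a pair of its two ends and a common element of their sets; the common element
  distinguishes parallel edges.
\<close>

definition mg_edges :: "'c set \<Rightarrow> ('c \<Rightarrow> 'a set) \<Rightarrow> ('c set \<times> 'a) set" where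
  "mg_edges V U = {({x, y}, a) | x y a. x \<in> V \<and> y \<in> V \<and> x \<noteq> y \<and> a \<in> U x \<inter> U y}"

definition adjacent :: "'c set \<Rightarrow> ('c \<Rightarrow> 'a set) \<Rightarrow> 'c \<Rightarrow> 'c \<Rightarrow> bool" where
  "adjacent V U x y \<longleftrightarrow> (\<exists>a. ({x, y}, a) \<in> mg_edges V U)"

definition independent_set :: "'c set \<Rightarrow> ('c \<Rightarrow> 'a set) \<Rightarrow> 'c set \<Rightarrow> bool" where
  "independent_set V U S \<longleftrightarrow> S \<subseteq> V \<and> (\<forall>x \<in> S. \<forall>y \<in> S. \<not> adjacent V U x y)"

definition neighbours :: "'c set \<Rightarrow> ('c \<Rightarrow> 'a set) \<Rightarrow> 'c set \<Rightarrow> 'c set" where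
  "neighbours V U S = {y \<in> V. \<exists>x \<in> S. adjacent V U x y}"

definition weight :: "('c \<Rightarrow> 'a set) \<Rightarrow> 'c \<Rightarrow> nat" where
  "weight U v = card (U v) - 1"

definition w2plus :: "('c \<Rightarrow> 'a set) \<Rightarrow> 'c set \<Rightarrow> nat" where
  "w2plus U S = (\<Sum>v \<in> S. (weight U v + 1)\<^sup>2)"

text \<open>\<open>claw V U C T\<close>: the vertex set \<open>C\<close> induces a claw with talons \<open>T\<close>.\<close>

definition claw :: "'c set \<Rightarrow> ('c \<Rightarrow> 'a set) \<Rightarrow> 'c set \<Rightarrow> 'c set \<Rightarrow> bool" where
  "claw V U C T \<longleftrightarrow> C \<subseteq> V \<and> independent_set V U T \<and> finite T \<and> T \<noteq> {} \<and>
     ((\<exists>v. C = {v} \<and> T = {v}) \<or> (\<exists>z. z \<notin> T \<and> C = insert z T \<and> (\<forall>t \<in> T. adjacent V U z t)))"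

definition claw_step :: "'c set \<Rightarrow> ('c \<Rightarrow> 'a set) \<Rightarrow> 'c set \<Rightarrow> 'c set \<Rightarrow> bool" where
  "claw_step V U A A' \<longleftrightarrow> (\<exists>C T. claw V U C T \<and>
     A' = (A \<union> T) - neighbours V U T \<and> w2plus U A < w2plus U A')"

definition heavy_union :: "('c \<Rightarrow> 'a set) \<Rightarrow> 'c set \<Rightarrow> 'a set" where
  "heavy_union U A = (\<Union>v \<in> {v \<in> A. weight U v = 2}. U v)"

definition H_verts :: "'c set \<Rightarrow> ('c \<Rightarrow> 'a set) \<Rightarrow> 'c set \<Rightarrow> 'a set" where
  "H_verts V U A = (\<Union>v \<in> {v \<in> V. weight U v = 1 \<and> U v \<inter> heavy_union U A = {}}. U v)"

definition H_edges :: "'c set \<Rightarrow> ('c \<Rightarrow> 'a set) \<Rightarrow> 'c set \<Rightarrow> 'a set set" where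
  "H_edges V U A = {{x, y} | x y. x \<noteq> y \<and> (\<exists>v \<in> V. U v = {x, y} \<and> U v \<subseteq> H_verts V U A)}"

definition H_matching :: "'c set \<Rightarrow> ('c \<Rightarrow> 'a set) \<Rightarrow> 'c set \<Rightarrow> 'a set set" where
  "H_matching V U A = {e \<in> H_edges V U A. \<exists>v \<in> A. U v = e}"

text \<open>Paths of an undirected graph are given by their lists of vertices.\<close>

definition path_edges :: "'a list \<Rightarrow> 'a set set" where
  "path_edges xs = {{xs ! i, xs ! Suc i} | i. Suc i < length xs}"

definition augmenting_path :: "'a set \<Rightarrow> 'a set set \<Rightarrow> 'a set set \<Rightarrow> 'a list \<Rightarrow> bool" where
  "augmenting_path W E M xs \<longleftrightarrow>
     distinct xs \<and> 2 \<le> length xs \<and> set xs \<subseteq> W \<and> path_edges xs \<subseteq> E \<and>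
     (\<forall>i. Suc (Suc i) < length xs \<longrightarrow>
        ({xs ! i, xs ! Suc i} \<in> M \<longleftrightarrow> {xs ! Suc i, xs ! Suc (Suc i)} \<notin> M)) \<and>
     hd xs \<notin> \<Union>M \<and> last xs \<notin> \<Union>M"

text \<open>The function \<open>g\<close> picks, for each new edge, a vertex of the multigraph whose set is that edge.\<close>

definition augment_step :: "'c set \<Rightarrow> ('c \<Rightarrow> 'a set) \<Rightarrow> 'c set \<Rightarrow> 'c set \<Rightarrow> bool" where
  "augment_step V U A A' \<longleftrightarrow> (\<exists>xs g. let M = H_matching V U A; P = path_edges xs in
     augmenting_path (H_verts V U A) (H_edges V U A) M xs \<and>
     (\<forall>e \<in> P - M. g e \<in> V \<and> U (g e) = e) \<and>
     A' = (A - {v \<in> A. U v \<in> M \<inter> P}) \<union> g ` (P - M))"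

text \<open>
  One change of the current set: augmenting paths are considered only when no claw improves.
  The results are the sets reached from the empty set at which neither kind of change is possible.
\<close>

definition square_imp_step :: "'c set \<Rightarrow> ('c \<Rightarrow> 'a set) \<Rightarrow> 'c set \<Rightarrow> 'c set \<Rightarrow> bool" where
  "square_imp_step V U A A' \<longleftrightarrow>
     claw_step V U A A' \<or> ((\<nexists>B. claw_step V U A B) \<and> augment_step V U A A')"

definition square_imp_result :: "'c set \<Rightarrow> ('c \<Rightarrow> 'a set) \<Rightarrow> 'c set \<Rightarrow> bool" where
  "square_imp_result V U A \<longleftrightarrow>
     (square_imp_step V U)\<^sup>*\<^sup>* {} A \<and> (\<nexists>B. square_imp_step V U A B)"


section \<open>The algorithm\<close>

text \<open>
  The algorithm leaves choices open (the orders of the nodes, the improving claws and the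
  augmenting paths), so it is rendered as a relation between inputs and possible outputs.
\<close>

definition expand_node ::
    "'a pair_pre_digraph \<Rightarrow> nat \<Rightarrow> 'a \<Rightarrow> 'a pair_pre_digraph \<Rightarrow> 'a pair_pre_digraph" where
  "expand_node D t v F = (let A = {e \<in> out_arcs D v. in_degree F (snd e) = 0} in
     if out_degree F v = 0 \<and> t \<le> card A then F\<lparr>parcs := parcs F \<union> A\<rparr> else F)"

definition greedy_expand ::
    "'a pair_pre_digraph \<Rightarrow> nat \<Rightarrow> 'a pair_pre_digraph \<Rightarrow> 'a pair_pre_digraph \<Rightarrow> bool" where
  "greedy_expand D t F F' \<longleftrightarrow>
     (\<exists>vs. distinct vs \<and> set vs = pverts D \<and> F' = fold (expand_node D t) vs F)"

definition no_arcs :: "'a pair_pre_digraph \<Rightarrow> 'a pair_pre_digraph" where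
  "no_arcs D = \<lparr>pverts = pverts D, parcs = {}\<rparr>"

definition free_heads :: "'a pair_pre_digraph \<Rightarrow> 'a pair_pre_digraph \<Rightarrow> 'a \<Rightarrow> 'a set" where
  "free_heads D F v = {u \<in> pverts D. in_degree F u = 0 \<and> (v, u) \<in> parcs D}"

text \<open>\<open>Drop v u\<close> is the element \<open>v\<^sub>u\<close>, whose set is that of \<open>v\<close> without \<open>u\<close>.\<close>

datatype 'a candidate = Orig (underlying: 'a) | Drop (underlying: 'a) 'a

fun candidate_set ::
    "'a pair_pre_digraph \<Rightarrow> 'a pair_pre_digraph \<Rightarrow> 'a candidate \<Rightarrow> 'a set" where
  "candidate_set D F (Orig v) = free_heads D F v"
| "candidate_set D F (Drop v u) = free_heads D F v - {u}"

definition candidates ::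
    "'a pair_pre_digraph \<Rightarrow> 'a pair_pre_digraph \<Rightarrow> 'a candidate set" where
  "candidates D F =
     {Orig v | v. v \<in> pverts D \<and> out_degree F v = 0 \<and>
        2 \<le> card (free_heads D F v) \<and> card (free_heads D F v) \<le> 3} \<union>
     {Drop v u | v u. v \<in> pverts D \<and> out_degree F v = 0 \<and>
        card (free_heads D F v) = 3 \<and> u \<in> free_heads D F v}"

definition add_selected :: "'a pair_pre_digraph \<Rightarrow> 'a pair_pre_digraph \<Rightarrow> 'a candidate set \<Rightarrow>
    'a pair_pre_digraph" where
  "add_selected D F I = F\<lparr>parcs := parcs F \<union>
     {(underlying x, u) | x u. x \<in> I \<and> u \<in> candidate_set D F x}\<rparr>"

definition max_leaves_12mis :: "'a pair_pre_digraph \<Rightarrow> 'a pair_pre_digraph \<Rightarrow> bool" where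
  "max_leaves_12mis D T \<longleftrightarrow> (\<exists>F1 I.
     greedy_expand D 4 (no_arcs D) F1 \<and>
     square_imp_result (candidates D F1) (candidate_set D F1) I \<and>
     greedy_expand D 1 (add_selected D F1 I) T)"


section \<open>Polynomial time\<close>

text \<open>
  The machine model is the WHILE language of N. D. Jones (Computability and Complexity from a
  Programming Perspective, 1997): programs over finitely many variables, which hold binary trees.
  A use of a variable costs the size of its value rather than a constant. So the cost of an
  expression is at least the size of each tree involved in its evaluation, building large trees by
  sharing is not free, and running times are polynomially related to those of Turing machines.
\<close>

datatype tree = Tip | Fork tree tree

datatype expr = Var nat | TipE | ForkE expr expr | Hd expr | Tl expr | EqE expr expr

datatype com = Assign nat expr | Seq com com | Cond expr com com | While expr com

type_synonym store = "nat \<Rightarrow> tree"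

fun left :: "tree \<Rightarrow> tree" where
  "left Tip = Tip"
| "left (Fork l r) = l"

fun right :: "tree \<Rightarrow> tree" where
  "right Tip = Tip"
| "right (Fork l r) = r"

fun eval_expr :: "expr \<Rightarrow> store \<Rightarrow> tree" where
  "eval_expr (Var x) s = s x"
| "eval_expr TipE s = Tip"
| "eval_expr (ForkE e f) s = Fork (eval_expr e s) (eval_expr f s)"
| "eval_expr (Hd e) s = left (eval_expr e s)"
| "eval_expr (Tl e) s = right (eval_expr e s)"
| "eval_expr (EqE e f) s = (if eval_expr e s = eval_expr f s then Fork Tip Tip else Tip)"

fun cost_expr :: "expr \<Rightarrow> store \<Rightarrow> nat" where
  "cost_expr (Var x) s = 1 + size (s x)"
| "cost_expr TipE s = 1"
| "cost_expr (ForkE e f) s = 1 + cost_expr e s + cost_expr f s"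
| "cost_expr (Hd e) s = 1 + cost_expr e s"
| "cost_expr (Tl e) s = 1 + cost_expr e s"
| "cost_expr (EqE e f) s = 1 + cost_expr e s + cost_expr f s"

text \<open>\<open>exec c s t s'\<close>: started in \<open>s\<close>, the program \<open>c\<close> halts in \<open>s'\<close> after time \<open>t\<close>.\<close>

inductive exec :: "com \<Rightarrow> store \<Rightarrow> nat \<Rightarrow> store \<Rightarrow> bool" where
  Assign: "exec (Assign x e) s (cost_expr e s) (s(x := eval_expr e s))"
| Seq: "exec c s t s' \<Longrightarrow> exec d s' t' s'' \<Longrightarrow> exec (Seq c d) s (t + t') s''"
| CondTrue: "eval_expr e s \<noteq> Tip \<Longrightarrow> exec c s t s' \<Longrightarrow> exec (Cond e c d) s (cost_expr e s + t) s'"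
| CondFalse: "eval_expr e s = Tip \<Longrightarrow> exec d s t s' \<Longrightarrow> exec (Cond e c d) s (cost_expr e s + t) s'"
| WhileFalse: "eval_expr e s = Tip \<Longrightarrow> exec (While e c) s (cost_expr e s) s"
| WhileTrue: "eval_expr e s \<noteq> Tip \<Longrightarrow> exec c s t s' \<Longrightarrow> exec (While e c) s' t' s'' \<Longrightarrow>
    exec (While e c) s (cost_expr e s + t + t') s''"

fun encode_nat :: "nat \<Rightarrow> tree" where
  "encode_nat 0 = Tip"
| "encode_nat (Suc n) = Fork Tip (encode_nat n)"

fun encode_arcs :: "(nat \<times> nat) list \<Rightarrow> tree" where
  "encode_arcs [] = Tip"
| "encode_arcs ((u, v) # as) = Fork (Fork (encode_nat u) (encode_nat v)) (encode_arcs as)"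

definition input_store :: "nat \<Rightarrow> (nat \<times> nat) list \<Rightarrow> store" where
  "input_store n as = (\<lambda>_. Tip)(0 := Fork (encode_nat n) (encode_arcs as))"

text \<open>
  A relation between digraphs and outputs on the same nodes is implemented in polynomial time if
  one program, given any instance as its number \<open>n\<close> of nodes (which are \<open>0, \<dots>, n - 1\<close>) and a list
  of its arcs, halts in time polynomial in \<open>n\<close> with the list of arcs of some output in variable \<open>0\<close>.
  The unary node names and the list of the at most \<open>n\<^sup>2\<close> arcs have size polynomial in \<open>n\<close>.
\<close>

definition polynomial_time_implementable :: "(nat pair_pre_digraph \<Rightarrow> bool) \<Rightarrow>
    (nat pair_pre_digraph \<Rightarrow> nat pair_pre_digraph \<Rightarrow> bool) \<Rightarrow> bool" where
  "polynomial_time_implementable inst R \<longleftrightarrow> (\<exists>c. \<exists>p :: nat poly. \<forall>n as.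
     distinct as \<longrightarrow> inst \<lparr>pverts = {..<n}, parcs = set as\<rparr> \<longrightarrow>
     (\<exists>t s bs. exec c (input_store n as) t s \<and> t \<le> poly p n \<and>
        s 0 = encode_arcs bs \<and> distinct bs \<and>
        R \<lparr>pverts = {..<n}, parcs = set as\<rparr> \<lparr>pverts = {..<n}, parcs = set bs\<rparr>))"

end

theory Submission
  imports Defs
begin

text \<open>
  Every spanning arborescence has at most 1 plus the number of arcs of \<open>F1\<close> plus the weight of some
  independent set leaves. The output has at least as many with the selected set \<open>I\<close> as the
  independent set, minus the number of inner nodes of \<open>F1\<close>, which is at most a quarter of the number
  of its arcs. So it suffices that the local search loses at most a factor 7/5 in weight.
  Let \<open>A\<close> be its result and \<open>J\<close> any independent set. Each element of a set of \<open>J\<close> that also lies in a set of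
  \<open>A\<close> receives a charge, so that the sets of \<open>J\<close> get 10 per unit of weight and the sets of \<open>A\<close> pay at
  most 14 per unit; the configurations in which a charge would be too large are excluded since no
  claw improves and the sets of size 2 form a maximum matching.

  The number of changes is bounded because each one increases the potential \<open>w2plus\<close>, which is at
  most 3 times the number of nodes. To run the search in polynomial time, claws have at most 3
  talons, and Edmonds' contraction of blossoms decides whether a matching is maximum. The functions
  computable by WHILE programs in polynomial time are closed under composition and under folds
  whose intermediate results stay polynomially small, so the algorithm is written with such folds.
\<close>

section \<open>Matchings and augmenting paths\<close>

text \<open>The constants fit together as follows. Let \<open>F1\<close> have m arcs and i inner
  nodes. An arborescence has at most 1 + m + w(J) leaves, the output at least 1 + m - i + w(I).
  Given 5 w(J) \<le> 7 w(I), the factor 7/5 only needs 7 i \<le> 2 m + 2, which follows from 4 i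
  \<le> m. The same threshold 4 leaves every unexpanded node at most 3 free heads, so the sets of
  the packing instance have at most 3 elements. The problem fixes a relation with free choices. The
  ratio is therefore proved for every run, and the program only has to realise one run. Lifting an
  augmenting path through nested contractions is avoided: contraction is used only to answer whether
  a larger matching exists, and the new edges are then found by deleting edges as long as the answer
  stays yes. Paths described by list indices are awkward for induction. They are replaced by an
  inductive predicate in which the matching shrinks together with the path.\<close>

definition matching :: "'a set set \<Rightarrow> bool" where
  "matching M \<longleftrightarrow> (\<forall>e\<in>M. card e = 2) \<and> (\<forall>e\<in>M. \<forall>f\<in>M. e \<noteq> f \<longrightarrow> e \<inter> f = {})"

lemma matching_subset: "matching M \<Longrightarrow> N \<subseteq> M \<Longrightarrow> matching N"
  unfolding matching_def by blast

lemma matching_unique: "matching M \<Longrightarrow> e \<in> M \<Longrightarrow> f \<in> M \<Longrightarrow> x \<in> e \<Longrightarrow> x \<in> f \<Longrightarrow> e = f"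
  unfolding matching_def by blast

lemma matching_insert:
  assumes "matching M" "x \<noteq> y" "x \<notin> \<Union>M" "y \<notin> \<Union>M"
  shows "matching (insert {x, y} M)"
  using assms unfolding matching_def by auto

lemma matching_Un:
  assumes "matching M" "matching N" "\<Union>M \<inter> \<Union>N = {}"
  shows "matching (M \<union> N)"
  unfolding matching_def
proof (intro conjI ballI impI)
  fix e f assume "e \<in> M \<union> N" "f \<in> M \<union> N" "e \<noteq> f"
  then consider "e \<in> M" "f \<in> M" | "e \<in> N" "f \<in> N" | "e \<inter> f \<subseteq> \<Union>M \<inter> \<Union>N" by auto
  then show "e \<inter> f = {}"
    using assms \<open>e \<noteq> f\<close> by cases (auto simp: matching_def)
qed (use assms in \<open>auto simp: matching_def\<close>)

lemma matching_edge_neq: "matching M \<Longrightarrow> {x, y} \<in> M \<Longrightarrow> x \<noteq> y"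
  unfolding matching_def by fastforce

lemma card_Union_matching:
  assumes "matching M" "finite M"
  shows "finite (\<Union>M)" "card (\<Union>M) = 2 * card M"
proof -
  have fin: "\<And>e. e \<in> M \<Longrightarrow> finite e"
    using assms(1) unfolding matching_def by (metis card.infinite zero_neq_numeral)
  then show "finite (\<Union>M)" using assms(2) by blast
  have "card (\<Union>M) = (\<Sum>e\<in>M. card e)"
    using assms fin by (intro card_Union_disjoint) (auto simp: matching_def disjoint_def pairwise_def disjnt_def)
  also have "\<dots> = (\<Sum>e\<in>M. 2)" using assms(1) by (intro sum.cong) (auto simp: matching_def)
  finally show "card (\<Union>M) = 2 * card M" by simp
qed

section \<open>Edge sets of paths given by vertex lists\<close>

lemma path_edges_Nil [simp]: "path_edges [] = {}" and path_edges_single [simp]: "path_edges [x] = {}"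
  by (auto simp: path_edges_def)

lemma path_edges_Cons_Cons [simp]:
  "path_edges (x # y # zs) = insert {x, y} (path_edges (y # zs))"
proof -
  have "{x, y} = {(x # y # zs) ! 0, (x # y # zs) ! Suc 0}" by simp
  then have 1: "{x, y} \<in> path_edges (x # y # zs)" unfolding path_edges_def by force
  have 2: "path_edges (y # zs) \<subseteq> path_edges (x # y # zs)"
  proof
    fix e assume "e \<in> path_edges (y # zs)"
    then obtain i where "Suc i < length (y # zs)" "e = {(y # zs) ! i, (y # zs) ! Suc i}"
      unfolding path_edges_def by blast
    then have "Suc (Suc i) < length (x # y # zs)"
      "e = {(x # y # zs) ! Suc i, (x # y # zs) ! Suc (Suc i)}" by auto
    then show "e \<in> path_edges (x # y # zs)" unfolding path_edges_def by blast
  qed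
  have "path_edges (x # y # zs) \<subseteq> insert {x, y} (path_edges (y # zs))"
  proof
    fix e assume "e \<in> path_edges (x # y # zs)"
    then obtain i where i: "Suc i < length (x # y # zs)"
      "e = {(x # y # zs) ! i, (x # y # zs) ! Suc i}" unfolding path_edges_def by blast
    show "e \<in> insert {x, y} (path_edges (y # zs))"
      using i by (cases i) (auto simp: path_edges_def)
  qed
  with 1 2 show ?thesis by blast
qed

lemma path_edges_append:
  "xs \<noteq> [] \<Longrightarrow> ys \<noteq> [] \<Longrightarrow>
    path_edges (xs @ ys) = insert {last xs, hd ys} (path_edges xs \<union> path_edges ys)"
proof (induction xs rule: induct_list012)
  case (2 x) then show ?case by (cases ys) auto
qed auto

lemma path_edges_rev [simp]: "path_edges (rev xs) = path_edges xs"
proof (induction xs rule: induct_list012)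
  case (3 x y zs)
  have "path_edges (rev (x # y # zs)) = path_edges (rev (y # zs) @ [x])" by simp
  also have "\<dots> = insert {y, x} (path_edges (rev (y # zs)))"
    by (subst path_edges_append) (auto simp: last_rev)
  finally show ?case using 3 by (simp add: insert_commute)
qed auto

lemma path_edges_vertices: "e \<in> path_edges xs \<Longrightarrow> e \<subseteq> set xs"
  by (auto simp: path_edges_def)

lemma vertices_path_edges: "2 \<le> length xs \<Longrightarrow> set xs \<subseteq> \<Union>(path_edges xs)"
proof (induction xs rule: induct_list012)
  case (3 x y zs)
  then show ?case by (cases zs) auto
qed auto

text \<open>Deleting the matching edge \<open>{y, z}\<close> exposes z, so the rest of the path is
  augmenting for the smaller matching. This makes the end condition the same at every level of the
  recursion, with no separate clause for alternation.\<close>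

inductive aug_path :: "'a set set \<Rightarrow> 'a set set \<Rightarrow> 'a list \<Rightarrow> bool" for E where
  base: "x \<noteq> y \<Longrightarrow> {x, y} \<in> E \<Longrightarrow> x \<notin> \<Union>M \<Longrightarrow> y \<notin> \<Union>M \<Longrightarrow> aug_path E M [x, y]"
| step: "aug_path E (M - {{y, z}}) (z # zs) \<Longrightarrow> {y, z} \<in> M \<Longrightarrow> {y, z} \<in> E \<Longrightarrow> {x, y} \<in> E \<Longrightarrow> x \<noteq> y \<Longrightarrow>
    x \<notin> \<Union>M \<Longrightarrow> x \<notin> set (z # zs) \<Longrightarrow> y \<notin> set (z # zs) \<Longrightarrow> aug_path E M (x # y # z # zs)"

text \<open>The first edge is outside M because its start is exposed, so alternation puts the second
  edge into M. The path cannot end there, since its last vertex is exposed too, and two edges can be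
  split off.\<close>

lemma augmenting_path_imp_aug_path:
  "matching M \<Longrightarrow> augmenting_path W E M xs \<Longrightarrow> aug_path E M xs"
proof (induction xs arbitrary: M rule: length_induct)
  case less: (1 xs)
  note ap = less.prems(2)[unfolded augmenting_path_def]
  then obtain x y ws where xs: "xs = x # y # ws" by (cases xs; cases "tl xs") auto
  show ?case
  proof (cases ws)
    case Nil
    then show ?thesis using ap xs by (auto intro!: aug_path.base)
  next
    case (Cons z zs)
    have alt: "\<And>i. Suc (Suc i) < length xs \<Longrightarrow>
        ({xs ! i, xs ! Suc i} \<in> M \<longleftrightarrow> {xs ! Suc i, xs ! Suc (Suc i)} \<notin> M)"
      using ap by blast
    have xy: "{x, y} \<notin> M" using ap xs by auto
    have yz: "{y, z} \<in> M" using alt[of 0] xy xs Cons by auto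
    have zs: "zs \<noteq> []" using ap xs Cons yz by auto
    let ?M = "M - {{y, z}}"
    \<comment> \<open>The vertex y is not on the remaining path, so removing \<open>{y, z}\<close>
      from M changes nothing for its edges.\<close>
    have mem: "e \<in> M \<longleftrightarrow> e \<in> ?M" if "e \<subseteq> set (z # zs)" for e
      using that ap xs Cons by auto
    have zM: "z \<notin> \<Union>?M" using matching_unique[OF less.prems(1) yz] by blast
    have "augmenting_path W E ?M (z # zs)"
      unfolding augmenting_path_def
    proof (intro conjI allI impI)
      fix i assume i: "Suc (Suc i) < length (z # zs)"
      let ?l = "z # zs"
      have "{?l ! i, ?l ! Suc i} \<in> M \<longleftrightarrow> {?l ! Suc i, ?l ! Suc (Suc i)} \<notin> M"
        using alt[of "Suc (Suc i)"] i xs Cons by simp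
      moreover have "{?l ! i, ?l ! Suc i} \<subseteq> set ?l" "{?l ! Suc i, ?l ! Suc (Suc i)} \<subseteq> set ?l"
        using i nth_mem[of i ?l] nth_mem[of "Suc i" ?l] nth_mem[of "Suc (Suc i)" ?l] by auto
      ultimately show "{?l ! i, ?l ! Suc i} \<in> ?M \<longleftrightarrow> {?l ! Suc i, ?l ! Suc (Suc i)} \<notin> ?M"
        using mem by blast
    qed (use ap xs Cons zs zM in \<open>auto simp: Suc_le_eq\<close>)
    then have "aug_path E ?M (z # zs)"
      using less.IH less.prems(1) xs Cons matching_subset[of M ?M] by auto
    then have "aug_path E M (x # y # z # zs)"
      using ap yz xs Cons by (intro aug_path.step) auto
    then show ?thesis using xs Cons by simp
  qed
qed

lemma aug_path_distinct: "aug_path E M xs \<Longrightarrow> distinct xs"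
  by (induction rule: aug_path.induct) auto

lemma aug_path_length: "aug_path E M xs \<Longrightarrow> 2 \<le> length xs"
  by (induction rule: aug_path.induct) auto

lemma aug_path_edges: "aug_path E M xs \<Longrightarrow> path_edges xs \<subseteq> E"
  by (induction rule: aug_path.induct) simp_all

lemma aug_path_hd: "aug_path E M xs \<Longrightarrow> hd xs \<notin> \<Union>M"
  by (induction rule: aug_path.induct) simp_all

lemma aug_path_last:
  assumes "aug_path E M xs" "matching M"
  shows "last xs \<notin> \<Union>M"
  using assms
proof (induction)
  case (step M y z zs x)
  have "zs \<noteq> []" using aug_path_length[OF step.hyps(1)] by auto
  moreover have "distinct (z # zs)" using aug_path_distinct[OF step.hyps(1)] .
  ultimately have l: "last (z # zs) \<noteq> z" "last (z # zs) \<in> set (z # zs)" by auto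
  have "last (z # zs) \<notin> \<Union>(M - {{y, z}})"
    using step.IH matching_subset[OF step.prems] by blast
  moreover have "last (z # zs) \<notin> {y, z}" using l step.hyps by blast
  ultimately have "last (z # zs) \<notin> \<Union>M" by blast
  then show ?case by simp
qed simp

lemma aug_path_interior: "aug_path E M xs \<Longrightarrow> set xs - {hd xs, last xs} \<subseteq> \<Union>M"
proof (induction rule: aug_path.induct)
  case (step M y z zs x)
  have "y \<in> \<Union>M" "z \<in> \<Union>M" using step.hyps(2) by blast+
  moreover have "set (z # zs) - {z, last (z # zs)} \<subseteq> \<Union>M" using step.IH by auto
  ultimately show ?case by (simp del: set_simps) (auto simp: subset_iff)
qed simp

lemmas aug_path_props = aug_path_distinct aug_path_length aug_path_edges aug_path_hd aug_path_last
  aug_path_interior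

lemma aug_path_imp_augmenting_path:
  assumes "aug_path E M xs" "matching M" "\<Union>E \<subseteq> W"
  shows "augmenting_path W E M xs"
proof -
  have "\<forall>i. Suc (Suc i) < length xs \<longrightarrow>
        ({xs ! i, xs ! Suc i} \<in> M \<longleftrightarrow> {xs ! Suc i, xs ! Suc (Suc i)} \<notin> M)"
    using assms(1,2)
  proof (induction)
    case (step M y z zs x)
    let ?l = "x # y # z # zs" and ?M = "M - {{y, z}}"
    have z: "z \<notin> \<Union>?M" using matching_unique[OF step.prems(1) step.hyps(2)] by blast
    have IH: "\<And>i. Suc (Suc i) < length (z # zs) \<Longrightarrow>
        ({(z # zs) ! i, (z # zs) ! Suc i} \<in> ?M \<longleftrightarrow>
         {(z # zs) ! Suc i, (z # zs) ! Suc (Suc i)} \<notin> ?M)"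
      using step.IH[OF matching_subset[OF step.prems(1)]] by simp
    have mem: "e \<in> M \<longleftrightarrow> e \<in> ?M" if "e \<subseteq> set (z # zs)" for e
      using that step.hyps by auto
    show ?case
    proof (intro allI impI)
      fix i assume i: "Suc (Suc i) < length ?l"
      consider "i = 0" | "i = 1" | j where "i = Suc (Suc j)" by (metis One_nat_def not0_implies_Suc)
      then show "{?l ! i, ?l ! Suc i} \<in> M \<longleftrightarrow> {?l ! Suc i, ?l ! Suc (Suc i)} \<notin> M"
      proof cases
        case 1 then show ?thesis using step by auto
      next
        case 2
        then obtain w ws where "zs = w # ws" using i by (cases zs) auto
        moreover have "{z, w} \<notin> M" using calculation z mem[of "{z, w}"] by auto
        ultimately show ?thesis using 2 step.hyps by simp
      next
        case 3
        let ?k = "z # zs"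
        have "{?k ! j, ?k ! Suc j} \<subseteq> set ?k" "{?k ! Suc j, ?k ! Suc (Suc j)} \<subseteq> set ?k"
          using i 3 nth_mem[of j ?k] nth_mem[of "Suc j" ?k] nth_mem[of "Suc (Suc j)" ?k] by auto
        note mem[OF this(1)] mem[OF this(2)]
        moreover have "Suc (Suc j) < length ?k" using i 3 by simp
        ultimately have "{?k ! j, ?k ! Suc j} \<in> M \<longleftrightarrow> {?k ! Suc j, ?k ! Suc (Suc j)} \<notin> M"
          using IH[of j] by (simp only:)
        then show ?thesis using 3 by simp
      qed
    qed
  qed auto
  moreover have "set xs \<subseteq> W"
    using vertices_path_edges[of xs] aug_path_props(2,3)[OF assms(1)] assms(3) by blast
  ultimately show ?thesis
    unfolding augmenting_path_def using aug_path_props[OF assms(1)] assms(2) by auto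
qed

lemma augmenting_path_rev:
  assumes "augmenting_path W E M xs"
  shows "augmenting_path W E M (rev xs)"
proof -
  have ne: "xs \<noteq> []" using assms by (auto simp: augmenting_path_def)
  have "{rev xs ! i, rev xs ! Suc i} \<in> M \<longleftrightarrow> {rev xs ! Suc i, rev xs ! Suc (Suc i)} \<notin> M"
    if i: "Suc (Suc i) < length xs" for i
  proof -
    define j where "j = length xs - Suc (Suc (Suc i))"
    have j: "Suc (Suc j) < length xs" "rev xs ! i = xs ! Suc (Suc j)"
      "rev xs ! Suc i = xs ! Suc j" "rev xs ! Suc (Suc i) = xs ! j"
      using i by (auto simp: rev_nth j_def Suc_diff_Suc)
    have "{xs ! j, xs ! Suc j} \<in> M \<longleftrightarrow> {xs ! Suc j, xs ! Suc (Suc j)} \<notin> M"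
      using assms j(1) unfolding augmenting_path_def by blast
    then show ?thesis unfolding j by (auto simp: insert_commute)
  qed
  then show ?thesis using assms ne by (auto simp: augmenting_path_def hd_rev last_rev)
qed

text \<open>The inductive form is directed; the detour through the index form is taken because that
  form is symmetric.\<close>

lemma aug_path_rev: "matching M \<Longrightarrow> aug_path E M xs \<Longrightarrow> aug_path E M (rev xs)"
  using aug_path_imp_augmenting_path[of E M xs "\<Union>E"] augmenting_path_rev
    augmenting_path_imp_aug_path by blast

lemma aug_path_mono: "aug_path E M xs \<Longrightarrow> E \<subseteq> F \<Longrightarrow> aug_path F M xs"
  by (induction rule: aug_path.induct) (auto intro!: aug_path.intros)

lemma aug_path_insert_matching:
  "aug_path E M xs \<Longrightarrow> e \<inter> set xs = {} \<Longrightarrow> aug_path E (insert e M) xs"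
proof (induction rule: aug_path.induct)
  case (step M y z zs x)
  have "insert e (M - {{y,z}}) = insert e M - {{y,z}}" using step.prems by auto
  then show ?case using step by (intro aug_path.step) auto
qed (auto intro!: aug_path.base)

text \<open>The symmetric difference along the whole path is the one along the tail, formed with M
  without \<open>{y, z}\<close>, plus the edge \<open>{x, y}\<close>. The two ends of this edge are
  uncovered there, so it can be inserted.\<close>

lemma aug_path_augments:
  assumes "aug_path E M xs" "matching M" "finite M"
  shows "matching ((M - path_edges xs) \<union> (path_edges xs - M))"
    "card ((M - path_edges xs) \<union> (path_edges xs - M)) = Suc (card M)"
    "\<Union>((M - path_edges xs) \<union> (path_edges xs - M)) \<subseteq> \<Union>M \<union> set xs"
  using assms
proof (induction)
  case (base x y M)
  have "{x, y} \<notin> M" using base by auto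
  then have eq: "M - path_edges [x, y] \<union> (path_edges [x, y] - M) = insert {x, y} M" by auto
  { case 1 then show ?case unfolding eq using base by (intro matching_insert) auto }
  { case 2 then show ?case unfolding eq using \<open>{x, y} \<notin> M\<close> by simp }
  { case 3 then show ?case by auto }
next
  case (step M y z zs x)
  let ?M = "M - {{y, z}}" and ?P = "path_edges (z # zs)"
  let ?N = "(?M - ?P) \<union> (?P - ?M)"
  have P: "\<And>e. e \<in> ?P \<Longrightarrow> y \<notin> e \<and> x \<notin> e"
    using step.hyps path_edges_vertices by blast
  have xy: "{x, y} \<notin> M" using step.hyps by auto
  have eq: "M - path_edges (x # y # z # zs) \<union> (path_edges (x # y # z # zs) - M) = insert {x, y} ?N"
    using P xy step.hyps by auto
  { case 1
    have yM: "y \<notin> \<Union>?M" using matching_unique[OF 1(1) step.hyps(2)] by blast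
    have "matching ?N" "\<Union>?N \<subseteq> \<Union>?M \<union> set (z # zs)"
      using step.IH matching_subset[OF 1(1)] 1(2) by auto
    then show ?case unfolding eq using yM step.hyps by (intro matching_insert) auto }
  { case 2
    have "card ?N = Suc (card ?M)" using step.IH(2) matching_subset[OF 2(1)] 2(2) by auto
    moreover have "finite ?N" using 2 by (auto simp: path_edges_def)
    moreover have "{x, y} \<notin> ?N" using P xy by blast
    moreover have "card M = Suc (card ?M)" using 2 step.hyps by (metis card_Suc_Diff1)
    ultimately show ?case unfolding eq by simp }
  { case 3
    have "\<Union>?N \<subseteq> \<Union>?M \<union> set (z # zs)"
      using step.IH(3) matching_subset[OF 3(1)] 3(2) by auto
    then show ?case unfolding eq by auto }
qed

text \<open>Instead of analysing the components of the symmetric difference, the proof removes one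
  edge from each matching. N covers more vertices than M, so some edge \<open>{x, y}\<close> of N
  has x exposed by M. If y is matched to z in M, the induction hypothesis for the matchings without
  \<open>{x, y}\<close> and \<open>{y, z}\<close> gives a path. Since z is exposed in the reduced M,
  it is an end of that path, which is then prolonged by y and x, or it is not on the path, and
  \<open>{y, z}\<close> can be put back.\<close>

theorem berge:
  assumes "matching M" "finite M" "matching N" "card M < card N"
  shows "\<exists>xs. aug_path (M \<union> N) M xs"
  using assms
proof (induction "card M" arbitrary: M N rule: less_induct)
  case less
  have finN: "finite N" using less.prems by (metis card.infinite not_less0)
  have "card (\<Union>M) < card (\<Union>N)" using less.prems finN by (simp add: card_Union_matching)
  then obtain x where x: "x \<in> \<Union>N" "x \<notin> \<Union>M"
    using card_Union_matching(1)[OF less.prems(1,2)] by (meson card_mono not_le subsetI)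
  then obtain e where e: "e \<in> N" "x \<in> e" by blast
  then obtain y where y: "e = {x, y}" "x \<noteq> y"
    using less.prems(3) unfolding matching_def by (metis card_2_iff insertE singletonD doubleton_eq_iff)
  show ?case
  proof (cases "y \<in> \<Union>M")
    case False
    then have "aug_path (M \<union> N) M [x, y]" using x y e by (intro aug_path.base) auto
    then show ?thesis by blast
  next
    case True
    then obtain f where f: "f \<in> M" "y \<in> f" by blast
    then obtain z where z: "f = {y, z}" "y \<noteq> z"
      using less.prems(1) unfolding matching_def by (metis card_2_iff insertE singletonD doubleton_eq_iff)
    let ?M = "M - {{y, z}}" and ?N = "N - {{x, y}}"
    have m: "matching ?M" "matching ?N" using less.prems matching_subset by blast+
    have "Suc (card ?M) = card M" "Suc (card ?N) = card N"
      using card_Suc_Diff1[OF less.prems(2) f(1)] card_Suc_Diff1[OF finN e(1)] z y by simp_all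
    then have "card ?M < card ?N" "card ?M < card M" using less.prems(4) by linarith+
    then obtain zs where zs: "aug_path (?M \<union> ?N) ?M zs" using less.hyps m less.prems(2) by blast
    have xy: "x \<notin> \<Union>?N" "y \<notin> \<Union>?N" "y \<notin> \<Union>?M" "x \<notin> \<Union>?M" "z \<notin> \<Union>?M"
    proof -
      have 1: "\<And>w g. w \<in> {x, y} \<Longrightarrow> g \<in> N \<Longrightarrow> w \<in> g \<Longrightarrow> g = {x, y}"
        using matching_unique[OF less.prems(3)] e(1) y(1) by metis
      have 2: "\<And>w g. w \<in> {y, z} \<Longrightarrow> g \<in> M \<Longrightarrow> w \<in> g \<Longrightarrow> g = {y, z}"
        using matching_unique[OF less.prems(1)] f(1) z(1) by metis
      show "x \<notin> \<Union>?N" "y \<notin> \<Union>?N" using 1 by blast+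
      show "y \<notin> \<Union>?M" "z \<notin> \<Union>?M" using 2 by blast+
      show "x \<notin> \<Union>?M" using x(2) by blast
    qed
    \<comment> \<open>The path only uses edges of the reduced matchings, and neither of them covers
      x or y.\<close>
    have "set zs \<subseteq> \<Union>(?M \<union> ?N)"
      by (rule order_trans[OF vertices_path_edges[OF aug_path_length[OF zs]]
            Union_mono[OF aug_path_edges[OF zs]]])
    moreover have "x \<notin> \<Union>(?M \<union> ?N)" "y \<notin> \<Union>(?M \<union> ?N)" unfolding Union_Un_distrib Un_iff using xy by iprover+
    ultimately have nxy: "x \<notin> set zs" "y \<notin> set zs" by (meson subsetD)+
    have big: "aug_path (M \<union> N) ?M zs" using zs aug_path_mono by blast
    have ext: "\<exists>xs. aug_path (M \<union> N) M xs"
      if ws: "aug_path (M \<union> N) ?M ws" "hd ws = z" "set ws = set zs" for ws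
    proof -
      obtain ws' where "ws = z # ws'" using ws aug_path_props(2)[OF ws(1)] by (cases ws) auto
      then have "aug_path (M \<union> N) M (x # y # z # ws')"
        using ws nxy x y z e f by (intro aug_path.step) auto
      then show ?thesis by blast
    qed
    consider "hd zs = z" | "last zs = z" | "z \<notin> set zs"
      using aug_path_props(6)[OF zs] xy by blast
    then show ?thesis
    proof cases
      case 1 then show ?thesis using ext big by blast
    next
      case 2
      have "zs \<noteq> []" using aug_path_props(2)[OF zs] by auto
      then show ?thesis using ext[of "rev zs"] aug_path_rev[OF m(1) big] 2 by (simp add: hd_rev)
    next
      case 3
      have "aug_path (M \<union> N) (insert {y, z} ?M) zs"
        using big 3 nxy by (intro aug_path_insert_matching) auto
      moreover have "insert {y, z} ?M = M" using f z by blast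
      ultimately show ?thesis by auto
    qed
  qed
qed

section \<open>Local search for set packing\<close>

lemma adjacent_iff: "adjacent V U x y \<longleftrightarrow> x \<in> V \<and> y \<in> V \<and> x \<noteq> y \<and> U x \<inter> U y \<noteq> {}"
  unfolding adjacent_def mg_edges_def by (auto simp: doubleton_eq_iff)

lemma independent_set_iff:
  "independent_set V U S \<longleftrightarrow> S \<subseteq> V \<and> (\<forall>x\<in>S. \<forall>y\<in>S. x \<noteq> y \<longrightarrow> U x \<inter> U y = {})"
  unfolding independent_set_def adjacent_iff by blast

text \<open>An abstraction of the candidate family. \<open>drop_one\<close> is what the added
  elements provide: every pair inside a set of the family is itself a set of the family, see
  \<open>pair_candidate\<close>.\<close>

locale packing =
  fixes V :: "'c set" and U :: "'c \<Rightarrow> 'a set"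
  assumes finite_V: "finite V"
    and card_U: "v \<in> V \<Longrightarrow> card (U v) = 2 \<or> card (U v) = 3"
    and drop_one: "v \<in> V \<Longrightarrow> card (U v) = 3 \<Longrightarrow> a \<in> U v \<Longrightarrow> \<exists>v'\<in>V. U v' = U v - {a}"
begin

abbreviation "indep \<equiv> independent_set V U"

lemma finite_U: "v \<in> V \<Longrightarrow> finite (U v)"
  using card_U[of v] by (metis card.infinite zero_neq_numeral)

lemma U_nonempty: "v \<in> V \<Longrightarrow> U v \<noteq> {}"
  using card_U[of v] by auto

lemma w2plus_eq: "S \<subseteq> V \<Longrightarrow> w2plus U S = (\<Sum>v\<in>S. (card (U v))\<^sup>2)"
  unfolding w2plus_def weight_def using card_U by (intro sum.cong) fastforce+

lemma indep_unique: "indep S \<Longrightarrow> x \<in> S \<Longrightarrow> y \<in> S \<Longrightarrow> a \<in> U x \<Longrightarrow> a \<in> U y \<Longrightarrow> x = y"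
  unfolding independent_set_iff by blast

lemma indep_inj: "indep S \<Longrightarrow> inj_on U S"
proof (rule inj_onI)
  fix x y assume S: "indep S" and xy: "x \<in> S" "y \<in> S" "U x = U y"
  then have "x \<in> V" by (auto simp: independent_set_iff)
  then obtain a where "a \<in> U x" using U_nonempty by blast
  then show "x = y" using indep_unique[OF S xy(1,2), of a] xy(3) by simp
qed

lemma indep_finite: "indep S \<Longrightarrow> finite S"
  using finite_V finite_subset unfolding independent_set_iff by blast

lemma pair_candidate:
  assumes "v \<in> V" "a \<in> U v" "b \<in> U v" "a \<noteq> b"
  shows "\<exists>v'\<in>V. U v' = {a, b}"
  using card_U[OF assms(1)]
proof
  assume "card (U v) = 2"
  then have "U v = {a, b}" using assms by (auto simp: card_2_iff)
  then show ?thesis using assms by blast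
next
  assume 3: "card (U v) = 3"
  then obtain x y z where "U v = {x, y, z}" "x \<noteq> y" "y \<noteq> z" "x \<noteq> z" by (auto simp: card_3_iff)
  then obtain c where "c \<in> U v" "U v - {c} = {a, b}" using assms by auto
  then show ?thesis using drop_one[OF assms(1) 3] by metis
qed

text \<open>A set of size 2 or 3 contributes 4 \<le> 3 * 2 or 9 \<le> 3 * 3, and the sets of an
  independent family are disjoint.\<close>

lemma indep_w2plus_le:
  assumes "indep S"
  shows "w2plus U S \<le> 3 * card (\<Union>v\<in>V. U v)"
proof -
  have S: "S \<subseteq> V" "finite S" using assms indep_finite by (auto simp: independent_set_iff)
  have "w2plus U S \<le> (\<Sum>v\<in>S. 3 * card (U v))"
    unfolding w2plus_eq[OF S(1)]
  proof (rule sum_mono)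
    fix v assume "v \<in> S"
    then have "card (U v) = 2 \<or> card (U v) = 3" using card_U S(1) by blast
    then show "(card (U v))\<^sup>2 \<le> 3 * card (U v)" by auto
  qed
  also have "\<dots> = 3 * card (\<Union>v\<in>S. U v)"
    using assms S finite_U by (subst card_UN_disjoint) (auto simp: independent_set_iff sum_distrib_left)
  also have "\<dots> \<le> 3 * card (\<Union>v\<in>V. U v)"
    using S finite_V finite_U by (intro mult_left_mono card_mono) auto
  finally show ?thesis .
qed

text \<open>The members of A that leave when T enters. A member of A that is itself a talon is
  included, since its nonempty set meets itself; so an exchange is exactly removing
  \<open>hits A T\<close> and adding T.\<close>

definition hits :: "'c set \<Rightarrow> 'c set \<Rightarrow> 'c set" where
  "hits A T = {a\<in>A. \<exists>t\<in>T. U a \<inter> U t \<noteq> {}}"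

lemma claw_exchange:
  assumes "indep A" "indep T"
  shows "indep ((A \<union> T) - neighbours V U T)"
    "w2plus U ((A \<union> T) - neighbours V U T) + w2plus U (hits A T) = w2plus U A + w2plus U T"
proof -
  have AT: "A \<subseteq> V" "T \<subseteq> V" "finite A" "finite T"
    using assms indep_finite by (auto simp: independent_set_iff)
  have eq: "(A \<union> T) - neighbours V U T = (A - hits A T) \<union> T"
    using AT assms U_nonempty unfolding neighbours_def hits_def independent_set_iff adjacent_iff by blast
  show "indep ((A \<union> T) - neighbours V U T)"
    unfolding eq using assms unfolding independent_set_iff hits_def by blast
  have disj: "(A - hits A T) \<inter> T = {}" using AT U_nonempty unfolding hits_def by fast
  have "w2plus U ((A - hits A T) \<union> T) = w2plus U (A - hits A T) + w2plus U T"
    unfolding w2plus_def using AT disj by (intro sum.union_disjoint) auto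
  moreover have "w2plus U A = w2plus U (A - hits A T) + w2plus U (hits A T)"
    unfolding w2plus_def using AT by (intro sum.subset_diff) (auto simp: hits_def)
  ultimately show "w2plus U ((A \<union> T) - neighbours V U T) + w2plus U (hits A T) = w2plus U A + w2plus U T"
    unfolding eq by simp
qed

section \<open>Light and heavy members, and the auxiliary graph H\<close>

definition light :: "'c set \<Rightarrow> 'c set" where "light A = {v\<in>A. card (U v) = 2}"
definition heavy :: "'c set \<Rightarrow> 'c set" where "heavy A = {v\<in>A. card (U v) = 3}"

lemma light_heavy: "A \<subseteq> V \<Longrightarrow> A = light A \<union> heavy A" "light A \<inter> heavy A = {}"
  using card_U unfolding light_def heavy_def by auto

lemma heavy_union_eq: "heavy_union U A = (\<Union>v\<in>heavy A. U v)"
  unfolding heavy_union_def weight_def heavy_def by auto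

text \<open>The vertex set of H disappears from the description: it is disjoint from the heavy sets,
  and conversely a 2-set that avoids the heavy sets contributes its own two elements to it.\<close>

lemma H_edges_iff:
  "e \<in> H_edges V U A \<longleftrightarrow> card e = 2 \<and> e \<inter> heavy_union U A = {} \<and> (\<exists>v\<in>V. U v = e)"
proof
  assume "e \<in> H_edges V U A"
  then obtain x y v where e: "e = {x, y}" "x \<noteq> y" "v \<in> V" "U v = {x, y}" "U v \<subseteq> H_verts V U A"
    unfolding H_edges_def by blast
  have "H_verts V U A \<inter> heavy_union U A = {}" unfolding H_verts_def by blast
  then show "card e = 2 \<and> e \<inter> heavy_union U A = {} \<and> (\<exists>v\<in>V. U v = e)" using e by auto
next
  assume e: "card e = 2 \<and> e \<inter> heavy_union U A = {} \<and> (\<exists>v\<in>V. U v = e)"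
  then obtain v x y where "v \<in> V" "U v = e" "e = {x, y}" "x \<noteq> y" by (auto simp: card_2_iff)
  moreover from this have "U v \<subseteq> H_verts V U A" unfolding H_verts_def weight_def using e by auto
  ultimately show "e \<in> H_edges V U A" unfolding H_edges_def by blast
qed

lemma Union_H_edges: "\<Union>(H_edges V U A) \<subseteq> H_verts V U A"
  unfolding H_edges_def by auto

lemma H_matching_eq:
  assumes "indep A"
  shows "H_matching V U A = U ` light A"
proof -
  have "U v \<inter> heavy_union U A = {}" if "v \<in> light A" for v
    using that assms unfolding heavy_union_eq heavy_def light_def independent_set_iff by fastforce
  then have "U v \<in> H_edges V U A" if "v \<in> light A" for v
    using that assms unfolding H_edges_iff light_def independent_set_iff by blast
  then show ?thesis unfolding H_matching_def by (auto simp: H_edges_iff light_def)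
qed

lemma matching_light: "indep A \<Longrightarrow> matching (U ` light A)"
  unfolding matching_def light_def independent_set_iff by (auto simp: Ball_def)

text \<open>The heavy members stay, and U maps the remaining members of \<open>A'\<close>
  bijectively onto the augmented matching. That matching consists of edges of H, so it avoids the
  heavy sets; it has one more edge, and the potential grows by 4.\<close>

lemma augment_step_indep:
  assumes A: "indep A" and step: "augment_step V U A A'"
  shows "indep A'" "w2plus U A < w2plus U A'"
proof -
  have AV: "A \<subseteq> V" and finA: "finite A" using A indep_finite by (auto simp: independent_set_iff)
  define M where "M = H_matching V U A"
  obtain xs g where aug: "augmenting_path (H_verts V U A) (H_edges V U A) M xs"
    and g: "\<And>e. e \<in> path_edges xs - M \<Longrightarrow> g e \<in> V \<and> U (g e) = e"
    and A': "A' = (A - {v \<in> A. U v \<in> M \<inter> path_edges xs}) \<union> g ` (path_edges xs - M)"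
    using step unfolding augment_step_def Let_def M_def by blast
  have M: "M = U ` light A" unfolding M_def by (rule H_matching_eq[OF A])
  have mM: "matching M" "finite M" using matching_light[OF A] finA unfolding M light_def by auto
  have ap: "aug_path (H_edges V U A) M xs" using augmenting_path_imp_aug_path[OF mM(1) aug] .
  let ?P = "path_edges xs"
  define N where "N = (M - ?P) \<union> (?P - M)"
  have N: "matching N" "card N = Suc (card M)"
    using aug_path_augments[OF ap mM] unfolding N_def by auto
  define L where "L = {v\<in>light A. U v \<notin> ?P}"
  define G where "G = g ` (?P - M)"
  have PH: "?P \<subseteq> H_edges V U A" using aug_path_edges[OF ap] .
  have c2: "\<And>v. v \<in> A \<Longrightarrow> U v \<in> M \<Longrightarrow> v \<in> light A" using AV unfolding M light_def by auto
  have eqA': "A' = heavy A \<union> (L \<union> G)"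
  proof -
    have "heavy A \<inter> {v. U v \<in> M} = {}" unfolding heavy_def M light_def by auto
    moreover have "heavy A \<subseteq> A" "\<And>v. v \<in> light A \<Longrightarrow> U v \<in> M \<and> v \<in> A" unfolding heavy_def M light_def by auto
    ultimately have "A - {v \<in> A. U v \<in> M \<inter> ?P} = heavy A \<union> L"
      using light_heavy(1)[OF AV] c2 unfolding L_def by blast
    then show ?thesis unfolding A' G_def by blast
  qed
  have UL: "U ` L = M - ?P" unfolding L_def M by auto
  have UG: "U ` G = ?P - M" unfolding G_def using g by (auto simp: image_iff)
  have UN: "U ` (L \<union> G) = N" unfolding N_def image_Un UL UG by blast
  have injL: "inj_on U L" using indep_inj[OF A] unfolding L_def light_def by (rule inj_on_subset) auto
  have injG: "inj_on U G" unfolding G_def using g by (auto simp: inj_on_def)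
  have inj: "inj_on U (L \<union> G)"
    using injL injG UL UG by (subst inj_on_Un) blast
  have LGV: "L \<union> G \<subseteq> V" "heavy A \<subseteq> V" using AV g unfolding L_def light_def heavy_def G_def by auto
  have NH: "N \<subseteq> H_edges V U A" using PH unfolding N_def M_def H_matching_def by blast
  have hd: "U x \<inter> U y = {}" if "x \<in> heavy A" "y \<in> L \<union> G" for x y
  proof -
    have "U y \<in> H_edges V U A" using that(2) UN NH by blast
    then show ?thesis using that(1) unfolding H_edges_iff heavy_union_eq by blast
  qed
  show ind: "indep A'"
    unfolding independent_set_iff eqA'
  proof (intro conjI ballI impI)
    show "heavy A \<union> (L \<union> G) \<subseteq> V" using LGV by blast
    fix x y assume xy: "x \<in> heavy A \<union> (L \<union> G)" "y \<in> heavy A \<union> (L \<union> G)" "x \<noteq> y"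
    consider "x \<in> heavy A" "y \<in> heavy A" | "x \<in> heavy A" "y \<in> L \<union> G" | "y \<in> heavy A" "x \<in> L \<union> G"
      | "x \<in> L \<union> G" "y \<in> L \<union> G" using xy by blast
    then show "U x \<inter> U y = {}"
    proof cases
      case 1 then show ?thesis using A xy(3) unfolding independent_set_iff heavy_def by blast
    next
      case 2 then show ?thesis using hd by blast
    next
      case 3 then show ?thesis using hd by blast
    next
      case 4
      then have "U x \<in> N" "U y \<in> N" "U x \<noteq> U y"
        using UN inj_onD[OF inj] xy(3) by blast+
      then show ?thesis using N(1) unfolding matching_def by blast
    qed
  qed
  have disj: "heavy A \<inter> (L \<union> G) = {}" using hd U_nonempty LGV by blast
  have fin: "finite (heavy A)" "finite (L \<union> G)" using LGV finite_V finite_subset by blast+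
  have cLG: "card (L \<union> G) = card N" using card_image[OF inj] UN by simp
  have cl: "card (light A) = card M"
    unfolding M using card_image[of U "light A"] indep_inj[OF A] unfolding light_def by (metis (no_types, lifting) inj_on_subset mem_Collect_eq subsetI)
  have two: "\<And>v. v \<in> L \<union> G \<Longrightarrow> card (U v) = 2" using UN N(1) unfolding matching_def by blast
  have "w2plus U A' = w2plus U (heavy A) + w2plus U (L \<union> G)"
    unfolding w2plus_def eqA' using fin disj by (intro sum.union_disjoint)
  moreover have "w2plus U A = w2plus U (heavy A) + w2plus U (light A)"
  proof -
    have "finite (light A)" using finA unfolding light_def by simp
    then have "w2plus U (heavy A \<union> light A) = w2plus U (heavy A) + w2plus U (light A)"
      unfolding w2plus_def using light_heavy(2)[of A] fin by (intro sum.union_disjoint) blast+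
    then show ?thesis using light_heavy(1)[OF AV] by (simp add: Un_commute)
  qed
  moreover have "w2plus U (L \<union> G) = 4 * card N"
    unfolding w2plus_eq[OF LGV(1)] cLG[symmetric] using two by simp
  moreover have "w2plus U (light A) = 4 * card M"
    using w2plus_eq[of "light A"] AV unfolding cl[symmetric] light_def by (simp add: subset_iff)
  ultimately show "w2plus U A < w2plus U A'" using N(2) by simp
qed

lemma square_imp_step_indep:
  assumes "indep A" "square_imp_step V U A A'"
  shows "indep A'" "w2plus U A < w2plus U A'"
proof -
  have "indep A' \<and> w2plus U A < w2plus U A'"
    using assms(2) unfolding square_imp_step_def
  proof (elim disjE conjE)
    assume "claw_step V U A A'"
    then obtain C T where "claw V U C T" "A' = (A \<union> T) - neighbours V U T" "w2plus U A < w2plus U A'"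
      unfolding claw_step_def by blast
    then show ?thesis using claw_exchange(1)[OF assms(1), of T] unfolding claw_def by blast
  qed (use augment_step_indep[OF assms(1)] in blast)
  then show "indep A'" "w2plus U A < w2plus U A'" by blast+
qed

lemma square_imp_steps_indep:
  "(square_imp_step V U ^^ k) {} A \<Longrightarrow> indep A \<and> k \<le> w2plus U A"
proof (induction k arbitrary: A)
  case 0 then show ?case by (simp add: independent_set_iff)
next
  case (Suc k)
  then obtain B where "(square_imp_step V U ^^ k) {} B" "square_imp_step V U B A" by auto
  then show ?case using Suc.IH square_imp_step_indep[of B A] by fastforce
qed

lemma square_imp_steps_bound:
  "(square_imp_step V U ^^ k) {} A \<Longrightarrow> k \<le> 3 * card (\<Union>v\<in>V. U v)"
  using square_imp_steps_indep[of k A] indep_w2plus_le[of A] by linarith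

lemma square_imp_result_indep: "square_imp_result V U A \<Longrightarrow> indep A"
  unfolding square_imp_result_def using square_imp_steps_indep by (metis rtranclp_power)

lemma claw_local_opt:
  assumes "indep A" "\<nexists>B. claw_step V U A B" "claw V U C T"
  shows "w2plus U T \<le> w2plus U (hits A T)"
proof -
  have "indep T" using assms(3) unfolding claw_def by blast
  moreover have "w2plus U ((A \<union> T) - neighbours V U T) \<le> w2plus U A"
    using assms(2,3) unfolding claw_step_def by (meson not_le)
  ultimately show ?thesis using claw_exchange(2)[OF assms(1), of T] by linarith
qed

lemma single_claw: "v \<in> V \<Longrightarrow> claw V U {v} {v}"
  unfolding claw_def independent_set_iff by auto

lemma centre_claw:
  assumes "z \<in> V" "indep T" "T \<noteq> {}" "z \<notin> T" "\<And>t. t \<in> T \<Longrightarrow> U t \<inter> U z \<noteq> {}"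
  shows "claw V U (insert z T) T"
proof -
  have T: "T \<subseteq> V" using assms(2) by (simp add: independent_set_iff)
  then have "\<forall>t\<in>T. adjacent V U z t" using assms unfolding adjacent_iff by (metis Int_commute subsetD)
  then have "\<exists>z'. z' \<notin> T \<and> insert z T = insert z' T \<and> (\<forall>t\<in>T. adjacent V U z' t)" using assms(4) by blast
  then show ?thesis using T assms indep_finite[OF assms(2)] unfolding claw_def by simp
qed

text \<open>The form in which maximality of the matching is used. If each set of P contains a pair
  that avoids the heavy members and meets light members only inside K, then exchanging K for these
  disjoint pairs gives a matching of H. Were P larger than K, Berge's theorem would give an
  augmenting path.\<close>

lemma matching_local_opt:
  assumes A: "indep A" and nostep: "\<nexists>B. square_imp_step V U A B"
    and K: "K \<subseteq> light A" and J: "indep J" "P \<subseteq> J"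
    and P: "\<And>j. j \<in> P \<Longrightarrow> \<exists>e\<subseteq>U j. card e = 2 \<and> e \<inter> (\<Union>v\<in>heavy A. U v) = {} \<and>
      e \<inter> (\<Union>v\<in>light A. U v) \<subseteq> (\<Union>v\<in>K. U v)"
  shows "card P \<le> card K"
proof (rule ccontr)
  assume "\<not> card P \<le> card K"
  obtain f where f: "\<And>j. j \<in> P \<Longrightarrow> f j \<subseteq> U j \<and> card (f j) = 2 \<and> f j \<inter> (\<Union>v\<in>heavy A. U v) = {} \<and>
      f j \<inter> (\<Union>v\<in>light A. U v) \<subseteq> (\<Union>v\<in>K. U v)" using P by metis
  have AV: "A \<subseteq> V" and finA: "finite A" using A indep_finite by (auto simp: independent_set_iff)
  define M where "M = U ` light A"
  \<comment> \<open>The competing matching: K leaves and the chosen pairs enter.\<close>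
  define N where "N = U ` (light A - K) \<union> f ` P"
  have mM: "matching M" "finite M" using matching_light[OF A] finA unfolding M_def light_def by auto
  have disj: "f i \<inter> f j = {}" if "i \<in> P" "j \<in> P" "i \<noteq> j" for i j
    using that f J unfolding independent_set_iff by blast
  have ne: "f j \<noteq> {}" if "j \<in> P" for j using f[OF that] by auto
  have injf: "inj_on f P" using disj ne by (metis inf.idem inj_onI)
  have mP: "matching (f ` P)" unfolding matching_def using f disj by (metis imageE)
  have sep: "U x \<inter> f j = {}" if x: "x \<in> light A - K" and j: "j \<in> P" for x j
  proof (rule ccontr)
    assume "U x \<inter> f j \<noteq> {}"
    then obtain a where a: "a \<in> U x" "a \<in> f j" by blast
    then obtain y where "y \<in> K" "a \<in> U y" using f[OF j] x by blast
    then have "x = y" using indep_unique[OF A _ _ a(1)] x K unfolding light_def by blast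
    then show False using x \<open>y \<in> K\<close> by blast
  qed
  have mN: "matching N"
    unfolding N_def using mP
  proof (intro matching_Un)
    show "\<Union>(U ` (light A - K)) \<inter> \<Union>(f ` P) = {}"
    proof (rule equals0I, elim IntE UnionE imageE)
      fix a e e' x j assume a: "a \<in> e" "a \<in> e'" and e: "e = U x" "e' = f j" and x: "x \<in> light A - K" and j: "j \<in> P"
      show False using sep[OF x j] a e by auto
    qed
    show "matching (U ` (light A - K))"
      by (rule matching_subset[OF mM(1)]) (simp add: M_def image_mono)
  qed
  have finP: "finite P" using J indep_finite finite_subset by blast
  have "card N = card (U ` (light A - K)) + card (f ` P)"
    unfolding N_def
  proof (intro card_Un_disjoint)
    show "U ` (light A - K) \<inter> f ` P = {}"
    proof (rule equals0I, elim IntE imageE)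
      fix e x j assume e: "e = U x" "e = f j" and x: "x \<in> light A - K" and j: "j \<in> P"
      show False using sep[OF x j] ne[OF j] e by simp
    qed
  qed (use finA finP in \<open>auto simp: light_def\<close>)
  moreover have "card (U ` (light A - K)) = card (light A) - card K" "card M = card (light A)"
  proof -
    have inj: "inj_on U (light A)" using indep_inj[OF A] unfolding light_def by (rule inj_on_subset) auto
    then show "card M = card (light A)" unfolding M_def by (rule card_image)
    have "card (U ` (light A - K)) = card (light A - K)"
      using inj by (intro card_image) (rule inj_on_subset, auto)
    then show "card (U ` (light A - K)) = card (light A) - card K"
      using K finA by (simp add: card_Diff_subset finite_subset light_def)
  qed
  moreover have "card (f ` P) = card P" using card_image[OF injf] .
  moreover have "card K \<le> card (light A)" using K finA by (intro card_mono) (auto simp: light_def)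
  ultimately have "card M < card N" using \<open>\<not> card P \<le> card K\<close> by linarith
  then obtain xs where "aug_path (M \<union> N) M xs" using berge[OF mM mN] by blast
  moreover have "M \<union> N \<subseteq> H_edges V U A"
  proof
    fix e assume "e \<in> M \<union> N"
    then consider "e \<in> M" | j where "j \<in> P" "e = f j" unfolding M_def N_def by blast
    then show "e \<in> H_edges V U A"
    proof cases
      case 1
      then have "e \<in> H_matching V U A" using H_matching_eq[OF A] unfolding M_def by simp
      then show ?thesis unfolding H_matching_def by blast
    next
      case 2
      obtain a b where ab: "e = {a, b}" "a \<noteq> b" using f[OF 2(1)] 2(2) by (auto simp: card_2_iff)
      moreover have "j \<in> V" "a \<in> U j" "b \<in> U j" using ab 2 f[OF 2(1)] J unfolding independent_set_iff by auto
      ultimately show ?thesis using pair_candidate[of j a b] f[OF 2(1)] 2 unfolding H_edges_iff heavy_union_eq by simp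
    qed
  qed
  ultimately have "aug_path (H_edges V U A) M xs" by (rule aug_path_mono)
  then have ap: "augmenting_path (H_verts V U A) (H_edges V U A) M xs"
    using aug_path_imp_augmenting_path[OF _ mM(1)] Union_H_edges by blast
  obtain g where g: "\<forall>e\<in>path_edges xs - M. g e \<in> V \<and> U (g e) = e"
  proof -
    have "\<forall>e\<in>path_edges xs - M. \<exists>v. v \<in> V \<and> U v = e"
      using ap unfolding augmenting_path_def by (auto simp: H_edges_iff subset_iff)
    then show ?thesis using that by metis
  qed
  have "\<exists>B. augment_step V U A B"
    unfolding augment_step_def Let_def H_matching_eq[OF A] M_def[symmetric] using ap g by blast
  then show False using nostep unfolding square_imp_step_def by blast
qed

end

section \<open>The ratio 7/5\<close>

locale packing_opt = packing V U for V :: "'c set" and U :: "'c \<Rightarrow> 'a set" +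
  fixes A J :: "'c set"
  assumes indep_A: "indep A" and indep_J: "indep J"
    and no_step: "\<nexists>B. square_imp_step V U A B"
begin

definition X :: "'a set" where "X = (\<Union>v\<in>heavy A. U v)"
definition Y :: "'a set" where "Y = (\<Union>v\<in>light A. U v)"
definition Fr :: "'a set" where "Fr = - (X \<union> Y)"

lemma A_V: "A \<subseteq> V" and J_V: "J \<subseteq> V"
  using indep_A indep_J by (auto simp: independent_set_iff)

lemma X_Y_disjoint: "X \<inter> Y = {}"
proof (rule equals0I)
  fix a assume "a \<in> X \<inter> Y"
  then obtain v w where "v \<in> heavy A" "a \<in> U v" "w \<in> light A" "a \<in> U w" unfolding X_def Y_def by blast
  moreover from this have "v = w" using indep_unique[OF indep_A] unfolding heavy_def light_def by blast
  ultimately show False unfolding heavy_def light_def by simp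
qed

lemma X_Un_Y: "X \<union> Y = (\<Union>v\<in>A. U v)"
  using light_heavy(1)[OF A_V] unfolding X_def Y_def by blast

lemma no_claw: "\<nexists>B. claw_step V U A B"
  using no_step unfolding square_imp_step_def by blast

lemma J_unique: "i \<in> J \<Longrightarrow> j \<in> J \<Longrightarrow> a \<in> U i \<Longrightarrow> a \<in> U j \<Longrightarrow> i = j"
  by (rule indep_unique[OF indep_J])

lemma A_unique: "i \<in> A \<Longrightarrow> j \<in> A \<Longrightarrow> a \<in> U i \<Longrightarrow> a \<in> U j \<Longrightarrow> i = j"
  by (rule indep_unique[OF indep_A])

text \<open>
  The two forms in which local optimality under claws is used: for a single candidate, and for
  disjoint candidates that all meet a member \<open>z\<close> of \<open>A\<close>. Here \<open>R\<close> contains all members of \<open>A\<close>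
  that would have to leave.
\<close>

lemma hits_bound:
  assumes "claw V U C T" "hits A T \<subseteq> R" "finite R" "R \<subseteq> V"
  shows "(\<Sum>t\<in>T. (card (U t))\<^sup>2) \<le> (\<Sum>r\<in>R. (card (U r))\<^sup>2)"
proof -
  have "T \<subseteq> V" using assms(1) unfolding claw_def independent_set_iff by blast
  then have "(\<Sum>t\<in>T. (card (U t))\<^sup>2) \<le> (\<Sum>r\<in>hits A T. (card (U r))\<^sup>2)"
    using claw_local_opt[OF indep_A no_claw assms(1)] w2plus_eq[of T] w2plus_eq[of "hits A T"] A_V
    unfolding hits_def by (simp add: subset_iff)
  also have "\<dots> \<le> (\<Sum>r\<in>R. (card (U r))\<^sup>2)" using assms by (intro sum_mono2) auto
  finally show ?thesis .
qed

lemma centre_bound: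
  assumes "z \<in> A" "T \<subseteq> V" "T \<noteq> {}" "z \<notin> T"
    and "\<And>s t. s \<in> T \<Longrightarrow> t \<in> T \<Longrightarrow> s \<noteq> t \<Longrightarrow> U s \<inter> U t = {}"
    and "\<And>t. t \<in> T \<Longrightarrow> U t \<inter> U z \<noteq> {}" "hits A T \<subseteq> R" "finite R" "R \<subseteq> V"
  shows "(\<Sum>t\<in>T. (card (U t))\<^sup>2) \<le> (\<Sum>r\<in>R. (card (U r))\<^sup>2)"
proof -
  have "indep T" using assms(2,5) unfolding independent_set_iff by blast
  then have "claw V U (insert z T) T" using assms A_V by (intro centre_claw) auto
  then show ?thesis using hits_bound assms by blast
qed

lemma hits_subset:
  assumes "\<And>t a. t \<in> T \<Longrightarrow> a \<in> U t \<Longrightarrow> a \<notin> Fr \<Longrightarrow> \<exists>r\<in>R. r \<in> A \<and> a \<in> U r"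
  shows "hits A T \<subseteq> R"
proof
  fix x assume "x \<in> hits A T"
  then obtain t a where xt: "x \<in> A" "t \<in> T" "a \<in> U x" "a \<in> U t" unfolding hits_def by blast
  then have "a \<notin> Fr" using X_Un_Y unfolding Fr_def by blast
  then obtain r where "r \<in> R" "r \<in> A" "a \<in> U r" using assms xt by blast
  then show "x \<in> R" using A_unique xt by blast
qed

text \<open>The two free elements form a candidate that meets no member of A, so adding it gains 4
  and removes nothing.\<close>

lemma not_two_free:
  assumes "j \<in> V" "a \<in> U j" "b \<in> U j" "a \<in> Fr" "b \<in> Fr"
  shows "a = b"
proof (rule ccontr)
  assume "a \<noteq> b"
  then obtain v where v: "v \<in> V" "U v = {a, b}" using pair_candidate assms by blast
  have "hits A {v} \<subseteq> {}" using v assms by (intro hits_subset) auto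
  then have "(\<Sum>t\<in>{v}. (card (U t))\<^sup>2) \<le> (\<Sum>r\<in>{}. (card (U r))\<^sup>2)"
    by (intro hits_bound[OF single_claw]) (use v in auto)
  then show False using v \<open>a \<noteq> b\<close> by simp
qed

text \<open>Adding j gains 9 and removes at most two light members, which are worth 8.\<close>

lemma not_free_two_light:
  assumes j: "j \<in> V" "card (U j) = 3" and "U j = {f, a, b}" "f \<in> Fr" "a \<in> Y" "b \<in> Y"
  shows False
proof -
  obtain v w where vw: "v \<in> light A" "a \<in> U v" "w \<in> light A" "b \<in> U w" using assms unfolding Y_def by blast
  then have vwA: "v \<in> A" "w \<in> A" "card (U v) = 2" "card (U w) = 2" unfolding light_def by auto
  have "hits A {j} \<subseteq> {v, w}" using assms vw vwA by (intro hits_subset) auto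
  then have "(\<Sum>t\<in>{j}. (card (U t))\<^sup>2) \<le> (\<Sum>r\<in>{v, w}. (card (U r))\<^sup>2)"
    by (intro hits_bound[OF single_claw]) (use j vwA A_V in auto)
  also have "\<dots> \<le> 8" using vwA by (cases "v = w") auto
  finally show False using j by simp
qed

text \<open>Around the centre z, the set \<open>U j\<close> (which equals \<open>{f, a, b}\<close>)
  and the pair \<open>{c, f'}\<close> gain 9 + 4 and remove only z, which is worth 9.\<close>

lemma heavy_two_free:
  assumes z: "z \<in> heavy A" "U z = {a, b, c}" and d: "a \<noteq> b" "b \<noteq> c" "a \<noteq> c"
    and j: "j \<in> J" "j' \<in> J" "a \<in> U j" "b \<in> U j" "c \<in> U j'"
    and f: "f \<in> U j" "f' \<in> U j'" "f \<in> Fr" "f' \<in> Fr"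
  shows False
proof -
  have zA: "z \<in> A" "card (U z) = 3" "z \<in> V" using z A_V unfolding heavy_def by auto
  have aX: "a \<in> X" "b \<in> X" "c \<in> X" using z unfolding X_def by auto
  then have nF: "a \<notin> Fr" "b \<notin> Fr" "c \<notin> Fr" unfolding Fr_def by auto
  have ne: "f \<noteq> a" "f \<noteq> b" "f \<noteq> c" "f' \<noteq> a" "f' \<noteq> b" "f' \<noteq> c" using f nF by auto
  have c3: "card {f, a, b} = 3" using ne d by auto
  have sub: "{f, a, b} \<subseteq> U j" using j f by auto
  have "j \<in> V" using J_V j by auto
  then have fin: "finite (U j)" "card (U j) \<le> 3" using finite_U card_U[of j] by auto
  have eq: "U j = {f, a, b}" using card_seteq[OF fin(1) sub] c3 fin(2) by simp
  have "c \<notin> U j" using ne d unfolding eq by auto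
  then have jj: "j \<noteq> j'" using j by auto
  have "j' \<in> V" using j J_V by auto
  then obtain w where w: "w \<in> V" "U w = {c, f'}" using pair_candidate[of j' c f'] j f ne by auto
  have dis: "U j \<inter> U w = {}" using jj J_unique[of j j'] j f w by auto
  have wj: "w \<noteq> j" using dis w by auto
  have "f \<notin> U z" "f' \<notin> U z" using ne z by auto
  then have zT: "z \<notin> {j, w}" using f w by auto
  have "hits A {j, w} \<subseteq> {z}" using eq w z zA f by (intro hits_subset) auto
  then have "(\<Sum>t\<in>{j, w}. (card (U t))\<^sup>2) \<le> (\<Sum>r\<in>{z}. (card (U r))\<^sup>2)"
    using dis eq w zA zT z \<open>j \<in> V\<close> by (intro centre_bound[of z]) auto
  moreover have "card (U w) = 2" using w ne by simp
  ultimately show False using eq c3 wj zA by simp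
qed

text \<open>If the three sets of J differ, the pairs \<open>{a, fa}\<close>, \<open>{b, fb}\<close>,
  \<open>{c, fc}\<close> gain 12 around z, which is worth 9. If two of them coincide,
  \<open>heavy_two_free\<close> applies up to renaming.\<close>

lemma heavy_not_three_free:
  assumes z: "z \<in> heavy A" "U z = {a, b, c}" and d: "a \<noteq> b" "b \<noteq> c" "a \<noteq> c"
    and j: "ja \<in> J" "jb \<in> J" "jc \<in> J" "a \<in> U ja" "b \<in> U jb" "c \<in> U jc"
    and f: "fa \<in> U ja" "fb \<in> U jb" "fc \<in> U jc" "fa \<in> Fr" "fb \<in> Fr" "fc \<in> Fr"
  shows False
proof -
  have zA: "z \<in> A" "card (U z) = 3" "z \<in> V" using z A_V unfolding heavy_def by auto
  have aX: "a \<in> X" "b \<in> X" "c \<in> X" using z unfolding X_def by auto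
  then have nF: "a \<notin> Fr" "b \<notin> Fr" "c \<notin> Fr" unfolding Fr_def by auto
  show False
  proof (cases "ja = jb \<or> jb = jc \<or> ja = jc")
    case True
    moreover have "U z = {b, c, a}" "U z = {a, c, b}" using z by auto
    ultimately show ?thesis
      using heavy_two_free[OF z d j(1,3), of fa fc] heavy_two_free[of z b c a jb ja fb fa]
        heavy_two_free[of z a c b ja jb fa fb] z(1) d j f by metis
  next
    case False
    have ne: "a \<noteq> fa" "b \<noteq> fb" "c \<noteq> fc" using f nF by auto
    have jV: "ja \<in> V" "jb \<in> V" "jc \<in> V" using j J_V by auto
    obtain u where u: "u \<in> V" "U u = {a, fa}" using pair_candidate[OF jV(1) j(4) f(1) ne(1)] by blast
    obtain v where v: "v \<in> V" "U v = {b, fb}" using pair_candidate[OF jV(2) j(5) f(2) ne(2)] by blast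
    obtain w where w: "w \<in> V" "U w = {c, fc}" using pair_candidate[OF jV(3) j(6) f(3) ne(3)] by blast
    have two: "card (U u) = 2" "card (U v) = 2" "card (U w) = 2" using u v w ne by auto
    have "U ja \<inter> U jb = {}" "U jb \<inter> U jc = {}" "U ja \<inter> U jc = {}"
      using False j J_unique by blast+
    then have dis: "U u \<inter> U v = {}" "U v \<inter> U w = {}" "U u \<inter> U w = {}"
      unfolding u(2) v(2) w(2) using j f by blast+
    then have uvw: "u \<noteq> v" "v \<noteq> w" "u \<noteq> w" using u v w by auto
    have "fa \<notin> U z" "fb \<notin> U z" "fc \<notin> U z" using f nF z by auto
    then have zT: "z \<notin> {u, v, w}" using u v w by auto
    have "hits A {u, v, w} \<subseteq> {z}" using u v w f zA z by (intro hits_subset) auto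
    then have "(\<Sum>t\<in>{u, v, w}. (card (U t))\<^sup>2) \<le> (\<Sum>r\<in>{z}. (card (U r))\<^sup>2)"
      using dis u v w zA zT z by (intro centre_bound[of z]) auto
    then show False using two uvw zA by simp
  qed
qed

text \<open>
  The types of an element of a light member: the set of \<open>J\<close> that contains it meets \<open>Y\<close> in one
  element and contains a free element (\<open>tS\<close>), or in one, two or three elements and is contained in
  \<open>X \<union> Y\<close> (\<open>tO\<close>, \<open>tQ\<close>, \<open>tH\<close>).
\<close>

definition tS :: "'a \<Rightarrow> bool" where
  "tS a \<longleftrightarrow> (\<exists>j\<in>J. U j \<inter> Y = {a} \<and> U j \<inter> Fr \<noteq> {})"
definition tO :: "'a \<Rightarrow> bool" where
  "tO a \<longleftrightarrow> (\<exists>j\<in>J. U j \<inter> Y = {a} \<and> U j \<inter> Fr = {})"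
definition tQ :: "'a \<Rightarrow> bool" where
  "tQ a \<longleftrightarrow> (\<exists>j\<in>J. \<exists>b. U j \<inter> Y = {a, b} \<and> a \<noteq> b)"
definition tH :: "'a \<Rightarrow> bool" where
  "tH a \<longleftrightarrow> (\<exists>j\<in>J. a \<in> U j \<and> U j \<subseteq> Y \<and> card (U j) = 3)"

text \<open>The other element of the light member containing a, and the other light element of the
  set of J containing a. Alternating between the two maps follows alternating paths of the matching
  formed by the light members. The values are meaningful only for a in Y and for a of type
  \<open>tQ\<close>, respectively.\<close>

definition mate :: "'a \<Rightarrow> 'a" where
  "mate a = (THE b. \<exists>v\<in>A. U v = {a, b} \<and> a \<noteq> b)"
definition partner :: "'a \<Rightarrow> 'a" where
  "partner a = (THE b. \<exists>j\<in>J. U j \<inter> Y = {a, b} \<and> a \<noteq> b)"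

lemma mate_eq:
  assumes "v \<in> A" "U v = {a, b}" "a \<noteq> b"
  shows "mate a = b"
  unfolding mate_def
proof (rule the_equality)
  fix b' assume "\<exists>w\<in>A. U w = {a, b'} \<and> a \<noteq> b'"
  then obtain w where w: "w \<in> A" "U w = {a, b'}" "a \<noteq> b'" by blast
  have "v = w" using A_unique[OF assms(1) w(1), of a] assms(2) w(2) by simp
  then show "b' = b" using assms w by (auto simp: doubleton_eq_iff)
qed (use assms in blast)

lemma partner_eq:
  assumes "j \<in> J" "U j \<inter> Y = {a, b}" "a \<noteq> b"
  shows "partner a = b"
  unfolding partner_def
proof (rule the_equality)
  fix b' assume "\<exists>i\<in>J. U i \<inter> Y = {a, b'} \<and> a \<noteq> b'"
  then obtain i where i: "i \<in> J" "U i \<inter> Y = {a, b'}" "a \<noteq> b'" by blast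
  have "a \<in> U j \<inter> Y" "a \<in> U i \<inter> Y" using assms(2) i(2) by simp_all
  then have "j = i" using J_unique[OF assms(1) i(1), of a] by simp
  then show "b' = b" using assms i by (auto simp: doubleton_eq_iff)
qed (use assms in blast)

lemma light_pair:
  assumes "a \<in> Y"
  obtains v where "v \<in> light A" "U v = {a, mate a}" "a \<noteq> mate a" "mate (mate a) = a" "mate a \<in> Y"
proof -
  obtain v where v: "v \<in> light A" "a \<in> U v" using assms unfolding Y_def by blast
  then have 2: "card (U v) = 2" "v \<in> A" unfolding light_def by auto
  then obtain x y where "U v = {x, y}" "x \<noteq> y" by (auto simp: card_2_iff)
  then obtain b where b: "U v = {a, b}" "a \<noteq> b" using v(2) by (metis insertE insert_commute singletonD)
  then have "mate a = b" "mate b = a" using mate_eq[OF \<open>v \<in> A\<close>] by (auto simp: insert_commute)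
  moreover have "b \<in> Y" using v b unfolding Y_def by auto
  ultimately show ?thesis using that v b by blast
qed

lemma type_iff:
  assumes "j \<in> J" "a \<in> U j"
  shows "tS a \<longleftrightarrow> U j \<inter> Y = {a} \<and> U j \<inter> Fr \<noteq> {}" "tO a \<longleftrightarrow> U j \<inter> Y = {a} \<and> U j \<inter> Fr = {}"
    "tQ a \<longleftrightarrow> (\<exists>b. U j \<inter> Y = {a, b} \<and> a \<noteq> b)" "tH a \<longleftrightarrow> U j \<subseteq> Y \<and> card (U j) = 3"
proof -
  have eq: "i = j" if "i \<in> J" "a \<in> U i" for i using J_unique that assms by blast
  have eq': "i = j" if "i \<in> J" "U i \<inter> Y = {a}" for i using eq[OF that(1)] that(2) by blast
  have eq'': "i = j" if "i \<in> J" "U i \<inter> Y = {a, b}" for i b using eq[OF that(1)] that(2) by blast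
  show "tS a \<longleftrightarrow> U j \<inter> Y = {a} \<and> U j \<inter> Fr \<noteq> {}" unfolding tS_def using eq' assms(1) by metis
  show "tO a \<longleftrightarrow> U j \<inter> Y = {a} \<and> U j \<inter> Fr = {}" unfolding tO_def using eq' assms(1) by metis
  show "tQ a \<longleftrightarrow> (\<exists>b. U j \<inter> Y = {a, b} \<and> a \<noteq> b)" unfolding tQ_def using eq'' assms(1) by metis
  show "tH a \<longleftrightarrow> U j \<subseteq> Y \<and> card (U j) = 3" unfolding tH_def using eq assms by metis
qed

lemma type_exclusive:
  assumes "tQ a" shows "\<not> tS a" "\<not> tO a" "\<not> tH a"
proof -
  obtain j b where j: "j \<in> J" "U j \<inter> Y = {a, b}" "a \<noteq> b" using assms unfolding tQ_def by blast
  then have a: "a \<in> U j" by blast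
  have ne: "{a, b} \<noteq> {a}" using j(3) by auto
  show "\<not> tS a" "\<not> tO a" using type_iff(1,2)[OF j(1) a] j(2) ne by auto
  show "\<not> tH a"
  proof
    assume "tH a"
    then have "U j = {a, b}" "card (U j) = 3" using type_iff(4)[OF j(1) a] j(2) by auto
    then show False using j(3) by simp
  qed
qed

lemma type_exclusive_H:
  assumes "tH a" shows "\<not> tS a" "\<not> tO a"
proof -
  obtain j where j: "j \<in> J" "a \<in> U j" "U j \<subseteq> Y" "card (U j) = 3" using assms unfolding tH_def by blast
  have "U j \<inter> Y \<noteq> {a}"
  proof
    assume "U j \<inter> Y = {a}"
    then have "U j = {a}" using j(3) by blast
    then show False using j(4) by simp
  qed
  then show "\<not> tS a" "\<not> tO a" using type_iff(1,2)[OF j(1,2)] by auto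
qed

lemma finite_J: "j \<in> J \<Longrightarrow> finite (U j)" and card_J: "j \<in> J \<Longrightarrow> card (U j) = 2 \<or> card (U j) = 3"
  using J_V finite_U card_U by blast+

lemma type_cases:
  assumes "j \<in> J" "a \<in> U j" "a \<in> Y"
  shows "tS a \<or> tO a \<or> tQ a \<or> tH a"
proof -
  have fin: "finite (U j \<inter> Y)" using finite_J assms by blast
  have "card (U j \<inter> Y) \<le> card (U j)" using finite_J assms by (intro card_mono) auto
  then have "card (U j \<inter> Y) \<le> 3" using card_J[OF assms(1)] by auto
  moreover have "card (U j \<inter> Y) \<noteq> 0" using fin assms by auto
  ultimately consider "card (U j \<inter> Y) = 1" | "card (U j \<inter> Y) = 2" | "card (U j \<inter> Y) = 3" by linarith
  then show ?thesis
  proof cases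
    case 1
    then obtain x where "U j \<inter> Y = {x}" by (auto simp: card_1_singleton_iff)
    then have "U j \<inter> Y = {a}" using assms by auto
    then show ?thesis using type_iff(1,2)[OF assms(1,2)] by blast
  next
    case 2
    then obtain x y where "U j \<inter> Y = {x, y}" "x \<noteq> y" by (auto simp: card_2_iff)
    moreover from this have "a = x \<or> a = y" using assms by blast
    ultimately show ?thesis using type_iff(3)[OF assms(1,2)] by (metis insert_commute)
  next
    case 3
    have "card (U j) = 3" using 3 \<open>card (U j \<inter> Y) \<le> card (U j)\<close> card_J[OF assms(1)] by auto
    moreover have "U j \<inter> Y = U j" using finite_J[OF assms(1)] 3 calculation by (intro card_subset_eq) auto
    ultimately show ?thesis using type_iff(4)[OF assms(1,2)] by blast
  qed
qed

text \<open>The hypothesis of \<open>matching_local_opt\<close> for a single set of J. Finding more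
  reducible sets than there are members of K gives a contradiction.\<close>

definition reducible :: "'c set \<Rightarrow> 'c \<Rightarrow> bool" where
  "reducible K j \<longleftrightarrow> (\<exists>e\<subseteq>U j. card e = 2 \<and> e \<inter> X = {} \<and> e \<inter> Y \<subseteq> (\<Union>v\<in>K. U v))"

lemma reducible_card:
  assumes "K \<subseteq> light A" "P \<subseteq> J" "\<And>j. j \<in> P \<Longrightarrow> reducible K j"
  shows "card P \<le> card K"
  using matching_local_opt[OF indep_A no_step assms(1) indep_J assms(2)] assms(3)
  unfolding reducible_def X_def Y_def by blast

lemma reducible_S:
  assumes "U j \<inter> Y = {a}" "U j \<inter> Fr \<noteq> {}" "v \<in> K" "a \<in> U v"
  shows "reducible K j"
proof -
  obtain f where f: "f \<in> U j" "f \<in> Fr" using assms(2) by blast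
  have a: "a \<in> Y" "a \<in> U j" using assms(1) by blast+
  then have "a \<noteq> f" "a \<notin> X" "f \<notin> X" "f \<notin> Y" using f X_Y_disjoint unfolding Fr_def by auto
  then show ?thesis unfolding reducible_def using a f assms(3,4) by (intro exI[of _ "{a, f}"]) auto
qed

lemma reducible_Q:
  assumes "a \<in> U j" "b \<in> U j" "a \<in> Y" "b \<in> Y" "a \<noteq> b" "v \<in> K" "w \<in> K" "a \<in> U v" "b \<in> U w"
  shows "reducible K j"
proof -
  have "a \<notin> X" "b \<notin> X" using assms X_Y_disjoint by auto
  then show ?thesis unfolding reducible_def using assms by (intro exI[of _ "{a, b}"]) auto
qed

text \<open>Three configurations that would let the matching of the light members grow.\<close>

lemma not_S_Q_S:
  assumes "tQ a" "tS (mate a)" "tS (mate (partner a))"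
  shows False
proof -
  obtain q b where q: "q \<in> J" "U q \<inter> Y = {a, b}" "a \<noteq> b" using assms(1) unfolding tQ_def by blast
  have b: "partner a = b" using partner_eq[OF q] .
  have aY: "a \<in> Y" "b \<in> Y" "a \<in> U q" "b \<in> U q" using q(2) by blast+
  obtain s where s: "s \<in> J" "U s \<inter> Y = {mate a}" "U s \<inter> Fr \<noteq> {}" using assms(2) unfolding tS_def by blast
  obtain s' where s': "s' \<in> J" "U s' \<inter> Y = {mate b}" "U s' \<inter> Fr \<noteq> {}"
    using assms(3) b unfolding tS_def by blast
  obtain v where v: "v \<in> light A" "U v = {a, mate a}" "mate (mate a) = a" using light_pair[OF aY(1)] by metis
  obtain w where w: "w \<in> light A" "U w = {b, mate b}" "mate (mate b) = b" using light_pair[OF aY(2)] by metis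
  have "mate a \<noteq> mate b" using v w q(3) by metis
  then have "s \<noteq> s'" "s \<noteq> q" "s' \<noteq> q" using s s' q by auto
  \<comment> \<open>Three sets of J use pairs that touch at most two light members. Coinciding light
    members only make the contradiction stronger.\<close>
  then have "card {s, q, s'} = 3" by simp
  moreover have "card {s, q, s'} \<le> card {v, w}"
  proof (rule reducible_card)
    fix j assume "j \<in> {s, q, s'}"
    then consider "j = s" | "j = q" | "j = s'" by blast
    then show "reducible {v, w} j"
    proof cases
      case 1 then show ?thesis using reducible_S[OF s(2,3), of v "{v, w}"] v by simp
    next
      case 2 then show ?thesis using reducible_Q[OF aY(3,4,1,2) q(3), of v "{v, w}" w] v w by simp
    next
      case 3 then show ?thesis using reducible_S[OF s'(2,3), of w "{v, w}"] w by simp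
    qed
  qed (use v w s s' q in auto)
  moreover have "card {v, w} \<le> 2" by (cases "v = w") auto
  ultimately show False by linarith
qed

text \<open>The sets s, q, q', s' form a chain linked by the light members w, v, w': four reducible
  sets over at most three light members.\<close>

lemma not_S_Q_Q_S:
  assumes "tQ a" "tQ (mate a)" "tS (mate (partner a))" "tS (mate (partner (mate a)))"
  shows False
proof -
  obtain q b where q: "q \<in> J" "U q \<inter> Y = {a, b}" "a \<noteq> b" using assms(1) unfolding tQ_def by blast
  have b: "partner a = b" using partner_eq[OF q] .
  have aY: "a \<in> Y" "b \<in> Y" "a \<in> U q" "b \<in> U q" using q(2) by blast+
  obtain v where v: "v \<in> light A" "U v = {a, mate a}" "mate (mate a) = a" "a \<noteq> mate a"
    using light_pair[OF aY(1)] by metis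
  obtain q' b' where q': "q' \<in> J" "U q' \<inter> Y = {mate a, b'}" "mate a \<noteq> b'"
    using assms(2) unfolding tQ_def by blast
  have b': "partner (mate a) = b'" using partner_eq[OF q'] .
  have a'Y: "mate a \<in> Y" "b' \<in> Y" "mate a \<in> U q'" "b' \<in> U q'" using q'(2) by blast+
  obtain w where w: "w \<in> light A" "U w = {b, mate b}" "mate (mate b) = b" using light_pair[OF aY(2)] by metis
  obtain w' where w': "w' \<in> light A" "U w' = {b', mate b'}" "mate (mate b') = b'" using light_pair[OF a'Y(2)] by metis
  obtain s where s: "s \<in> J" "U s \<inter> Y = {mate b}" "U s \<inter> Fr \<noteq> {}" using assms(3) b unfolding tS_def by blast
  obtain s' where s': "s' \<in> J" "U s' \<inter> Y = {mate b'}" "U s' \<inter> Fr \<noteq> {}"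
    using assms(4) b' unfolding tS_def by blast
  \<comment> \<open>Otherwise the partner of a is its mate, and the hypothesis on
    \<open>mate (partner a)\<close> says \<open>tS a\<close>, which excludes
    \<open>tQ a\<close>.\<close>
  have qq': "q \<noteq> q'"
  proof
    assume "q = q'"
    then have "{a, b} = {mate a, b'}" using q q' by simp
    then have "b = mate a" using v(4) by (auto simp: doubleton_eq_iff)
    then have "tS a" using assms(3) b v(3) by simp
    then show False using type_exclusive assms(1) by blast
  qed
  have "b \<noteq> b'" using qq' J_unique[OF q(1) q'(1)] aY a'Y by blast
  then have "mate b \<noteq> mate b'" using w w' by metis
  then have "s \<noteq> s'" "s \<noteq> q" "s' \<noteq> q" "s \<noteq> q'" "s' \<noteq> q'" using s s' q q' by auto
  then have "card {s, q, q', s'} = 4" using qq' by simp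
  moreover have "card {s, q, q', s'} \<le> card {v, w, w'}"
  proof (rule reducible_card)
    fix j assume "j \<in> {s, q, q', s'}"
    then consider "j = s" | "j = q" | "j = q'" | "j = s'" by blast
    then show "reducible {v, w, w'} j"
    proof cases
      case 1 then show ?thesis using reducible_S[OF s(2,3), of w "{v, w, w'}"] w by simp
    next
      case 2 then show ?thesis using reducible_Q[OF aY(3,4,1,2) q(3), of v "{v, w, w'}" w] v w by simp
    next
      case 3 then show ?thesis using reducible_Q[OF a'Y(3,4,1,2) q'(3), of v "{v, w, w'}" w'] v w' by simp
    next
      case 4 then show ?thesis using reducible_S[OF s'(2,3), of w' "{v, w, w'}"] w' by simp
    qed
  qed (use v w w' s s' q q' in auto)
  moreover have "card {v, w, w'} \<le> 3" by (intro order_trans[OF card_insert_le_m1]) (auto simp: card_insert_if)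
  ultimately show False by linarith
qed

text \<open>The chain s, q, h, q', s' is linked by four light members, while it consists of five
  reducible sets; h contributes the pair \<open>{a, b}\<close>.\<close>

lemma not_S_Q_H_Q_S:
  assumes h: "h \<in> J" "U h \<subseteq> Y" "card (U h) = 3" and ab: "a \<in> U h" "b \<in> U h" "a \<noteq> b"
    and Q: "tQ (mate a)" "tQ (mate b)"
    and S: "tS (mate (partner (mate a)))" "tS (mate (partner (mate b)))"
  shows False
proof -
  have Y: "a \<in> Y" "b \<in> Y" using h ab by auto
  have H: "tH a" "tH b" using h ab unfolding tH_def by blast+
  obtain v where v: "v \<in> light A" "U v = {a, mate a}" "mate (mate a) = a" "mate a \<in> Y"
    using light_pair[OF Y(1)] by metis
  obtain v' where v': "v' \<in> light A" "U v' = {b, mate b}" "mate (mate b) = b" "mate b \<in> Y"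
    using light_pair[OF Y(2)] by metis
  obtain q c where q: "q \<in> J" "U q \<inter> Y = {mate a, c}" "mate a \<noteq> c" using Q(1) unfolding tQ_def by blast
  obtain q' d where q': "q' \<in> J" "U q' \<inter> Y = {mate b, d}" "mate b \<noteq> d" using Q(2) unfolding tQ_def by blast
  have c: "partner (mate a) = c" and d: "partner (mate b) = d" using partner_eq q q' by blast+
  have cY: "c \<in> Y" "c \<in> U q" "mate a \<in> U q" and dY: "d \<in> Y" "d \<in> U q'" "mate b \<in> U q'" using q(2) q'(2) by blast+
  obtain w where w: "w \<in> light A" "U w = {c, mate c}" "mate (mate c) = c" using light_pair[OF cY(1)] by metis
  obtain w' where w': "w' \<in> light A" "U w' = {d, mate d}" "mate (mate d) = d" using light_pair[OF dY(1)] by metis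
  obtain s where s: "s \<in> J" "U s \<inter> Y = {mate c}" "U s \<inter> Fr \<noteq> {}" using S(1) c unfolding tS_def by blast
  obtain s' where s': "s' \<in> J" "U s' \<inter> Y = {mate d}" "U s' \<inter> Fr \<noteq> {}" using S(2) d unfolding tS_def by blast
  have mab: "mate a \<noteq> mate b" using v v' ab(3) by metis
  have qq': "q \<noteq> q'"
  proof
    assume "q = q'"
    then have "{mate a, c} = {mate b, d}" using q q' by simp
    then have "c = mate b" using mab by (auto simp: doubleton_eq_iff)
    then have "tS b" using S(1) c v'(3) by simp
    then show False using type_exclusive_H H(2) by blast
  qed
  have "c \<noteq> d" using qq' J_unique[OF q(1) q'(1)] cY dY by blast
  then have "mate c \<noteq> mate d" using w w' by metis
  moreover have "U h \<inter> Y = U h" using h by blast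
  then have "card (U h \<inter> Y) = 3" using h by simp
  moreover have "card (U q \<inter> Y) = 2" "card (U q' \<inter> Y) = 2" using q q' by simp_all
  moreover have "card (U s \<inter> Y) = 1" "card (U s' \<inter> Y) = 1" using s s' by simp_all
  ultimately have "s \<noteq> s'" "s \<noteq> q" "s' \<noteq> q" "s \<noteq> q'" "s' \<noteq> q'" "h \<noteq> s" "h \<noteq> s'" "h \<noteq> q" "h \<noteq> q'"
    using s s' by auto
  then have "card {s, q, h, q', s'} = 5" using qq' by simp
  moreover let ?K = "{v, v', w, w'}"
  have "card {s, q, h, q', s'} \<le> card ?K"
  proof (rule reducible_card)
    fix j assume "j \<in> {s, q, h, q', s'}"
    then consider "j = s" | "j = q" | "j = h" | "j = q'" | "j = s'" by blast
    then show "reducible ?K j"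
    proof cases
      case 1 then show ?thesis using reducible_S[OF s(2,3), of w ?K] w by simp
    next
      case 2 then show ?thesis using reducible_Q[OF cY(3,2) v(4) cY(1) q(3), of v ?K w] v w by simp
    next
      case 3 then show ?thesis using reducible_Q[OF ab(1,2) Y ab(3), of v ?K v'] v v' by simp
    next
      case 4 then show ?thesis using reducible_Q[OF dY(3,2) v'(4) dY(1) q'(3), of v' ?K w'] v' w' by simp
    next
      case 5 then show ?thesis using reducible_S[OF s'(2,3), of w' ?K] w' by simp
    qed
  qed (use v v' w w' s s' q q' h in auto)
  moreover have "card ?K \<le> 4" by (simp add: card_insert_if)
  ultimately show False by linarith
qed

lemma tS_pair:
  assumes "tS a"
  obtains j f t where "j \<in> J" "U j \<inter> Y = {a}" "f \<in> U j" "f \<in> Fr" "f \<noteq> a" "t \<in> V" "U t = {a, f}"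
proof -
  obtain j f where j: "j \<in> J" "U j \<inter> Y = {a}" "f \<in> U j" "f \<in> Fr" using assms unfolding tS_def by blast
  have "a \<in> U j" "a \<in> Y" using j(2) by blast+
  then have "f \<noteq> a" using j(4) unfolding Fr_def by blast
  then show ?thesis using pair_candidate[of j a f] j \<open>a \<in> U j\<close> J_V that by (metis subsetD)
qed

text \<open>The pairs \<open>{a, f}\<close> and \<open>{b, f'}\<close> gain 8 around the centre v
  and remove only v, which is worth 4.\<close>

lemma not_S_S:
  assumes v: "v \<in> light A" "U v = {a, b}" "a \<noteq> b" and "tS a" "tS b"
  shows False
proof -
  obtain j f t where j: "j \<in> J" "U j \<inter> Y = {a}" "f \<in> U j" "f \<in> Fr" "f \<noteq> a" "t \<in> V" "U t = {a, f}"
    using tS_pair[OF assms(4)] .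
  obtain j' f' t' where j': "j' \<in> J" "U j' \<inter> Y = {b}" "f' \<in> U j'" "f' \<in> Fr" "f' \<noteq> b" "t' \<in> V" "U t' = {b, f'}"
    using tS_pair[OF assms(5)] .
  have vA: "v \<in> A" "card (U v) = 2" "v \<in> V" using v A_V unfolding light_def by auto
  have "j \<noteq> j'" using j(2) j'(2) v(3) by auto
  then have jj: "U j \<inter> U j' = {}" using J_unique j(1) j'(1) by blast
  have "a \<in> U j" "b \<in> U j'" using j(2) j'(2) by blast+
  then have dis: "U t \<inter> U t' = {}" using jj j j' by auto
  have tt: "t \<noteq> t'" using dis j by auto
  have "{a, b} \<subseteq> Y" using v unfolding Y_def by auto
  then have fn: "f \<notin> {a, b}" "f' \<notin> {a, b}" using j(4) j'(4) unfolding Fr_def by auto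
  then have vT: "v \<notin> {t, t'}" using v j j' by auto
  have "hits A {t, t'} \<subseteq> {v}" using j j' v vA by (intro hits_subset) auto
  then have "(\<Sum>x\<in>{t, t'}. (card (U x))\<^sup>2) \<le> (\<Sum>r\<in>{v}. (card (U r))\<^sup>2)"
    using dis j(6,7) j'(6,7) vA vT v by (intro centre_bound[of v]) auto
  moreover have "card (U t) = 2" "card (U t') = 2" using j j' by auto
  ultimately show False using tt vA by simp
qed

text \<open>The pair \<open>{a, f}\<close> and the 3-set h gain 4 + 9 = 13 around the centre v. They
  remove at most three light members, worth 12.\<close>

lemma not_S_H:
  assumes v: "v \<in> light A" "U v = {a, b}" "a \<noteq> b" and "tS a" "tH b"
  shows False
proof -
  obtain j f t where j: "j \<in> J" "U j \<inter> Y = {a}" "f \<in> U j" "f \<in> Fr" "f \<noteq> a" "t \<in> V" "U t = {a, f}"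
    using tS_pair[OF assms(4)] .
  obtain h where h: "h \<in> J" "b \<in> U h" "U h \<subseteq> Y" "card (U h) = 3" using assms(5) unfolding tH_def by blast
  have vA: "v \<in> A" "card (U v) = 2" "v \<in> V" using v A_V unfolding light_def by auto
  have "card (U h - {b}) = 2" using h finite_J[OF h(1)] by simp
  then obtain c d where cd: "U h - {b} = {c, d}" by (auto simp: card_2_iff)
  then have Uh: "U h = {b, c, d}" using h(2) by blast
  obtain vc vd where vc: "vc \<in> light A" "c \<in> U vc" and vd: "vd \<in> light A" "d \<in> U vd"
  proof -
    have "c \<in> Y" "d \<in> Y" using h(3) Uh by auto
    then show ?thesis using that unfolding Y_def by (elim UN_E)
  qed
  then have vcd: "vc \<in> A" "vd \<in> A" "card (U vc) = 2" "card (U vd) = 2" unfolding light_def by auto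
  have "j \<noteq> h"
  proof
    assume "j = h"
    then have "U h = {a}" using j(2) h(3) by blast
    then show False using h(4) by simp
  qed
  then have jj: "U j \<inter> U h = {}" using J_unique j(1) h(1) by blast
  have "a \<in> U j" using j(2) by blast
  then have dis: "U t \<inter> U h = {}" using jj j by auto
  have tt: "t \<noteq> h" using dis j by auto
  have "a \<notin> U h" using dis j by auto
  moreover have "f \<notin> U v" using v j(4) unfolding Fr_def Y_def by blast
  ultimately have vT: "v \<notin> {t, h}" using v j by auto
  have "hits A {t, h} \<subseteq> {v, vc, vd}" using j v vA vc vd vcd Uh by (intro hits_subset) auto
  then have "(\<Sum>x\<in>{t, h}. (card (U x))\<^sup>2) \<le> (\<Sum>r\<in>{v, vc, vd}. (card (U r))\<^sup>2)"
    using dis j(6,7) h(1,2) J_V vA vT v vcd A_V by (intro centre_bound[of v]) auto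
  also have "\<dots> = (\<Sum>r\<in>{v, vc, vd}. 4)" using vA vcd by (intro sum.cong) auto
  also have "\<dots> \<le> 12" by (simp add: card_insert_if)
  finally have "(\<Sum>x\<in>{t, h}. (card (U x))\<^sup>2) \<le> 12" .
  moreover have "card (U t) = 2" using j by auto
  ultimately show False using tt h by simp
qed

text \<open>
  Charges in units of 1/10 of a weight. A heavy member of \<open>A\<close> can pay 28 and a light one 14. An
  element of \<open>tQ\<close> normally pays 6, but only 4 if its mate has to pay 10; its partner then pays 8.
\<close>

definition charge :: "'a \<Rightarrow> nat" where
  "charge a = (if \<forall>j\<in>J. a \<notin> U j then 0
    else if a \<in> X then (if \<exists>j\<in>J. a \<in> U j \<and> U j \<inter> Fr \<noteq> {} then 10 else 8)
    else if tS a then 10 else if tO a then 4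
    else if tQ a then (if tS (mate a) then 4 else if tS (mate (partner a)) then 8 else 6)
    else (if tQ (mate a) \<and> tS (mate (partner (mate a))) then 6 else 7))"

lemma charge_X:
  assumes "j \<in> J" "a \<in> U j" "a \<in> X"
  shows "charge a = (if U j \<inter> Fr \<noteq> {} then 10 else 8)"
proof -
  have "(\<exists>i\<in>J. a \<in> U i \<and> U i \<inter> Fr \<noteq> {}) \<longleftrightarrow> U j \<inter> Fr \<noteq> {}" using J_unique assms by metis
  then show ?thesis unfolding charge_def using assms by auto
qed

lemma charge_Y:
  assumes "j \<in> J" "a \<in> U j" "a \<in> Y"
  shows "tS a \<Longrightarrow> charge a = 10" "tO a \<Longrightarrow> charge a = 4"
    "tQ a \<Longrightarrow> charge a = (if tS (mate a) then 4 else if tS (mate (partner a)) then 8 else 6)"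
    "tH a \<Longrightarrow> charge a = (if tQ (mate a) \<and> tS (mate (partner (mate a))) then 6 else 7)"
proof -
  have a: "\<not> (\<forall>j\<in>J. a \<notin> U j)" "a \<notin> X" using assms X_Y_disjoint by auto
  show "tS a \<Longrightarrow> charge a = 10" unfolding charge_def using a by simp
  show "tO a \<Longrightarrow> charge a = 4" unfolding charge_def using a type_iff(1,2)[OF assms(1,2)] by simp
  show "tQ a \<Longrightarrow> charge a = (if tS (mate a) then 4 else if tS (mate (partner a)) then 8 else 6)"
    unfolding charge_def using a(2) type_exclusive[of a] by (simp only: a(1) if_False if_True not_False_eq_True simp_thms)
  show "tH a \<Longrightarrow> charge a = (if tQ (mate a) \<and> tS (mate (partner (mate a))) then 6 else 7)"
    unfolding charge_def using a type_exclusive type_exclusive_H by auto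
qed

text \<open>Consider the larger of the two charges. A charge of 10 has type \<open>tS\<close>; its
  mate is neither \<open>tS\<close> nor \<open>tH\<close>, so it pays at most 4, which is why a
  \<open>tQ\<close> element with such a mate is reduced to 4. If a \<open>tQ\<close> element pays 8,
  its mate pays at most 6: for a \<open>tQ\<close> mate by \<open>not_S_Q_Q_S\<close>, and for a
  \<open>tH\<close> mate by the reduction from 7 to 6. In all other cases both charges are at most
  7.\<close>

lemma light_budget:
  assumes v: "v \<in> light A"
  shows "(\<Sum>a\<in>U v. charge a) \<le> 14"
proof -
  obtain a where a: "a \<in> U v" using U_nonempty v A_V unfolding light_def by blast
  then have "a \<in> Y" using v unfolding Y_def by blast
  then obtain w where w: "w \<in> light A" "U w = {a, mate a}" "a \<noteq> mate a" "mate (mate a) = a" "mate a \<in> Y"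
    by (rule light_pair)
  define b where "b = mate a"
  have "v = w" using A_unique[of v w a] v w a unfolding light_def by simp
  then have Uv: "U v = {a, b}" "a \<noteq> b" using w b_def by auto
  have m: "mate a = b" "mate b = a" using w b_def by auto
  have Y: "a \<in> Y" "b \<in> Y" using \<open>a \<in> Y\<close> w b_def by auto
  have types: "charge x = 0 \<or> tS x \<and> charge x = 10 \<or> tO x \<and> charge x = 4 \<or> tQ x \<and> charge x = (if tS (mate x) then 4 else if tS (mate (partner x)) then 8 else 6)
     \<or> tH x \<and> charge x = (if tQ (mate x) \<and> tS (mate (partner (mate x))) then 6 else 7)" if "x \<in> Y" for x
  proof (cases "\<forall>j\<in>J. x \<notin> U j")
    case True then show ?thesis unfolding charge_def by simp
  next
    case False
    then obtain j where j: "j \<in> J" "x \<in> U j" by blast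
    then show ?thesis using type_cases[OF j that] charge_Y[OF j that] by blast
  qed
  have ex: "\<not> (tS a \<and> tS b)" "\<not> (tS a \<and> tH b)" "\<not> (tS b \<and> tH a)"
    using not_S_S[OF v Uv] not_S_H[OF v Uv] not_S_H[of v b a] v Uv by (auto simp: insert_commute)
  have QQ: "\<not> (tQ a \<and> tQ b \<and> tS (mate (partner a)) \<and> tS (mate (partner b)))"
    using not_S_Q_Q_S[of a] m by auto
  have cH: "charge x = 6 \<or> charge x = 7" if "x \<in> Y" "tH x" "charge x \<noteq> 0" for x
    using types[OF that(1)] type_exclusive[of x] type_exclusive_H[of x] that by (smt (verit))
  have key: "charge x + charge y \<le> 14"
    if y: "{x, y} = {a, b}" "mate x = y" "mate y = x" and le: "charge y \<le> charge x" for x y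
  proof -
    have xY: "x \<in> Y" "y \<in> Y" using y(1) Y by (auto simp: doubleton_eq_iff)
    have ex': "\<not> (tS x \<and> tS y)" "\<not> (tS x \<and> tH y)" 
      using ex y(1) by (auto simp: doubleton_eq_iff)
    have QQ': "\<not> (tQ x \<and> tQ y \<and> tS (mate (partner x)) \<and> tS (mate (partner y)))"
      using QQ y(1) by (auto simp: doubleton_eq_iff)
    consider "charge x = 0" | "tS x" "charge x = 10" | "tO x" "charge x = 4" | "tQ x" | "tH x" "charge x \<noteq> 0"
      using types[OF xY(1)] by (auto split: if_split_asm)
    then show ?thesis
    proof cases
      case 2
      then show ?thesis using types[OF xY(2)] ex' y(3) by (auto split: if_split_asm)
    next
      case 4
      show ?thesis
      proof (cases "charge x = 8")
        case True
        then have "tS (mate (partner x))" "\<not> tS y" using types[OF xY(1)] type_exclusive[OF 4] 4 y(2) by (auto split: if_split_asm)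
        then show ?thesis using types[OF xY(2)] QQ' 4 y(3) True le by (auto split: if_split_asm)
      next
        case False
        then show ?thesis using types[OF xY(1)] type_exclusive[OF 4] 4 le by (auto split: if_split_asm)
      qed
    next
      case 5
      then show ?thesis using cH[OF xY(1)] le by (auto split: if_split_asm)
    qed (use le in linarith)+
  qed
  have "charge a + charge b \<le> 14"
    using key[of a b] key[of b a] m by (cases "charge b \<le> charge a") (auto simp: insert_commute)
  then show ?thesis using Uv by simp
qed

text \<open>Three charges of 10 are excluded by \<open>heavy_not_three_free\<close>, so the worst
  case is 10 + 10 + 8.\<close>

lemma heavy_budget:
  assumes z: "z \<in> heavy A"
  shows "(\<Sum>a\<in>U z. charge a) \<le> 28"
proof -
  have "card (U z) = 3" using z unfolding heavy_def by simp
  then obtain a b c where U: "U z = {a, b, c}" "a \<noteq> b" "b \<noteq> c" "a \<noteq> c" by (auto simp: card_3_iff)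
  have X: "a \<in> X" "b \<in> X" "c \<in> X" using z U unfolding X_def by auto
  have le: "charge x \<le> 8 \<or> charge x = 10 \<and> (\<exists>j\<in>J. \<exists>f\<in>U j. x \<in> U j \<and> f \<in> Fr)" if "x \<in> X" for x
  proof (cases "\<forall>j\<in>J. x \<notin> U j")
    case True then show ?thesis unfolding charge_def by simp
  next
    case False
    then obtain j where j: "j \<in> J" "x \<in> U j" by blast
    then show ?thesis using charge_X[OF j that] by auto
  qed
  have "\<not> (charge a = 10 \<and> charge b = 10 \<and> charge c = 10)"
  proof
    assume "charge a = 10 \<and> charge b = 10 \<and> charge c = 10"
    then obtain ja jb jc fa fb fc where "ja \<in> J" "jb \<in> J" "jc \<in> J" "a \<in> U ja" "b \<in> U jb" "c \<in> U jc"
      "fa \<in> U ja" "fb \<in> U jb" "fc \<in> U jc" "fa \<in> Fr" "fb \<in> Fr" "fc \<in> Fr"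
      using le[OF X(1)] le[OF X(2)] le[OF X(3)] by auto
    then show False by (rule heavy_not_three_free[OF z U])
  qed
  then have "charge a + charge b + charge c \<le> 28" using le[OF X(1)] le[OF X(2)] le[OF X(3)] by linarith
  then show ?thesis using U by simp
qed

text \<open>By \<open>not_S_Q_S\<close> at most one of the two elements is reduced to 4, and then
  the other one pays 8; otherwise each pays at least 6.\<close>

lemma charge_Q_pair:
  assumes j: "j \<in> J" "U j \<inter> Y = {a, b}" "a \<noteq> b"
  shows "12 \<le> charge a + charge b"
proof -
  have aY: "a \<in> U j" "a \<in> Y" "b \<in> U j" "b \<in> Y" using j(2) by blast+
  have Q: "tQ a" "tQ b" using j unfolding tQ_def by (metis insert_commute)+
  have p: "partner a = b" "partner b = a" using partner_eq j by (metis insert_commute)+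
  have "\<not> (tS (mate a) \<and> tS (mate b))" using not_S_Q_S[OF Q(1)] p by auto
  then show ?thesis
    using charge_Y(3)[OF j(1) aY(1,2) Q(1)] charge_Y(3)[OF j(1) aY(3,4) Q(2)] p by auto
qed

text \<open>By \<open>not_S_Q_H_Q_S\<close> at most one element is reduced from 7 to 6, so the sum
  is at least 6 + 7 + 7.\<close>

lemma charge_H_triple:
  assumes h: "h \<in> J" "U h \<subseteq> Y" "card (U h) = 3"
  shows "20 \<le> (\<Sum>a\<in>U h. charge a)"
proof -
  obtain a b c where U: "U h = {a, b, c}" "a \<noteq> b" "b \<noteq> c" "a \<noteq> c" using h(3) by (auto simp: card_3_iff)
  have H: "tH x" if "x \<in> U h" for x using that h unfolding tH_def by blast
  have ch: "charge x = (if tQ (mate x) \<and> tS (mate (partner (mate x))) then 6 else 7)" if "x \<in> U h" for x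
    using charge_Y(4)[OF h(1) that _ H[OF that]] h(2) that by blast
  have "\<not> ((tQ (mate x) \<and> tS (mate (partner (mate x)))) \<and> tQ (mate y) \<and> tS (mate (partner (mate y))))"
    if "x \<in> U h" "y \<in> U h" "x \<noteq> y" for x y using not_S_Q_H_Q_S[OF h that] by blast
  from this[of a b] this[of b c] this[of a c]
  show ?thesis using U ch[of a] ch[of b] ch[of c] by auto
qed

text \<open>A set with a free element has only one of them and at most one light element, and every
  other element pays 10. A set of size 3 without free elements receives at least 8 + 8 + 8, 8 + 8 +
  4, 8 + 12 or 20, according to its number of light elements; a set of size 2 receives at least 16,
  8 + 4 or 12.\<close>

lemma charge_covers:
  assumes j: "j \<in> J"
  shows "10 * weight U j \<le> (\<Sum>a\<in>U j - Fr. charge a)"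
proof -
  let ?X = "U j \<inter> X" and ?Y = "U j \<inter> Y" and ?F = "U j \<inter> Fr"
  have fin: "finite (U j)" using finite_J[OF j] .
  have "U j = ?X \<union> ?Y \<union> ?F" "?X \<inter> ?Y = {}" "(?X \<union> ?Y) \<inter> ?F = {}"
    using X_Y_disjoint unfolding Fr_def by auto
  then have cards: "card (U j) = card ?X + card ?Y + card ?F"
    using fin by (metis card_Un_disjoint finite_Int finite_Un)
  have split: "(\<Sum>a\<in>U j - Fr. charge a) = (\<Sum>a\<in>?X. charge a) + (\<Sum>a\<in>?Y. charge a)"
  proof -
    have "U j - Fr = ?X \<union> ?Y" unfolding Fr_def by auto
    moreover have "?X \<inter> ?Y = {}" using X_Y_disjoint by blast
    ultimately show ?thesis using fin by (simp add: sum.union_disjoint)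
  qed
  have w: "weight U j = card (U j) - 1" unfolding weight_def ..
  have cU: "card (U j) = 2 \<or> card (U j) = 3" using card_J[OF j] .
  have one: "\<exists>x. ?Y = {x}" if "card ?Y = 1" using that by (auto simp: card_1_singleton_iff)
  show ?thesis
  proof (cases "?F = {}")
    case False
    then obtain f where f: "f \<in> U j" "f \<in> Fr" by blast
    have "?F = {f}" using not_two_free[of j f] j J_V f by blast
    then have F: "card ?F = 1" by simp
    have sX: "(\<Sum>a\<in>?X. charge a) = 10 * card ?X" using charge_X[OF j] False by simp
    have Y1: "card ?Y \<le> 1"
    proof (rule ccontr)
      assume "\<not> card ?Y \<le> 1"
      then have "card ?Y = 2" "card (U j) = 3" using cards F cU by auto
      then obtain a b where ab: "?Y = {a, b}" "a \<noteq> b" by (auto simp: card_2_iff)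
      have "a \<in> ?Y" "b \<in> ?Y" unfolding ab(1) by simp_all
      then have abY: "a \<in> Y" "b \<in> Y" "a \<in> U j" "b \<in> U j" by simp_all
      have "f \<noteq> a" "f \<noteq> b" using f abY unfolding Fr_def by auto
      then have "card {f, a, b} = 3" using ab by simp
      then have "{f, a, b} = U j" using f abY fin \<open>card (U j) = 3\<close> by (intro card_subset_eq) simp_all
      then show False
        using not_free_two_light[OF subsetD[OF J_V j] \<open>card (U j) = 3\<close> _ f(2) abY(1,2)] by metis
    qed
    have sY: "(\<Sum>a\<in>?Y. charge a) = 10 * card ?Y"
    proof (cases "card ?Y = 1")
      case True
      then obtain x where x: "?Y = {x}" using one by blast
      then have "x \<in> U j" "x \<in> Y" by blast+
      then have "charge x = 10" using charge_Y(1)[OF j] x False j unfolding tS_def by blast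
      then show ?thesis using x by simp
    next
      case False
      then have "?Y = {}" using Y1 fin by (metis One_nat_def card_0_eq finite_Int le_SucE le_zero_eq)
      then show ?thesis by simp
    qed
    show ?thesis unfolding split w sX sY using cards F by simp
  next
    case True
    have sX: "(\<Sum>a\<in>?X. charge a) = 8 * card ?X" using charge_X[OF j] True by simp
    have "card ?Y = 0 \<or> card ?Y = 1 \<or> card ?Y = 2 \<or> card ?Y = 3" using cards cU by linarith
    then consider "card ?Y = 0" | "card ?Y = 1" | "card ?Y = 2" | "card ?Y = 3" by (elim disjE)
    then show ?thesis
    proof cases
      case 1
      then show ?thesis unfolding split w sX using cards cU True by auto
    next
      case 2
      then obtain x where x: "?Y = {x}" using one by blast
      then have "x \<in> U j" "x \<in> Y" by blast+
      then have "charge x = 4" using charge_Y(2)[OF j] x True j unfolding tO_def by blast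
      then show ?thesis unfolding split w sX x using cards cU True x by auto
    next
      case 3
      then obtain a b where ab: "?Y = {a, b}" "a \<noteq> b" by (auto simp: card_2_iff)
      then have "12 \<le> (\<Sum>a\<in>?Y. charge a)" using charge_Q_pair[OF j] by simp
      then show ?thesis unfolding split w sX using cards cU True 3 by auto
    next
      case 4
      then have c3: "card (U j) = 3" using cards cU by auto
      then have "?Y = U j" using 4 fin by (intro card_subset_eq) auto
      then have "20 \<le> (\<Sum>a\<in>?Y. charge a)" using charge_H_triple[OF j _ c3] by auto
      then show ?thesis unfolding split w using c3 by simp
    qed
  qed
qed

theorem ratio: "5 * (\<Sum>j\<in>J. weight U j) \<le> 7 * (\<Sum>i\<in>A. weight U i)"
proof -
  have finJ: "finite J" and finA: "finite A" using indep_J indep_A indep_finite by auto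
  have "10 * (\<Sum>j\<in>J. weight U j) \<le> (\<Sum>j\<in>J. \<Sum>a\<in>U j - Fr. charge a)"
    unfolding sum_distrib_left by (rule sum_mono) (rule charge_covers)
  also have "\<dots> = (\<Sum>a\<in>(\<Union>j\<in>J. U j - Fr). charge a)"
    using finJ finite_J J_unique by (intro sum.UNION_disjoint[symmetric]) (auto simp: disjoint_iff)
  also have "\<dots> \<le> (\<Sum>a\<in>(\<Union>i\<in>A. U i). charge a)"
    using finA finite_U A_V X_Un_Y unfolding Fr_def by (intro sum_mono2) auto
  also have "\<dots> = (\<Sum>i\<in>A. \<Sum>a\<in>U i. charge a)"
    using finA finite_U A_V A_unique by (intro sum.UNION_disjoint) (auto simp: disjoint_iff)
  also have "\<dots> \<le> (\<Sum>i\<in>A. 14 * weight U i)"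
  proof (rule sum_mono)
    fix i assume "i \<in> A"
    then consider "i \<in> light A" | "i \<in> heavy A" using light_heavy(1)[OF A_V] by blast
    then show "(\<Sum>a\<in>U i. charge a) \<le> 14 * weight U i"
      using light_budget[of i] heavy_budget[of i] by cases (auto simp: weight_def light_def heavy_def)
  qed
  finally show ?thesis by (simp add: sum_distrib_left[symmetric])
qed

end

lemma (in packing) square_imp_result_ratio:
  assumes "square_imp_result V U A" "indep J"
  shows "5 * (\<Sum>j\<in>J. weight U j) \<le> 7 * (\<Sum>i\<in>A. weight U i)"
proof -
  interpret packing_opt V U A J
    using assms square_imp_result_indep by unfold_locales (auto simp: square_imp_result_def)
  show ?thesis by (rule ratio)
qed

section \<open>Dags, branchings and the greedy expansion\<close>

lemma in_degree_0_iff: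
  "finite (parcs F) \<Longrightarrow> in_degree (with_proj F) u = 0 \<longleftrightarrow> u \<notin> snd ` parcs F"
  unfolding in_degree_def in_arcs_def by (force simp: card_eq_0_iff)

lemma out_degree_0_iff:
  "finite (parcs F) \<Longrightarrow> out_degree (with_proj F) v = 0 \<longleftrightarrow> v \<notin> fst ` parcs F"
  unfolding out_degree_def out_arcs_def by (force simp: card_eq_0_iff)

locale dag =
  fixes D :: "'a pair_pre_digraph"
  assumes rooted_dag: "rooted_dag D"
begin

sublocale pair_digraph D using rooted_dag unfolding rooted_dag_def by blast

section \<open>Rooted dags and their spanning arborescences\<close>

definition root :: 'a where "root = (SOME r. is_root D r)"

lemma is_root_root: "is_root D root"
  unfolding root_def using rooted_dag unfolding rooted_dag_def by (metis someI_ex)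

lemma root_in: "root \<in> pverts D"
  using is_root_root unfolding is_root_def by blast

lemma acyclic_arcs: "acyclic (parcs D)"
proof (rule ccontr)
  assume "\<not> acyclic (parcs D)"
  then obtain v where "(v, v) \<in> (parcs D)\<^sup>+" unfolding acyclic_def by blast
  then obtain p where "awalk v p v" "p \<noteq> []" using reachable1_awalk by blast
  then have "closed_w p" unfolding closed_w_def by auto
  then show False using closed_w_imp_cycle rooted_dag unfolding rooted_dag_def by auto
qed

lemma root_reaches:
  assumes "v \<in> pverts D"
  shows "(root, v) \<in> (parcs D)\<^sup>*"
proof -
  obtain p where "awalk root p v" using is_root_root assms unfolding is_root_def apath_def by blast
  then show ?thesis using reachable_awalkI[of root p v] by (auto simp: reachable_def dest: rtrancl_on_rtranclI)
qed

lemma no_arc_into_root: "(u, root) \<notin> parcs D"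
proof
  assume a: "(u, root) \<in> parcs D"
  then have "(root, u) \<in> (parcs D)\<^sup>*" using root_reaches in_arcsD1 by blast
  then have "(root, root) \<in> (parcs D)\<^sup>+" using a by (meson rtrancl_into_trancl1)
  then show False using acyclic_arcs unfolding acyclic_def by blast
qed

lemma arc_into:
  assumes "v \<in> pverts D" "v \<noteq> root"
  shows "\<exists>u. (u, v) \<in> parcs D"
  using root_reaches[OF assms(1)] assms(2) by (metis rtranclE)

lemma wf_arcs: "wf (parcs D)"
  using acyclic_arcs pair_finite_arcs by (rule finite_acyclic_wf[rotated])

text \<open>Reachability from the root follows by induction along the arcs of D, which are
  well-founded because D is finite and acyclic. Walks from the root are unique because they can be
  retraced from their end: arcs with the same head coincide, and no arc enters the root.\<close>

lemma arborescenceI: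
  assumes F: "pverts F = pverts D" "parcs F \<subseteq> parcs D"
    and uniq: "\<And>e f. e \<in> parcs F \<Longrightarrow> f \<in> parcs F \<Longrightarrow> snd e = snd f \<Longrightarrow> e = f"
    and cov: "\<And>v. v \<in> pverts D \<Longrightarrow> v \<noteq> root \<Longrightarrow> v \<in> snd ` parcs F"
  shows "spanning_arborescence F D"
proof -
  interpret F: pair_digraph F
  proof
    show "finite (parcs F)" using F(2) pair_finite_arcs by (rule finite_subset)
    show "finite (pverts F)" using F(1) pair_finite_verts by simp
    fix e assume "e \<in> parcs F"
    then have "e \<in> parcs D" using F(2) by blast
    then show "fst e \<in> pverts F" "snd e \<in> pverts F" "fst e \<noteq> snd e"
      using F(1) arc_fst_in_verts arc_snd_in_verts pair_no_loops by simp_all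
  qed
  have reach: "v \<in> pverts D \<Longrightarrow> (root, v) \<in> (parcs F)\<^sup>*" for v
  proof (induction v rule: wf_induct[OF wf_arcs])
    case (1 v)
    show ?case
    proof (cases "v = root")
      case False
      then obtain u where u: "(u, v) \<in> parcs F" using cov 1(2) by force
      then have "(root, u) \<in> (parcs F)\<^sup>*" using 1 F in_arcsD1 by blast
      then show ?thesis using u by (meson rtrancl.rtrancl_into_rtrancl)
    qed simp
  qed
  have ex: "\<exists>p. F.apath root p v" if "v \<in> pverts F" for v
  proof -
    have "(root, v) \<in> (parcs F)\<^sup>*" using reach that F by simp
    moreover have "root \<in> pverts F" using root_in F by simp
    ultimately have "root \<rightarrow>\<^sup>*\<^bsub>with_proj F\<^esub> v"
      by (induction rule: rtrancl_induct) (auto intro: F.reachable_adj_trans)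
    then show ?thesis by (simp add: F.reachable_apath)
  qed
  have "p = q" if "F.awalk root p v" "F.awalk root q v" for p q v
    using that
  proof (induction p arbitrary: q v rule: rev_induct)
    case Nil
    then have v: "v = root" by (simp add: F.awalk_Nil_iff)
    show ?case
    proof (cases q rule: rev_cases)
      case (snoc q' e)
      then have "(fst e, root) \<in> parcs F"
        using Nil(2) v by (cases e) (auto simp: F.awalk_append_iff F.awalk_Cons_iff F.awalk_Nil_iff)
      then show ?thesis using no_arc_into_root F by blast
    qed simp
  next
    case (snoc e p)
    have e: "F.awalk root p (fst e)" "e \<in> parcs F" "snd e = v"
      using snoc.prems(1) by (auto simp: F.awalk_append_iff F.awalk_Cons_iff F.awalk_Nil_iff)
    show ?case
    proof (cases q rule: rev_cases)
      case Nil
      then have "v = root" using snoc.prems(2) by (simp add: F.awalk_Nil_iff)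
      then have "(fst e, root) \<in> parcs F" using e by (metis prod.collapse)
      then show ?thesis using no_arc_into_root F by blast
    next
      case (snoc q' e')
      then have e': "F.awalk root q' (fst e')" "e' \<in> parcs F" "snd e' = v"
        using snoc.prems(2) by (auto simp: F.awalk_append_iff F.awalk_Cons_iff F.awalk_Nil_iff)
      then have "e = e'" using uniq e by simp
      then show ?thesis using snoc.IH[OF e(1)] e'(1) snoc by simp
    qed
  qed
  then have "\<exists>!p. F.apath root p v" if "v \<in> pverts F" for v
    using ex[OF that] unfolding F.apath_def by blast
  moreover have "is_root F root" unfolding is_root_def using ex root_in F by simp
  ultimately have "arborescence F" unfolding arborescence_def using F.pair_digraph by blast
  moreover have "spanning (with_proj F) (with_proj D)"
    unfolding spanning_def subgraph_def compatible_def using F F.wf_digraph_axioms wf_digraph_axioms by auto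
  ultimately show ?thesis unfolding spanning_arborescence_def by blast
qed

lemma num_leaves_eq:
  assumes "pverts F = pverts D" "parcs F \<subseteq> parcs D"
  shows "num_leaves F + card (fst ` parcs F) = card (pverts D)"
proof -
  have fin: "finite (parcs F)" using assms(2) pair_finite_arcs finite_subset by blast
  have sub: "fst ` parcs F \<subseteq> pverts D" using assms(2) arc_fst_in_verts by blast
  have "{v \<in> pverts F. out_degree (with_proj F) v = 0} = pverts D - fst ` parcs F"
    using out_degree_0_iff[OF fin] assms(1) by auto
  then have "num_leaves F = card (pverts D) - card (fst ` parcs F)"
    unfolding num_leaves_def using sub fin by (simp add: card_Diff_subset)
  moreover have "card (fst ` parcs F) \<le> card (pverts D)" using sub pair_finite_verts by (rule card_mono[rotated])
  ultimately show ?thesis by simp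
qed

lemma spanning_arborescence_sub:
  assumes "spanning_arborescence T D"
  shows "pverts T = pverts D" "parcs T \<subseteq> parcs D"
  using assms unfolding spanning_arborescence_def spanning_def subgraph_def by auto

text \<open>The root of T has to be \<open>root\<close>: otherwise T would have an arc into
  \<open>root\<close>, but D has none.\<close>

lemma spanning_arborescence_cov:
  assumes "spanning_arborescence T D" "v \<in> pverts D" "v \<noteq> root"
  shows "v \<in> snd ` parcs T"
proof -
  note sub = spanning_arborescence_sub[OF assms(1)]
  obtain r where T: "pair_digraph T" "is_root T r"
    using assms(1) unfolding spanning_arborescence_def arborescence_def by blast
  interpret T: pair_digraph T by fact
  have last: "w \<in> snd ` parcs T" if w: "w \<in> pverts T" "w \<noteq> r" for w
  proof -
    obtain p where p: "T.awalk r p w" using T(2) w unfolding is_root_def T.apath_def by blast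
    show ?thesis
    proof (cases p rule: rev_cases)
      case Nil then show ?thesis using p w by (simp add: T.awalk_Nil_iff)
    next
      case (snoc q e)
      then have "e \<in> parcs T" "snd e = w" using p by (auto simp: T.awalk_append_iff T.awalk_Cons_iff T.awalk_Nil_iff)
      then show ?thesis by force
    qed
  qed
  have "r = root"
  proof (rule ccontr)
    assume "r \<noteq> root"
    then have "root \<in> snd ` parcs T" using last root_in sub by simp
    then show False using no_arc_into_root sub(2) by force
  qed
  then show ?thesis using last assms sub by simp
qed

definition avail :: "'a pair_pre_digraph \<Rightarrow> 'a \<Rightarrow> ('a \<times> 'a) set" where
  "avail F v = {e \<in> parcs D. fst e = v \<and> snd e \<notin> snd ` parcs F}"

text \<open>In a dag, a spanning subgraph with all in-degrees at most one is a spanning branching,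
  so no further condition is imposed.\<close>

definition branching :: "'a pair_pre_digraph \<Rightarrow> bool" where
  "branching F \<longleftrightarrow> pverts F = pverts D \<and> parcs F \<subseteq> parcs D \<and> inj_on snd (parcs F)"

section \<open>Invariants of the greedy expansion\<close>

lemma branching_finite: "branching F \<Longrightarrow> finite (parcs F)"
  unfolding branching_def using pair_finite_arcs finite_subset by blast

lemma finite_avail: "finite (avail F v)"
  unfolding avail_def using pair_finite_arcs by simp

lemma expand_node_eq:
  assumes "finite (parcs F)"
  shows "expand_node D t v F =
    (if v \<notin> fst ` parcs F \<and> t \<le> card (avail F v) then F\<lparr>parcs := parcs F \<union> avail F v\<rparr> else F)"
proof -
  have "{e \<in> out_arcs (with_proj D) v. in_degree (with_proj F) (snd e) = 0} = avail F v"
    unfolding avail_def using in_degree_0_iff[OF assms] by auto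
  then show ?thesis unfolding expand_node_def Let_def out_degree_0_iff[OF assms] by simp
qed

lemma expand_node_branching:
  assumes "branching F"
  shows "branching (expand_node D t v F)" "parcs F \<subseteq> parcs (expand_node D t v F)"
proof -
  note fin = branching_finite[OF assms]
  have "inj_on snd (parcs F \<union> avail F v)"
    unfolding inj_on_Un
  proof (intro conjI)
    show "inj_on snd (parcs F)" using assms unfolding branching_def by blast
    show "inj_on snd (avail F v)" unfolding avail_def by (auto simp: inj_on_def)
    show "snd ` (parcs F - avail F v) \<inter> snd ` (avail F v - parcs F) = {}"
    proof (rule equals0I, elim IntE imageE)
      fix u e f assume "e \<in> parcs F - avail F v" "u = snd e" "f \<in> avail F v - parcs F" "u = snd f"
      then have "snd f \<notin> snd ` parcs F" "e \<in> parcs F" "snd f = snd e" unfolding avail_def by simp_all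
      then show False by (metis image_eqI)
    qed
  qed
  then show "branching (expand_node D t v F)"
    using assms unfolding expand_node_eq[OF fin] branching_def avail_def by auto
  show "parcs F \<subseteq> parcs (expand_node D t v F)" unfolding expand_node_eq[OF fin] by auto
qed

lemma avail_antimono: "parcs F \<subseteq> parcs F' \<Longrightarrow> avail F' v \<subseteq> avail F v"
  unfolding avail_def by auto

lemma fold_expand_branching:
  assumes "branching F"
  shows "branching (fold (expand_node D t) vs F)" "parcs F \<subseteq> parcs (fold (expand_node D t) vs F)"
  using assms
proof (induction vs arbitrary: F)
  case (Cons v vs)
  { case 1 then show ?case using Cons.IH expand_node_branching by simp }
  { case 2 then show ?case using Cons.IH(2) expand_node_branching[of F t v] by (metis fold_simps(2) order_trans) }
qed auto

text \<open>When v was visited it had fewer than t available arcs, since otherwise it would have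
  been expanded; \<open>1 \<le> t\<close> ensures that an expansion adds an arc. Available arcs only
  disappear later.\<close>

lemma fold_expand_stuck:
  assumes "branching F" "1 \<le> t" "v \<in> set vs" "v \<notin> fst ` parcs (fold (expand_node D t) vs F)"
  shows "card (avail (fold (expand_node D t) vs F) v) < t"
  using assms
proof (induction vs arbitrary: F)
  case (Cons w vs)
  let ?F = "expand_node D t w F"
  have b: "branching ?F" using expand_node_branching Cons.prems(1) by blast
  show ?case
  proof (cases "v = w")
    case True
    note fin = branching_finite[OF Cons.prems(1)]
    have sub: "parcs ?F \<subseteq> parcs (fold (expand_node D t) vs ?F)" using fold_expand_branching(2)[OF b] .
    then have "v \<notin> fst ` parcs ?F" using Cons.prems(4) by auto
    moreover have "card (avail F v) < t"
    proof (rule ccontr)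
      assume *: "\<not> card (avail F v) < t"
      then obtain e where "e \<in> avail F v" using Cons.prems(2) by (metis card.empty equals0I not_less_eq_eq One_nat_def not_less)
      moreover have "v \<notin> fst ` parcs F" using calculation expand_node_branching(2)[OF Cons.prems(1), of t w]
          \<open>v \<notin> fst ` parcs ?F\<close> by blast
      ultimately have "e \<in> parcs ?F" "fst e = v" using * True unfolding expand_node_eq[OF fin] by (auto simp: avail_def)
      then show False using \<open>v \<notin> fst ` parcs ?F\<close> by force
    qed
    moreover have "avail (fold (expand_node D t) vs ?F) v \<subseteq> avail F v"
      using avail_antimono sub expand_node_branching(2)[OF Cons.prems(1)] by (meson order_trans)
    ultimately show ?thesis using card_mono[OF finite_avail] by (metis fold_simps(2) le_less_trans)
  next
    case False
    then show ?thesis using Cons.IH[OF b] Cons.prems by simp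
  qed
qed simp

text \<open>An expansion takes all arcs of v to uncovered heads at once, and covered heads stay
  covered.\<close>

lemma fold_expand_full:
  assumes "branching F" "v \<notin> fst ` parcs F" "v \<in> fst ` parcs (fold (expand_node D t) vs F)" "(v, u) \<in> parcs D"
  shows "u \<in> snd ` parcs (fold (expand_node D t) vs F)"
  using assms
proof (induction vs arbitrary: F)
  case (Cons w vs)
  let ?F = "expand_node D t w F"
  note fin = branching_finite[OF Cons.prems(1)]
  have b: "branching ?F" using expand_node_branching Cons.prems(1) by blast
  show ?case
  proof (cases "v \<in> fst ` parcs ?F")
    case True
    then have eq: "parcs ?F = parcs F \<union> avail F w" "v \<in> fst ` avail F w"
      using Cons.prems(2) unfolding expand_node_eq[OF fin] by (auto split: if_splits)
    then have "w = v" unfolding avail_def by auto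
    then have "(v, u) \<in> avail F w \<or> u \<in> snd ` parcs F" using Cons.prems(4) unfolding avail_def by simp
    then have "u \<in> snd ` parcs ?F" unfolding eq(1) by force
    then show ?thesis using fold_expand_branching(2)[OF b, of t vs] by auto
  next
    case False
    then show ?thesis using Cons.IH[OF b] Cons.prems by simp
  qed
qed simp

text \<open>Each expansion creates at most one new inner node and adds at least t arcs.\<close>

lemma fold_expand_ratio:
  assumes "branching F" "t * card (fst ` parcs F) \<le> card (parcs F)"
  shows "t * card (fst ` parcs (fold (expand_node D t) vs F)) \<le> card (parcs (fold (expand_node D t) vs F))"
  using assms
proof (induction vs arbitrary: F)
  case (Cons w vs)
  let ?F = "expand_node D t w F"
  note fin = branching_finite[OF Cons.prems(1)]
  have b: "branching ?F" using expand_node_branching Cons.prems(1) by blast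
  have "t * card (fst ` parcs ?F) \<le> card (parcs ?F)"
  proof (cases "w \<notin> fst ` parcs F \<and> t \<le> card (avail F w)")
    case True
    then have eq: "parcs ?F = parcs F \<union> avail F w" unfolding expand_node_eq[OF fin] by simp
    have "fst ` parcs ?F \<subseteq> insert w (fst ` parcs F)" unfolding eq avail_def by auto
    then have "card (fst ` parcs ?F) \<le> card (insert w (fst ` parcs F))" using fin by (intro card_mono) auto
    also have "\<dots> = Suc (card (fst ` parcs F))" using True fin by simp
    finally have "t * card (fst ` parcs ?F) \<le> t * Suc (card (fst ` parcs F))" by (rule mult_left_mono) simp
    also have "\<dots> \<le> card (parcs F) + card (avail F w)" using Cons.prems(2) True by simp
    also have "\<dots> = card (parcs ?F)" unfolding eq
      using fin finite_avail by (intro card_Un_disjoint[symmetric]) (auto simp: avail_def)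
    finally show ?thesis .
  next
    case False then show ?thesis using Cons.prems unfolding expand_node_eq[OF fin] by auto
  qed
  then show ?case using Cons.IH[OF b] by simp
qed simp

lemma branching_card_snd: "branching F \<Longrightarrow> card (snd ` parcs F) = card (parcs F)"
  unfolding branching_def by (intro card_image) auto

lemma branching_no_arcs: "branching (no_arcs D)"
  unfolding branching_def no_arcs_def by auto

end

locale phase1 = dag +
  fixes F1 :: "'a pair_pre_digraph"
  assumes F1: "greedy_expand D 4 (no_arcs D) F1"
begin

lemma F1_fold: obtains vs where "set vs = pverts D" "F1 = fold (expand_node D 4) vs (no_arcs D)"
  using F1 unfolding greedy_expand_def by blast

lemma F1_branching: "branching F1"
  using F1_fold fold_expand_branching(1)[OF branching_no_arcs] by metis

lemma F1_full: "v \<in> fst ` parcs F1 \<Longrightarrow> (v, u) \<in> parcs D \<Longrightarrow> u \<in> snd ` parcs F1"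
  by (rule F1_fold) (use fold_expand_full[OF branching_no_arcs] in \<open>auto simp: no_arcs_def\<close>)

lemma F1_ratio: "4 * card (fst ` parcs F1) \<le> card (parcs F1)"
  by (rule F1_fold) (use fold_expand_ratio[OF branching_no_arcs] in \<open>auto simp: no_arcs_def\<close>)

lemma finite_F1: "finite (parcs F1)"
  using F1_branching branching_finite by blast

abbreviation "fh \<equiv> free_heads D F1"
abbreviation "V \<equiv> candidates D F1"
abbreviation "U \<equiv> candidate_set D F1"

lemma fh_eq: "fh v = {u. (v, u) \<in> parcs D \<and> u \<notin> snd ` parcs F1}"
  unfolding free_heads_def using in_degree_0_iff[OF finite_F1] in_arcsD2 by auto

lemma finite_fh: "finite (fh v)"
  unfolding free_heads_def using pair_finite_verts by simp

lemma card_fh: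
  assumes "v \<in> pverts D" "v \<notin> fst ` parcs F1"
  shows "card (fh v) \<le> 3"
proof -
  have "fh v = snd ` avail F1 v" unfolding fh_eq avail_def by force
  then have "card (fh v) \<le> card (avail F1 v)" using card_image_le finite_avail by metis
  moreover have "card (avail F1 v) < 4"
    by (rule F1_fold) (use fold_expand_stuck[OF branching_no_arcs, of 4] assms in auto)
  ultimately show ?thesis by simp
qed

lemma Orig_in: "Orig v \<in> V \<longleftrightarrow> v \<in> pverts D \<and> v \<notin> fst ` parcs F1 \<and> 2 \<le> card (fh v)"
  unfolding candidates_def out_degree_0_iff[OF finite_F1] using card_fh by auto

lemma Drop_in: "Drop v u \<in> V \<longleftrightarrow> v \<in> pverts D \<and> v \<notin> fst ` parcs F1 \<and> card (fh v) = 3 \<and> u \<in> fh v"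
  unfolding candidates_def out_degree_0_iff[OF finite_F1] by auto

lemma finite_candidates: "finite V"
proof -
  have "V \<subseteq> Orig ` pverts D \<union> (\<lambda>(v, u). Drop v u) ` (pverts D \<times> pverts D)"
    unfolding candidates_def free_heads_def by auto
  then show ?thesis using pair_finite_verts finite_subset by blast
qed

lemma candidate_set_subset: "U x \<subseteq> fh (underlying x)"
  by (cases x) auto

text \<open>Removing an element from a 3-set of some \<open>Orig v\<close> gives the set of a
  \<open>Drop\<close>; sets of \<open>Drop\<close> candidates have size 2, so nothing is required of
  them.\<close>

sublocale packing V U
proof
  show "finite V" by (rule finite_candidates)
  fix x assume x: "x \<in> V"
  show "card (U x) = 2 \<or> card (U x) = 3"
    using x finite_fh card_fh by (cases x) (fastforce simp: Orig_in Drop_in)+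
  assume 3: "card (U x) = 3" fix a assume a: "a \<in> U x"
  show "\<exists>x'\<in>V. U x' = U x - {a}"
  proof (cases x)
    case (Orig v)
    then have "Drop v a \<in> V" using x 3 a by (simp add: Orig_in Drop_in)
    then show ?thesis using Orig by (intro bexI[of _ "Drop v a"]) auto
  next
    case (Drop v u)
    then show ?thesis using x 3 finite_fh by (auto simp: Drop_in)
  qed
qed

lemma steps_bound:
  assumes "(square_imp_step V U ^^ k) {} A"
  shows "k \<le> 3 * card (pverts D)"
proof -
  have "(\<Union>v\<in>V. U v) \<subseteq> pverts D" using candidate_set_subset unfolding free_heads_def by blast
  then have "card (\<Union>v\<in>V. U v) \<le> card (pverts D)" using pair_finite_verts by (intro card_mono)
  then show ?thesis using square_imp_steps_bound[OF assms] by linarith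
qed

lemma num_leaves_upper:
  assumes T: "spanning_arborescence T D"
  obtains J where "indep J" "num_leaves T \<le> 1 + card (parcs F1) + (\<Sum>x\<in>J. weight U x)"
proof -
  note sub = spanning_arborescence_sub[OF T]
  define R where "R = pverts D - {root} - snd ` parcs F1"
  obtain \<pi> where \<pi>: "(\<pi> u, u) \<in> parcs T" if "u \<in> R" for u
  proof -
    have "\<forall>u\<in>R. \<exists>v. (v, u) \<in> parcs T"
      using spanning_arborescence_cov[OF T] unfolding R_def by force
    then show ?thesis using that by metis
  qed
  have finR: "finite R" unfolding R_def using pair_finite_verts by simp
  define S where "S v = {u\<in>R. \<pi> u = v}" for v
  have finS: "finite (S v)" for v unfolding S_def using finR by simp
  define W where "W = {v \<in> \<pi> ` R. 2 \<le> card (S v)}"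
  have finW: "finite W" unfolding W_def using finR by simp
  have Sfh: "S v \<subseteq> fh v" for v
    unfolding S_def fh_eq using \<pi> sub(2) unfolding R_def by blast
  \<comment> \<open>A parent of a node in R is not expanded in \<open>F1\<close>, since
    \<open>F1\<close> covers all out-neighbours of the nodes it expands.\<close>
  have vW: "v \<in> pverts D \<and> v \<notin> fst ` parcs F1" if v: "v \<in> \<pi> ` R" for v
  proof -
    obtain u where u: "u \<in> R" "v = \<pi> u" using v by blast
    then have "(v, u) \<in> parcs D" using \<pi> sub by blast
    then show ?thesis using in_arcsD1 F1_full u unfolding R_def by blast
  qed
  have "\<exists>x\<in>V. underlying x = v \<and> U x = S v" if v: "v \<in> W" for v
  proof -
    have v': "v \<in> pverts D" "v \<notin> fst ` parcs F1" "2 \<le> card (S v)" using vW v unfolding W_def by auto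
    have le: "card (S v) \<le> card (fh v)" using Sfh finite_fh by (rule card_mono[rotated])
    show ?thesis
    proof (cases "S v = fh v")
      case True
      then show ?thesis using v' by (intro bexI[of _ "Orig v"]) (auto simp: Orig_in)
    next
      case False
      then have "card (S v) < card (fh v)" using Sfh finite_fh by (intro psubset_card_mono) auto
      then have c: "card (S v) = 2" "card (fh v) = 3" using v' card_fh[OF v'(1,2)] by linarith+
      then have "card (fh v - S v) = 1" using Sfh finS by (simp add: card_Diff_subset)
      then obtain u where "fh v - S v = {u}" by (auto simp: card_1_singleton_iff)
      then have "u \<in> fh v" "fh v - {u} = S v" using Sfh by auto
      then show ?thesis using v' c by (intro bexI[of _ "Drop v u"]) (auto simp: Drop_in)
    qed
  qed
  then obtain c where c: "\<And>v. v \<in> W \<Longrightarrow> c v \<in> V \<and> underlying (c v) = v \<and> U (c v) = S v" by metis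
  have injc: "inj_on c W" using c by (metis inj_onI)
  have "indep (c ` W)"
    unfolding independent_set_iff using c by (auto simp: S_def)
  moreover have "num_leaves T \<le> 1 + card (parcs F1) + (\<Sum>x\<in>c ` W. weight U x)"
  proof -
    have "(\<Sum>x\<in>c ` W. weight U x) = (\<Sum>v\<in>W. card (S v) - 1)"
      unfolding sum.reindex[OF injc] using c by (simp add: weight_def)
    also have "\<dots> = (\<Sum>v\<in>\<pi> ` R. card (S v) - 1)"
      using finR by (intro sum.mono_neutral_left) (auto simp: W_def)
    finally have w: "(\<Sum>x\<in>c ` W. weight U x) = (\<Sum>v\<in>\<pi> ` R. card (S v) - 1)" .
    have "R = (\<Union>v\<in>\<pi> ` R. S v)" unfolding S_def by auto
    then have "card R = card (\<Union>v\<in>\<pi> ` R. S v)" by simp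
    also have "\<dots> = (\<Sum>v\<in>\<pi> ` R. card (S v))"
      using finR finS by (intro card_UN_disjoint) (auto simp: S_def)
    also have "\<dots> \<le> (\<Sum>v\<in>\<pi> ` R. 1 + (card (S v) - 1))" by (intro sum_mono) simp
    also have "\<dots> = card (\<pi> ` R) + (\<Sum>x\<in>c ` W. weight U x)" unfolding sum.distrib w by simp
    finally have R: "card R \<le> card (\<pi> ` R) + (\<Sum>x\<in>c ` W. weight U x)" .
    have "\<pi> ` R \<subseteq> fst ` parcs T" using \<pi> by force
    then have "card (\<pi> ` R) \<le> card (fst ` parcs T)"
      using finite_subset[OF sub(2) pair_finite_arcs] by (intro card_mono) auto
    moreover have "card (pverts D) \<le> 1 + card R + card (parcs F1)"
    proof -
      have "pverts D \<subseteq> insert root (R \<union> snd ` parcs F1)" unfolding R_def by auto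
      then have "card (pverts D) \<le> card (insert root (R \<union> snd ` parcs F1))"
        using finR finite_F1 by (intro card_mono) auto
      also have "\<dots> \<le> 1 + card (R \<union> snd ` parcs F1)" using finR finite_F1 by (simp add: card_insert_if)
      also have "\<dots> \<le> 1 + (card R + card (snd ` parcs F1))" using card_Un_le by simp
      also have "\<dots> = 1 + card R + card (parcs F1)" using branching_card_snd[OF F1_branching] by simp
      finally show ?thesis .
    qed
    ultimately show ?thesis using num_leaves_eq[OF sub] R by linarith
  qed
  ultimately show ?thesis using that by blast
qed

end

locale phase2 = phase1 +
  fixes I T
  assumes I: "square_imp_result V U I" and T: "greedy_expand D 1 (add_selected D F1 I) T"
begin

lemma indep_I: "indep I" using I by (rule square_imp_result_indep)

lemma I_V: "I \<subseteq> V" and finite_I: "finite I"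
  using indep_I indep_finite by (auto simp: independent_set_iff)

definition sel where "sel = (\<lambda>(x, u). (underlying x, u)) ` (SIGMA x:I. U x)"

lemma parcs_F2: "parcs (add_selected D F1 I) = parcs F1 \<union> sel"
  unfolding add_selected_def sel_def by auto

lemma I_unique: "x \<in> I \<Longrightarrow> y \<in> I \<Longrightarrow> u \<in> U x \<Longrightarrow> u \<in> U y \<Longrightarrow> x = y"
  using indep_I by (rule indep_unique)

lemma sel_arcs: "sel \<subseteq> parcs D" "snd ` sel \<inter> snd ` parcs F1 = {}"
proof -
  have *: "(v, u) \<in> parcs D \<and> u \<notin> snd ` parcs F1" if vu: "(v, u) \<in> sel" for v u
  proof -
    obtain x where "x \<in> I" "u \<in> U x" "v = underlying x" using vu unfolding sel_def by auto
    then have "u \<in> fh v" using candidate_set_subset by blast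
    then show ?thesis unfolding fh_eq by simp
  qed
  then show "sel \<subseteq> parcs D" by force
  show "snd ` sel \<inter> snd ` parcs F1 = {}"
  proof (rule equals0I, elim IntE imageE)
    fix u e f assume "e \<in> sel" "u = snd e" "f \<in> parcs F1" "u = snd f"
    then show False using *[of "fst e" "snd e"] by (metis image_eqI prod.collapse)
  qed
qed

lemma F2_branching: "branching (add_selected D F1 I)"
proof -
  have "pverts (add_selected D F1 I) = pverts D" "parcs F1 \<subseteq> parcs D" "inj_on snd (parcs F1)"
    using F1_branching unfolding branching_def add_selected_def by auto
  moreover note sel_arcs
  moreover have "inj_on snd sel"
    unfolding sel_def using I_unique by (auto simp: inj_on_def)
  ultimately show ?thesis
    unfolding branching_def parcs_F2 by (auto simp: inj_on_Un)
qed

lemma card_F2: "card (parcs (add_selected D F1 I)) = card (parcs F1) + (\<Sum>x\<in>I. card (U x))"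
proof -
  have "inj_on (\<lambda>(x, u). (underlying x, u)) (SIGMA x:I. U x)"
    using I_unique by (auto simp: inj_on_def)
  then have "card sel = card (SIGMA x:I. U x)" unfolding sel_def by (rule card_image)
  also have "\<dots> = (\<Sum>x\<in>I. card (U x))" using finite_I finite_U I_V by (intro card_SigmaI) auto
  finally have s: "card sel = (\<Sum>x\<in>I. card (U x))" .
  have "parcs F1 \<inter> sel = {}" using sel_arcs(2) by auto
  moreover have "finite sel" using branching_finite[OF F2_branching] unfolding parcs_F2 by simp
  ultimately show ?thesis unfolding parcs_F2 using finite_F1 s by (simp add: card_Un_disjoint)
qed

text \<open>
  A head \<open>u\<close> dropped by a selected \<open>Drop v u\<close> is covered by another selected set: otherwise the
  single vertex \<open>Orig v\<close> would be an improving claw.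
\<close>

lemma selected_full:
  assumes "x \<in> I" "(underlying x, u) \<in> parcs D"
  shows "u \<in> snd ` (parcs F1 \<union> sel)"
proof (rule ccontr)
  assume u: "u \<notin> snd ` (parcs F1 \<union> sel)"
  have nsel: "u \<notin> U y" if "y \<in> I" for y
    using u that unfolding sel_def by force
  have ufh: "u \<in> fh (underlying x)" using assms(2) u unfolding fh_eq by auto
  then obtain v where x: "x = Drop v u" using nsel[OF assms(1)] by (cases x) auto
  then have V: "Orig v \<in> V" "card (fh v) = 3" using subsetD[OF I_V assms(1)] by (auto simp: Drop_in Orig_in)
  have "hits I {Orig v} \<subseteq> {x}"
  proof
    fix y assume "y \<in> hits I {Orig v}"
    then obtain a where a: "y \<in> I" "a \<in> U y" "a \<in> fh v" unfolding hits_def by auto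
    then have "a \<noteq> u" using nsel by blast
    then have "a \<in> U x" using a x by simp
    then show "y \<in> {x}" using I_unique a assms(1) by blast
  qed
  then have "w2plus U (hits I {Orig v}) \<le> w2plus U {x}" unfolding w2plus_def by (intro sum_mono2) auto
  moreover have "w2plus U {Orig v} \<le> w2plus U (hits I {Orig v})"
  proof (rule claw_local_opt[OF indep_I _ single_claw[OF V(1)]])
    show "\<nexists>B. claw_step V U I B" using I unfolding square_imp_result_def square_imp_step_def by blast
  qed
  moreover have "card (U x) = 2" using x V ufh finite_fh by simp
  ultimately have "w2plus U {Orig v} \<le> w2plus U {x}" "card (U x) = 2" by simp_all
  then show False using V by (simp add: w2plus_def weight_def power2_eq_square)
qed

lemma T_fold: obtains vs where "set vs = pverts D" "T = fold (expand_node D 1) vs (add_selected D F1 I)"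
  using T unfolding greedy_expand_def by blast

lemma T_branching: "branching T" "parcs (add_selected D F1 I) \<subseteq> parcs T"
  using T_fold fold_expand_branching[OF F2_branching] by metis+

text \<open>Take any in-neighbour v of u. If v was expanded in one of the three phases, all its
  out-neighbours are covered; if it is a leaf of T, it has no available arc left, so u is
  covered.\<close>

lemma T_covers:
  assumes "u \<in> pverts D" "u \<noteq> root"
  shows "u \<in> snd ` parcs T"
proof -
  obtain v where v: "(v, u) \<in> parcs D" using arc_into[OF assms] by blast
  obtain vs where vs: "set vs = pverts D" "T = fold (expand_node D 1) vs (add_selected D F1 I)" using T_fold .
  consider "v \<in> fst ` parcs F1" | "v \<in> fst ` sel" | "v \<in> fst ` parcs T" "v \<notin> fst ` (parcs F1 \<union> sel)" | "v \<notin> fst ` parcs T"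
    by blast
  then show ?thesis
  proof cases
    case 1
    then show ?thesis using F1_full v T_branching(2) unfolding parcs_F2 by blast
  next
    case 2
    then obtain x where "x \<in> I" "v = underlying x" unfolding sel_def by auto
    then show ?thesis using selected_full v T_branching(2) unfolding parcs_F2 by blast
  next
    case 3
    then show ?thesis using fold_expand_full[OF F2_branching, of v 1 vs u] v vs unfolding parcs_F2 by simp
  next
    case 4
    then have "card (avail T v) < 1"
      using fold_expand_stuck[OF F2_branching, of 1 v vs] vs v in_arcsD1 by simp
    then have "avail T v = {}" using finite_avail by simp
    then show ?thesis using v unfolding avail_def by force
  qed
qed

lemma T_arborescence: "spanning_arborescence T D"
  using T_branching(1) T_covers unfolding branching_def by (intro arborescenceI) (auto dest: inj_onD)

text \<open>T has one arc less than nodes. Its inner nodes are at most those of \<open>F1\<close>,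
  one for each selected set, and one for each arc of the last phase. So a selected set contributes
  its size minus one, and the last phase loses nothing.\<close>

lemma num_leaves_lower: "1 + card (parcs F1) + (\<Sum>x\<in>I. weight U x) \<le> num_leaves T + card (fst ` parcs F1)"
proof -
  let ?F2 = "parcs (add_selected D F1 I)"
  have sub: "pverts T = pverts D" "parcs T \<subseteq> parcs D" and finT: "finite (parcs T)"
    using T_branching(1) branching_finite unfolding branching_def by blast+
  have "snd ` parcs T = pverts D - {root}"
    using T_covers sub no_arc_into_root arc_snd_in_verts by force
  then have "card (parcs T) = card (pverts D) - 1"
    using branching_card_snd[OF T_branching(1)] root_in by simp
  moreover have "0 < card (pverts D)" using root_in pair_finite_verts by (auto simp: card_gt_0_iff)
  ultimately have n: "card (pverts D) = 1 + card (parcs T)" by simp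
  have "fst ` parcs T \<subseteq> fst ` parcs F1 \<union> (underlying ` I \<union> fst ` (parcs T - ?F2))"
    unfolding parcs_F2 sel_def by auto
  then have "card (fst ` parcs T) \<le> card (fst ` parcs F1 \<union> (underlying ` I \<union> fst ` (parcs T - ?F2)))"
    using finite_F1 finite_I finT by (intro card_mono) auto
  also have "\<dots> \<le> card (fst ` parcs F1) + (card (underlying ` I) + card (fst ` (parcs T - ?F2)))"
    using card_Un_le[of "fst ` parcs F1"] card_Un_le[of "underlying ` I"] by (meson add_left_mono order_trans)
  also have "\<dots> \<le> card (fst ` parcs F1) + (card I + card (parcs T - ?F2))"
    using card_image_le finite_I finT by (meson add_left_mono add_mono finite_Diff)
  also have "card (parcs T - ?F2) = card (parcs T) - card ?F2"
    using T_branching(2) finT by (intro card_Diff_subset) (auto intro: finite_subset)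
  finally have t: "card (fst ` parcs T) \<le> card (fst ` parcs F1) + (card I + (card (parcs T) - card ?F2))" .
  have "card ?F2 \<le> card (parcs T)" using T_branching(2) finT by (rule card_mono[rotated])
  moreover have "(\<Sum>x\<in>I. card (U x)) = card I + (\<Sum>x\<in>I. weight U x)"
  proof -
    have "(\<Sum>x\<in>I. card (U x)) = (\<Sum>x\<in>I. 1 + weight U x)"
      using card_U I_V unfolding weight_def by (intro sum.cong) fastforce+
    then show ?thesis unfolding sum.distrib by simp
  qed
  ultimately show ?thesis using t n num_leaves_eq[OF sub] card_F2 by linarith
qed

theorem approximation: "5 * max_leaves D \<le> 7 * num_leaves T"
proof -
  have bound: "5 * num_leaves T' \<le> 7 * num_leaves T" if T': "spanning_arborescence T' D" for T'
  proof -
    obtain J where J: "indep J" "num_leaves T' \<le> 1 + card (parcs F1) + (\<Sum>x\<in>J. weight U x)"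
      using num_leaves_upper[OF T'] .
    \<comment> \<open>With m arcs and i inner nodes in \<open>F1\<close>: 5 (1 + m + w(J)) \<le> 5 +
      5 m + 7 w(I) \<le> 7 (1 + m - i + w(I)), where the last step uses 7 i \<le> 8 i \<le> 2
      m.\<close>
    show ?thesis
      using J(2) square_imp_result_ratio[OF I J(1)] num_leaves_lower F1_ratio by linarith
  qed
  have "finite {T'. spanning_arborescence T' D}"
  proof (rule finite_subset)
    show "{T'. spanning_arborescence T' D} \<subseteq> (\<lambda>A. \<lparr>pverts = pverts D, parcs = A\<rparr>) ` Pow (parcs D)"
    proof
      fix T' assume "T' \<in> {T'. spanning_arborescence T' D}"
      then have "pverts T' = pverts D" "parcs T' \<subseteq> parcs D" using spanning_arborescence_sub by blast+
      then show "T' \<in> (\<lambda>A. \<lparr>pverts = pverts D, parcs = A\<rparr>) ` Pow (parcs D)" by (cases T') auto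
    qed
    show "finite ((\<lambda>A. \<lparr>pverts = pverts D, parcs = A\<rparr>) ` Pow (parcs D))" using pair_finite_arcs by simp
  qed
  then have "max_leaves D \<in> num_leaves ` {T'. spanning_arborescence T' D}"
    unfolding max_leaves_def using T_arborescence by (intro Max_in) auto
  then show ?thesis using bound by auto
qed

end

lemma approximation_guarantee:
  assumes "rooted_dag D" "max_leaves_12mis D T"
  shows "spanning_arborescence T D \<and> real (num_leaves T) \<ge> 1 / (7 / 5) * real (max_leaves D)"
proof -
  obtain F1 I where F1: "greedy_expand D 4 (no_arcs D) F1"
    and I: "square_imp_result (candidates D F1) (candidate_set D F1) I"
    and T: "greedy_expand D 1 (add_selected D F1 I) T"
    using assms(2) unfolding max_leaves_12mis_def by blast
  interpret phase2 D F1 I T using assms(1) F1 I T by unfold_locales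
  have "5 * real (max_leaves D) \<le> 7 * real (num_leaves T)" using approximation by linarith
  then show ?thesis using T_arborescence by simp
qed

lemma square_imp_step_bound:
  "\<exists>p :: nat poly. \<forall>(D :: 'a pair_pre_digraph) F1 k A.
    rooted_dag D \<longrightarrow> greedy_expand D 4 (no_arcs D) F1 \<longrightarrow>
    (square_imp_step (candidates D F1) (candidate_set D F1) ^^ k) {} A \<longrightarrow>
    k \<le> poly p (card (pverts D))"
proof (intro exI[of _ "[:0, 3:]"] allI impI)
  fix D :: "'a pair_pre_digraph" and F1 k A
  assume "rooted_dag D" and F1: "greedy_expand D 4 (no_arcs D) F1"
    and k: "(square_imp_step (candidates D F1) (candidate_set D F1) ^^ k) {} A"
  then interpret phase1 D F1 by unfold_locales
  show "k \<le> poly [:0, 3:] (card (pverts D))" using steps_bound[OF k] by simp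
qed

section \<open>Polynomial-time functions on encoded data\<close>

text \<open>Injectivity is what allows the tree comparison \<open>EqE\<close> to decide equality of
  encoded values.\<close>

class enc =
  fixes enc :: "'a \<Rightarrow> tree"
  assumes enc_inject [simp]: "enc x = enc y \<longleftrightarrow> x = y"

instantiation nat :: enc
begin
definition enc_nat :: "nat \<Rightarrow> tree" where "enc_nat = encode_nat"
instance
proof
  fix x y :: nat
  show "enc x = enc y \<longleftrightarrow> x = y" unfolding enc_nat_def
  proof (induction x arbitrary: y)
    case 0 then show ?case by (cases y) auto
  next
    case (Suc x) then show ?case by (cases y) auto
  qed
qed
end

instantiation unit :: enc
begin
definition enc_unit :: "unit \<Rightarrow> tree" where "enc_unit x = Tip"
instance by standard (auto simp: enc_unit_def)
end

instantiation bool :: enc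
begin
definition enc_bool :: "bool \<Rightarrow> tree" where "enc_bool b = (if b then Fork Tip Tip else Tip)"
instance by standard (auto simp: enc_bool_def)
end

instantiation prod :: (enc, enc) enc
begin
definition enc_prod :: "'a \<times> 'b \<Rightarrow> tree" where "enc_prod z = Fork (enc (fst z)) (enc (snd z))"
instance by standard (auto simp: enc_prod_def prod_eq_iff)
end

primrec enc_list' :: "'a::enc list \<Rightarrow> tree" where
  "enc_list' [] = Tip"
| "enc_list' (x # xs) = Fork (enc x) (enc_list' xs)"

instantiation list :: (enc) enc
begin
definition enc_list :: "'a list \<Rightarrow> tree" where "enc_list = enc_list'"
instance
proof
  fix x y :: "'a list"
  show "enc x = enc y \<longleftrightarrow> x = y" unfolding enc_list_def
  proof (induction x arbitrary: y)
    case Nil then show ?case by (cases y) auto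
  next
    case (Cons a x) then show ?case by (cases y) auto
  qed
qed
end

lemma enc_simps [simp]:
  "enc (0 :: nat) = Tip" "enc (Suc n) = Fork Tip (enc n)" "enc () = Tip"
  "enc True = Fork Tip Tip" "enc False = Tip" "enc (a, b) = Fork (enc a) (enc b)"
  "enc ([] :: 'c::enc list) = Tip" "enc (x # xs) = Fork (enc x) (enc xs)"
  by (simp_all add: enc_nat_def enc_unit_def enc_bool_def enc_prod_def enc_list_def)

text \<open>The class encoding agrees with the encodings used in the statement of the problem, so no
  conversion of input or output is needed.\<close>

lemma enc_encode_nat: "enc n = encode_nat n"
  by (simp add: enc_nat_def)

lemma enc_encode_arcs: "enc as = encode_arcs as"
  by (induction as rule: encode_arcs.induct) (simp_all add: enc_encode_nat)

abbreviation esize :: "'a::enc \<Rightarrow> nat" where "esize x \<equiv> size (enc x)"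

lemma esize_mem: "a \<in> set xs \<Longrightarrow> esize a < esize xs"
  by (induction xs) auto

lemma length_le_esize: "length xs \<le> esize xs"
  by (induction xs) auto

lemma esize_append: "esize (xs @ ys) = esize xs + esize ys"
  by (induction xs) auto

lemma esize_nat [simp]: "esize (n :: nat) = n"
  by (induction n) auto

text \<open>Time bounds are polynomials over the naturals for this reason: larger intermediate
  results may be substituted without side conditions.\<close>

lemma poly_nat_mono: "x \<le> y \<Longrightarrow> poly (p :: nat poly) x \<le> poly p y"
  by (induction p) (auto intro: add_mono mult_mono)

text \<open>A total-correctness triple with a time budget n.\<close>

definition runs :: "com \<Rightarrow> store \<Rightarrow> nat \<Rightarrow> (store \<Rightarrow> bool) \<Rightarrow> bool" where
  "runs c s n P \<longleftrightarrow> (\<exists>t s'. exec c s t s' \<and> t \<le> n \<and> P s')"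

lemma runs_Assign: "cost_expr e s \<le> n \<Longrightarrow> P (s(x := eval_expr e s)) \<Longrightarrow> runs (Assign x e) s n P"
  unfolding runs_def using exec.Assign by blast

lemma runs_Seq:
  assumes "runs c s m R" "\<And>s'. R s' \<Longrightarrow> runs d s' n P" "m + n \<le> N"
  shows "runs (Seq c d) s N P"
  using assms unfolding runs_def by (meson add_mono exec.Seq order_trans)

lemma runs_Cond:
  assumes "eval_expr e s \<noteq> Tip \<Longrightarrow> runs c s n P" "eval_expr e s = Tip \<Longrightarrow> runs d s n P" "cost_expr e s + n \<le> N"
  shows "runs (Cond e c d) s N P"
  using assms unfolding runs_def
  by (cases "eval_expr e s = Tip") (meson add_left_mono exec.CondTrue exec.CondFalse order_trans)+

lemma runs_mono: "runs c s n P \<Longrightarrow> n \<le> m \<Longrightarrow> (\<And>s'. P s' \<Longrightarrow> Q s') \<Longrightarrow> runs c s m Q"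
  unfolding runs_def by (meson order_trans)

lemma size_eval_le_cost: "size (eval_expr e s) \<le> cost_expr e s"
proof (induction e)
  case (Hd e) then show ?case by (cases "eval_expr e s") auto
next
  case (Tl e) then show ?case by (cases "eval_expr e s") auto
qed auto

text \<open>An assignment pays at least the size of the value it stores. Hence fast programs have
  small outputs, which makes composition of time bounds possible.\<close>

lemma exec_size: "exec c s t s' \<Longrightarrow> size (s' x) \<le> size (s x) + t"
proof (induction rule: exec.induct)
  case (Assign y e s) then show ?case using size_eval_le_cost[of e s] by auto
qed auto

text \<open>
  For every base register there is a program that overwrites the argument in that register by the
  value of the function. It leaves the registers below untouched and assumes nothing about the
  registers above, so programs can be nested.
\<close>

definition pt :: "('a::enc \<Rightarrow> 'b::enc) \<Rightarrow> bool" where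
  "pt f \<longleftrightarrow> (\<exists>p :: nat poly. \<forall>k. \<exists>c. \<forall>s x. s k = enc x \<longrightarrow>
     runs c s (poly p (esize x)) (\<lambda>s'. s' k = enc (f x) \<and> (\<forall>j<k. s' j = s j)))"

text \<open>The choice form of \<open>pt\<close>: \<open>C k\<close> is the program for base
  register k. The same polynomial also bounds the size of the output.\<close>

definition computes :: "(nat \<Rightarrow> com) \<Rightarrow> ('a::enc \<Rightarrow> 'b::enc) \<Rightarrow> nat poly \<Rightarrow> bool" where
  "computes C f p \<longleftrightarrow> (\<forall>k s x. s k = enc x \<longrightarrow>
     runs (C k) s (poly p (esize x)) (\<lambda>s'. s' k = enc (f x) \<and> (\<forall>j<k. s' j = s j)))
     \<and> (\<forall>x. esize (f x) \<le> poly p (esize x))"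

lemma computes_run:
  "computes C f p \<Longrightarrow> s k = enc x \<Longrightarrow>
    runs (C k) s (poly p (esize x)) (\<lambda>s'. s' k = enc (f x) \<and> (\<forall>j<k. s' j = s j))"
  unfolding computes_def by blast

lemma computes_size: "computes C f p \<Longrightarrow> esize (f x) \<le> poly p (esize x)"
  unfolding computes_def by blast

lemma pt_computes:
  fixes f :: "'a::enc \<Rightarrow> 'b::enc"
  assumes "pt f"
  shows "\<exists>C p. computes C f p"
proof -
  obtain p where p: "\<forall>k. \<exists>c. \<forall>s x. s k = enc x \<longrightarrow>
      runs c s (poly p (esize x)) (\<lambda>s'. s' k = enc (f x) \<and> (\<forall>j<k. s' j = s j))"
    using assms unfolding pt_def by (elim exE)
  from choice[OF this] obtain C where C: "\<And>k s x. s k = enc x \<Longrightarrow>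
      runs (C k) s (poly p (esize x)) (\<lambda>s'. s' k = enc (f x) \<and> (\<forall>j<k. s' j = s j))" by blast
  let ?q = "p + [:0, 1:]"
  have 1: "runs (C k) s (poly ?q (esize x)) (\<lambda>s'. s' k = enc (f x) \<and> (\<forall>j<k. s' j = s j))"
    if "s k = enc x" for k s and x :: 'a
    using C[of s k x, OF that] by (rule runs_mono) auto
  have 2: "esize (f x) \<le> poly ?q (esize x)" for x
  proof -
    \<comment> \<open>One run suffices to bound the output: start with the argument in all
      registers, so that register 0 initially has the size of x.\<close>
    have "runs (C 0) (\<lambda>_. enc x) (poly p (esize x)) (\<lambda>s'. s' 0 = enc (f x) \<and> (\<forall>j<0. s' j = enc x))"
      by (rule C) simp
    then obtain t s' where e: "exec (C 0) (\<lambda>_. enc x) t s'" "t \<le> poly p (esize x)" "s' 0 = enc (f x)"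
      unfolding runs_def by blast
    have "esize (f x) \<le> esize x + poly p (esize x)" using exec_size[OF e(1), of 0] e(2,3) by simp
    then show ?thesis by simp
  qed
  show ?thesis unfolding computes_def using 1 2 by blast
qed

lemma ptI:
  assumes "\<And>k s x. s k = enc x \<Longrightarrow> runs (C k) s (poly p (esize x)) (\<lambda>s'. s' k = enc (f x) \<and> (\<forall>j<k. s' j = s j))"
  shows "pt f"
  unfolding pt_def using assms by blast

text \<open>Only encodings matter, so a function into another type with the same trees is obtained
  for free. This covers lists as pairs, numbers as lists of units, and equivalent forms of a
  condition.\<close>

lemma pt_coerce: "pt f \<Longrightarrow> (\<And>x. enc (g x) = enc (f x)) \<Longrightarrow> pt g"
  unfolding pt_def by simp

lemma pt_expr:
  fixes f :: "'a::enc \<Rightarrow> 'b::enc"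
  assumes "\<And>k s x. s k = enc x \<Longrightarrow> eval_expr (e k) s = enc (f x)"
    "\<And>k s (x :: 'a). s k = enc x \<Longrightarrow> cost_expr (e k) s \<le> poly p (esize x)"
  shows "pt f"
  by (rule ptI[of "\<lambda>k. Assign k (e k)" p]) (auto intro!: runs_Assign simp: assms)

lemma pt_id: "pt (\<lambda>x. x)"
  by (rule pt_expr[of "\<lambda>k. Var k" _ "[:1, 1:]"]) auto

primrec const_expr :: "tree \<Rightarrow> expr" where
  "const_expr Tip = TipE"
| "const_expr (Fork l r) = ForkE (const_expr l) (const_expr r)"

lemma eval_const_expr [simp]: "eval_expr (const_expr t) s = t"
  by (induction t) auto

lemma cost_const_expr [simp]: "cost_expr (const_expr t) s = 2 * size t + 1"
  by (induction t) auto

lemma pt_const: "pt (\<lambda>x. c)"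
  by (rule pt_expr[of "\<lambda>k. const_expr (enc c)" _ "[:2 * esize c + 1:]"]) auto

text \<open>Both programs work in the same register. The second runs on an argument of size at most
  p, hence the composed polynomial.\<close>

lemma pt_comp:
  fixes g :: "'b::enc \<Rightarrow> 'c::enc" and f :: "'a::enc \<Rightarrow> 'b"
  assumes "pt g" "pt f"
  shows "pt (\<lambda>x. g (f x))"
proof -
  obtain p C where f: "computes C f p" using pt_computes[OF assms(2)] by blast
  obtain q D where g: "computes D g q" using pt_computes[OF assms(1)] by blast
  show ?thesis
  proof (rule ptI[of "\<lambda>k. Seq (C k) (D k)" "p + pcompose q p"])
    fix k :: nat and s :: store and x :: 'a assume s: "s k = enc x"
    show "runs (Seq (C k) (D k)) s (poly (p + pcompose q p) (esize x))
      (\<lambda>s'. s' k = enc (g (f x)) \<and> (\<forall>j<k. s' j = s j))"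
      by (rule runs_Seq[OF computes_run[OF f, of s k x, OF s]], rule runs_mono[OF computes_run[OF g, of _ _ "f x"]])
        (auto simp: poly_pcompose intro: poly_nat_mono computes_size[OF f])
  qed
qed

section \<open>Basic operations and control structures\<close>

lemma pt_fst0: "pt fst"
  by (rule pt_expr[of "\<lambda>k. Hd (Var k)" _ "[:2, 1:]"]) (auto simp: enc_prod_def)
lemma pt_snd0: "pt snd"
  by (rule pt_expr[of "\<lambda>k. Tl (Var k)" _ "[:2, 1:]"]) (auto simp: enc_prod_def)
lemma pt_tl0: "pt tl"
proof (rule pt_expr[of "\<lambda>k. Tl (Var k)" _ "[:2, 1:]"])
  fix k :: nat and s :: store and x :: "'a list" assume "s k = enc x"
  then show "eval_expr (Tl (Var k)) s = enc (tl x)" by (cases x) auto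
qed auto
lemma pt_pred0: "pt (\<lambda>n::nat. n - 1)"
proof (rule pt_expr[of "\<lambda>k. Tl (Var k)" _ "[:2, 1:]"])
  fix k :: nat and s :: store and x :: nat assume "s k = enc x"
  then show "eval_expr (Tl (Var k)) s = enc (x - 1)" by (cases x) auto
qed auto
lemma pt_Suc0: "pt Suc"
  by (rule pt_expr[of "\<lambda>k. ForkE TipE (Var k)" _ "[:3, 1:]"]) auto
lemma pt_eq0: "pt (\<lambda>z. fst z = snd z)"
  by (rule pt_expr[of "\<lambda>k. EqE (Hd (Var k)) (Tl (Var k))" _ "[:5, 2:]"])
    (auto simp: enc_prod_def enc_bool_def)

lemmas pt_fst = pt_comp[OF pt_fst0] and pt_snd = pt_comp[OF pt_snd0] and pt_tl = pt_comp[OF pt_tl0]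
  and pt_pred = pt_comp[OF pt_pred0] and pt_Suc = pt_comp[OF pt_Suc0]

text \<open>The argument is kept in register k while the results are computed in k+1 and k+2. The
  program for k+2 leaves the first result in k+1 intact.\<close>

lemma pt_Pair:
  fixes f :: "'a::enc \<Rightarrow> 'b::enc" and g :: "'a \<Rightarrow> 'c::enc"
  assumes "pt f" "pt g"
  shows "pt (\<lambda>x. (f x, g x))"
proof -
  obtain p C where f: "computes C f p" using pt_computes[OF assms(1)] by blast
  obtain q D where g: "computes D g q" using pt_computes[OF assms(2)] by blast
  let ?P = "\<lambda>k. Seq (Assign (k+1) (Var k)) (Seq (C (k+1)) (Seq (Assign (k+2) (Var k)) (Seq (D (k+2))
      (Assign k (ForkE (Var (k+1)) (Var (k+2)))))))"
  show ?thesis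
  proof (rule ptI[of ?P "2 * p + 2 * q + [:5, 2:]"])
    fix k :: nat and s :: store and x :: 'a assume s: "s k = enc x"
    let ?n = "esize x"
    show "runs (?P k) s (poly (2 * p + 2 * q + [:5, 2:]) ?n) (\<lambda>s'. s' k = enc (f x, g x) \<and> (\<forall>j<k. s' j = s j))"
      (is "runs _ _ ?N ?Q")
    proof (rule runs_Seq)
      show "runs (Assign (k+1) (Var k)) s (1 + ?n) (\<lambda>s'. s' = s(k+1 := enc x))"
        by (rule runs_Assign) (auto simp: s)
      show "1 + ?n + (2 * poly p ?n + 2 * poly q ?n + 4 + ?n) \<le> ?N" by simp
      fix s1 assume "s1 = s(k+1 := enc x)"
      then have s1: "s1 (k+1) = enc x" "s1 k = enc x" "\<forall>j<k. s1 j = s j" using s by auto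
      show "runs (Seq (C (k+1)) (Seq (Assign (k+2) (Var k)) (Seq (D (k+2))
          (Assign k (ForkE (Var (k+1)) (Var (k+2))))))) s1 (2 * poly p ?n + 2 * poly q ?n + 4 + ?n) ?Q"
      proof (rule runs_Seq[OF computes_run[OF f, of s1 "k+1" x, OF s1(1)]])
        show "poly p ?n + (poly p ?n + 2 * poly q ?n + 4 + ?n) \<le> 2 * poly p ?n + 2 * poly q ?n + 4 + ?n" by simp
        fix s2 assume "s2 (k+1) = enc (f x) \<and> (\<forall>j<k+1. s2 j = s1 j)"
        then have s2: "s2 (k+1) = enc (f x)" "s2 k = enc x" "\<forall>j<k. s2 j = s j" using s1 by auto
        show "runs (Seq (Assign (k+2) (Var k)) (Seq (D (k+2))
          (Assign k (ForkE (Var (k+1)) (Var (k+2)))))) s2 (poly p ?n + 2 * poly q ?n + 4 + ?n) ?Q"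
        proof (rule runs_Seq)
          show "runs (Assign (k+2) (Var k)) s2 (1 + ?n) (\<lambda>s'. s' = s2(k+2 := enc x))"
            by (rule runs_Assign) (auto simp: s2)
          show "1 + ?n + (poly p ?n + 2 * poly q ?n + 3) \<le> poly p ?n + 2 * poly q ?n + 4 + ?n" by simp
          fix s3 assume "s3 = s2(k+2 := enc x)"
          then have s3: "s3 (k+2) = enc x" "s3 (k+1) = enc (f x)" "\<forall>j<k. s3 j = s j" using s2 by auto
          show "runs (Seq (D (k+2)) (Assign k (ForkE (Var (k+1)) (Var (k+2))))) s3 (poly p ?n + 2 * poly q ?n + 3) ?Q"
          proof (rule runs_Seq[OF computes_run[OF g, of s3 "k+2" x, OF s3(1)]])
            show "poly q ?n + (poly p ?n + poly q ?n + 3) \<le> poly p ?n + 2 * poly q ?n + 3" by simp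
            fix s4 assume "s4 (k+2) = enc (g x) \<and> (\<forall>j<k+2. s4 j = s3 j)"
            then have s4: "s4 (k+2) = enc (g x)" "s4 (k+1) = enc (f x)" "\<forall>j<k. s4 j = s j" using s3 by auto
            show "runs (Assign k (ForkE (Var (k+1)) (Var (k+2)))) s4 (poly p ?n + poly q ?n + 3) ?Q"
              by (rule runs_Assign) (use s4 computes_size[OF f, of x] computes_size[OF g, of x] in auto)
          qed
        qed
      qed
    qed
  qed
qed

lemma pt_If:
  fixes f :: "'a::enc \<Rightarrow> 'b::enc"
  assumes "pt b" "pt f" "pt g"
  shows "pt (\<lambda>x. if b x then f x else g x)"
proof -
  obtain p C where f: "computes C f p" using pt_computes[OF assms(2)] by blast
  obtain q D where g: "computes D g q" using pt_computes[OF assms(3)] by blast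
  obtain r B where b: "computes B b r" using pt_computes[OF assms(1)] by blast
  let ?P = "\<lambda>k. Seq (Assign (k+1) (Var k)) (Seq (B (k+1)) (Cond (Var (k+1)) (C k) (D k)))"
  show ?thesis
  proof (rule ptI[of ?P "r + p + q + [:3, 1:]"])
    fix k :: nat and s :: store and x :: 'a assume s: "s k = enc x"
    let ?n = "esize x"
    show "runs (?P k) s (poly (r + p + q + [:3, 1:]) ?n) (\<lambda>s'. s' k = enc (if b x then f x else g x) \<and> (\<forall>j<k. s' j = s j))"
      (is "runs _ _ ?N ?Q")
    proof (rule runs_Seq)
      show "runs (Assign (k+1) (Var k)) s (1 + ?n) (\<lambda>s'. s' = s(k+1 := enc x))"
        by (rule runs_Assign) (auto simp: s)
      show "1 + ?n + (poly r ?n + (2 + (poly p ?n + poly q ?n))) \<le> ?N" by simp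
      fix s1 assume "s1 = s(k+1 := enc x)"
      then have s1: "s1 (k+1) = enc x" "s1 k = enc x" "\<forall>j<k. s1 j = s j" using s by auto
      show "runs (Seq (B (k+1)) (Cond (Var (k+1)) (C k) (D k))) s1 (poly r ?n + (2 + (poly p ?n + poly q ?n))) ?Q"
      proof (rule runs_Seq[OF computes_run[OF b, of s1 "k+1" x, OF s1(1)]])
        fix s2 assume "s2 (k+1) = enc (b x) \<and> (\<forall>j<k+1. s2 j = s1 j)"
        then have s2: "s2 (k+1) = enc (b x)" "s2 k = enc x" "\<forall>j<k. s2 j = s j" using s1 by auto
        show "runs (Cond (Var (k+1)) (C k) (D k)) s2 (2 + (poly p ?n + poly q ?n)) ?Q"
        proof (rule runs_Cond[where n = "poly p ?n + poly q ?n"])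
          assume "eval_expr (Var (k+1)) s2 \<noteq> Tip"
          then have "b x" using s2 by (cases "b x") auto
          then show "runs (C k) s2 (poly p ?n + poly q ?n) ?Q"
            by (intro runs_mono[OF computes_run[OF f, of s2 k x, OF s2(2)]]) (use s2 in auto)
        next
          assume "eval_expr (Var (k+1)) s2 = Tip"
          then have "\<not> b x" using s2 by (cases "b x") auto
          then show "runs (D k) s2 (poly p ?n + poly q ?n) ?Q"
            by (intro runs_mono[OF computes_run[OF g, of s2 k x, OF s2(2)]]) (use s2 in auto)
        qed (use s2 in \<open>auto simp: enc_bool_def\<close>)
      qed simp
    qed
  qed
qed

text \<open>The empty list is the only one encoded by \<open>Tip\<close>, so the conditional tests
  for it directly.\<close>

lemma pt_case_list:
  fixes l :: "'a::enc \<Rightarrow> 'b::enc list" and a :: "'a \<Rightarrow> 'c::enc"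
  assumes "pt l" "pt a" "pt (\<lambda>z. b (fst z) (fst (snd z)) (snd (snd z)))"
  shows "pt (\<lambda>x. case l x of [] \<Rightarrow> a x | y # ys \<Rightarrow> b x y ys)"
proof -
  obtain p C where l: "computes C l p" using pt_computes[OF assms(1)] by blast
  obtain q D where a: "computes D a q" using pt_computes[OF assms(2)] by blast
  \<comment> \<open>A nonempty list \<open>y # ys\<close> and the pair \<open>(y, ys)\<close> have
    the same encoding, so the program of b can be run on \<open>(x, y # ys)\<close>.\<close>
  obtain r B where b: "\<And>k s x y ys. s k = enc (x, y # ys) \<Longrightarrow>
      runs (B k) s (poly r (esize (x, y # ys))) (\<lambda>s'. s' k = enc (b x y ys) \<and> (\<forall>j<k. s' j = s j))"
  proof -
    obtain r B where *: "computes B (\<lambda>z. b (fst z) (fst (snd z)) (snd (snd z))) r"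
      using pt_computes[OF assms(3)] by blast
    show ?thesis
    proof (rule that[of B r])
      fix k :: nat and s :: store and x :: 'a and y :: 'b and ys assume "s k = enc (x, y # ys)"
      then show "runs (B k) s (poly r (esize (x, y # ys))) (\<lambda>s'. s' k = enc (b x y ys) \<and> (\<forall>j<k. s' j = s j))"
        using computes_run[OF *, of s k "(x, y, ys)"] by simp
    qed
  qed
  let ?P = "\<lambda>k. Seq (Assign (k+1) (Var k)) (Seq (C (k+1))
      (Cond (Var (k+1)) (Seq (Assign k (ForkE (Var k) (Var (k+1)))) (B k)) (D k)))"
  let ?p = "p + p + [:6, 2:] + p + q + pcompose r (p + [:1, 1:])"
  show ?thesis
  proof (rule ptI[of ?P ?p])
    fix k :: nat and s :: store and x :: 'a assume s: "s k = enc x"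
    let ?n = "esize x"
    let ?R = "poly r (poly (p + [:1, 1:]) ?n)"
    show "runs (?P k) s (poly ?p ?n) (\<lambda>s'. s' k = enc (case l x of [] \<Rightarrow> a x | y # ys \<Rightarrow> b x y ys) \<and> (\<forall>j<k. s' j = s j))"
      (is "runs _ _ ?N ?Q")
    proof (rule runs_Seq)
      show "runs (Assign (k+1) (Var k)) s (1 + ?n) (\<lambda>s'. s' = s(k+1 := enc x))"
        by (rule runs_Assign) (auto simp: s)
      show "1 + ?n + (poly p ?n + (1 + poly p ?n + (3 + ?n + poly p ?n + poly q ?n + ?R))) \<le> ?N"
        by (simp add: poly_pcompose)
      fix s1 assume "s1 = s(k+1 := enc x)"
      then have s1: "s1 (k+1) = enc x" "s1 k = enc x" "\<forall>j<k. s1 j = s j" using s by auto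
      show "runs (Seq (C (k+1)) (Cond (Var (k+1)) (Seq (Assign k (ForkE (Var k) (Var (k+1)))) (B k)) (D k))) s1
        (poly p ?n + (1 + poly p ?n + (3 + ?n + poly p ?n + poly q ?n + ?R))) ?Q"
      proof (rule runs_Seq[OF computes_run[OF l, of s1 "k+1" x, OF s1(1)]])
        fix s2 assume "s2 (k+1) = enc (l x) \<and> (\<forall>j<k+1. s2 j = s1 j)"
        then have s2: "s2 (k+1) = enc (l x)" "s2 k = enc x" "\<forall>j<k. s2 j = s j" using s1 by auto
        show "runs (Cond (Var (k+1)) (Seq (Assign k (ForkE (Var k) (Var (k+1)))) (B k)) (D k)) s2
          (1 + poly p ?n + (3 + ?n + poly p ?n + poly q ?n + ?R)) ?Q"
        proof (rule runs_Cond[where n = "3 + ?n + poly p ?n + poly q ?n + ?R"])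
          assume "eval_expr (Var (k+1)) s2 \<noteq> Tip"
          then obtain y ys where y: "l x = y # ys" using s2 by (cases "l x") auto
          show "runs (Seq (Assign k (ForkE (Var k) (Var (k+1)))) (B k)) s2 (3 + ?n + poly p ?n + poly q ?n + ?R) ?Q"
          proof (rule runs_Seq)
            show "runs (Assign k (ForkE (Var k) (Var (k+1)))) s2 (3 + ?n + poly p ?n) (\<lambda>s'. s' = s2(k := enc (x, y # ys)))"
              by (rule runs_Assign) (use s2 y computes_size[OF l, of x] in auto)
            fix s3 assume s3: "s3 = s2(k := enc (x, y # ys))"
            have "esize (x, y # ys) \<le> poly (p + [:1, 1:]) ?n" using computes_size[OF l, of x] y by simp
            then have "poly r (esize (x, y # ys)) \<le> ?R" by (rule poly_nat_mono)
            then show "runs (B k) s3 (poly q ?n + ?R) ?Q"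
              by (intro runs_mono[OF b[of s3 k x y ys]]) (use s3 s2 y in auto)
          qed simp
        next
          assume "eval_expr (Var (k+1)) s2 = Tip"
          then have "l x = []" using s2 by (cases "l x") auto
          then show "runs (D k) s2 (3 + ?n + poly p ?n + poly q ?n + ?R) ?Q"
            by (intro runs_mono[OF computes_run[OF a, of s2 k x, OF s2(2)]]) (use s2 in auto)
        qed (use s2 computes_size[OF l, of x] in simp)
      qed simp
    qed
  qed
qed

text \<open>Each test pays one plus the size of the remaining list, which is at most
  \<open>1 + esize L\<close>. The final \<open>+ 1\<close> pays for the test that finds
  \<open>Tip\<close>.\<close>

lemma runs_While_list:
  assumes body: "\<And>s ys y zs. L = ys @ y # zs \<Longrightarrow> I ys s \<Longrightarrow> s k = enc (y # zs) \<Longrightarrow>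
      runs c s m (\<lambda>s'. I (ys @ [y]) s' \<and> s' k = enc zs)"
    and "L = ys @ zs" "I ys s" "s k = enc zs"
  shows "runs (While (Var k) c) s (length zs * (1 + esize L + m) + 1) (\<lambda>s'. I L s')"
  using assms(2-4)
proof (induction zs arbitrary: ys s)
  case Nil
  then have "exec (While (Var k) c) s (cost_expr (Var k) s) s" by (intro exec.WhileFalse) simp
  then show ?case using Nil unfolding runs_def by force
next
  case (Cons y zs)
  obtain t s' where 1: "exec c s t s'" "t \<le> m" "I (ys @ [y]) s'" "s' k = enc zs"
    using body[OF Cons.prems] unfolding runs_def by blast
  obtain t' s'' where 2: "exec (While (Var k) c) s' t' s''" "t' \<le> length zs * (1 + esize L + m) + 1" "I L s''"
    using Cons.IH[of "ys @ [y]" s'] 1 Cons.prems unfolding runs_def by auto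
  have "exec (While (Var k) c) s (cost_expr (Var k) s + t + t') s''"
    using 1 2 Cons.prems by (intro exec.WhileTrue[of _ _ _ _ s']) auto
  moreover have "cost_expr (Var k) s + t + t' \<le> length (y # zs) * (1 + esize L + m) + 1"
    using 1 2 Cons.prems by (simp add: esize_append)
  ultimately show ?case using 2 unfolding runs_def by blast
qed

lemma pt_fold:
  fixes l :: "'a::enc \<Rightarrow> 'b::enc list" and a :: "'a \<Rightarrow> 'c::enc"
  assumes "pt l" "pt a" "pt (\<lambda>z. f (fst z) (fst (snd z)) (snd (snd z)))"
    and bound: "\<And>x ys zs. l x = ys @ zs \<Longrightarrow> esize (fold (f x) ys (a x)) \<le> poly Q (esize x)"
  shows "pt (\<lambda>x. fold (f x) (l x) (a x))"
proof -
  obtain p C where l: "computes C l p" using pt_computes[OF assms(1)] by blast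
  obtain q D where a: "computes D a q" using pt_computes[OF assms(2)] by blast
  obtain r B where b: "\<And>k s x y w. s k = enc (x, y, w) \<Longrightarrow>
      runs (B k) s (poly r (esize (x, y, w))) (\<lambda>s'. s' k = enc (f x y w) \<and> (\<forall>j<k. s' j = s j))"
  proof -
    obtain r B where *: "computes B (\<lambda>z. f (fst z) (fst (snd z)) (snd (snd z))) r"
      using pt_computes[OF assms(3)] by blast
    show ?thesis
    proof (rule that[of B r])
      fix k :: nat and s :: store and x :: 'a and y :: 'b and w :: 'c assume "s k = enc (x, y, w)"
      then show "runs (B k) s (poly r (esize (x, y, w))) (\<lambda>s'. s' k = enc (f x y w) \<and> (\<forall>j<k. s' j = s j))"
        using computes_run[OF *, of s k "(x, y, w)"] by simp
    qed
  qed
  let ?body = "\<lambda>k. Seq (Assign (k+3) (ForkE (Var k) (ForkE (Hd (Var (k+1))) (Var (k+2)))))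
      (Seq (B (k+3)) (Seq (Assign (k+2) (Var (k+3))) (Assign (k+1) (Tl (Var (k+1))))))"
  let ?P = "\<lambda>k. Seq (Assign (k+1) (Var k)) (Seq (C (k+1)) (Seq (Assign (k+2) (Var k)) (Seq (D (k+2))
      (Seq (While (Var (k+1)) (?body k)) (Assign k (Var (k+2)))))))"
  let ?m = "[:9, 1:] + p + p + Q + Q + pcompose r ([:2, 1:] + p + Q)"
  let ?p = "[:10, 2:] + p + q + Q + p * (1 + p + ?m)"
  show ?thesis
  proof (rule ptI[of ?P ?p])
    fix k :: nat and s :: store and x :: 'a assume s: "s k = enc x"
    let ?n = "esize x"
    let ?M = "poly ?m ?n"
    let ?W = "poly p ?n * (1 + poly p ?n + ?M) + 1"
    define I where "I ys s' \<longleftrightarrow> s' (k+2) = enc (fold (f x) ys (a x)) \<and> s' k = enc x \<and> (\<forall>j<k. s' j = s j)" for ys s'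
    show "runs (?P k) s (poly ?p ?n) (\<lambda>s'. s' k = enc (fold (f x) (l x) (a x)) \<and> (\<forall>j<k. s' j = s j))"
      (is "runs _ _ ?N ?Q")
    proof (rule runs_Seq)
      show "runs (Assign (k+1) (Var k)) s (1 + ?n) (\<lambda>s'. s' = s(k+1 := enc x))"
        by (rule runs_Assign) (auto simp: s)
      show "1 + ?n + (poly p ?n + (1 + ?n + (poly q ?n + (?W + (1 + poly Q ?n))))) \<le> ?N"
        by simp
      fix s1 assume "s1 = s(k+1 := enc x)"
      then have s1: "s1 (k+1) = enc x" "s1 k = enc x" "\<forall>j<k. s1 j = s j" using s by auto
      show "runs (Seq (C (k+1)) (Seq (Assign (k+2) (Var k)) (Seq (D (k+2))
        (Seq (While (Var (k+1)) (?body k)) (Assign k (Var (k+2))))))) s1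
        (poly p ?n + (1 + ?n + (poly q ?n + (?W + (1 + poly Q ?n))))) ?Q"
      proof (rule runs_Seq[OF computes_run[OF l, of s1 "k+1" x, OF s1(1)]])
        fix s2 assume "s2 (k+1) = enc (l x) \<and> (\<forall>j<k+1. s2 j = s1 j)"
        then have s2: "s2 (k+1) = enc (l x)" "s2 k = enc x" "\<forall>j<k. s2 j = s j" using s1 by auto
        show "runs (Seq (Assign (k+2) (Var k)) (Seq (D (k+2))
          (Seq (While (Var (k+1)) (?body k)) (Assign k (Var (k+2)))))) s2
          (1 + ?n + (poly q ?n + (?W + (1 + poly Q ?n)))) ?Q"
        proof (rule runs_Seq)
          show "runs (Assign (k+2) (Var k)) s2 (1 + ?n) (\<lambda>s'. s' = s2(k+2 := enc x))"
            by (rule runs_Assign) (auto simp: s2)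
          fix s3 assume "s3 = s2(k+2 := enc x)"
          then have s3: "s3 (k+2) = enc x" "s3 (k+1) = enc (l x)" "s3 k = enc x" "\<forall>j<k. s3 j = s j" using s2 by auto
          show "runs (Seq (D (k+2)) (Seq (While (Var (k+1)) (?body k)) (Assign k (Var (k+2))))) s3
            (poly q ?n + (?W + (1 + poly Q ?n))) ?Q"
          proof (rule runs_Seq[OF computes_run[OF a, of s3 "k+2" x, OF s3(1)]])
            fix s4 assume "s4 (k+2) = enc (a x) \<and> (\<forall>j<k+2. s4 j = s3 j)"
            then have s4: "I [] s4" "s4 (k+1) = enc (l x)" using s3 unfolding I_def by auto
            have body: "runs (?body k) s ?M (\<lambda>s'. I (ys @ [y]) s' \<and> s' (k+1) = enc zs)"
              if L: "l x = ys @ y # zs" and "I ys s" and sk: "s (k+1) = enc (y # zs)" for s ys y zs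
            proof -
              let ?w = "fold (f x) ys (a x)"
              have I: "s (k+2) = enc ?w" "s k = enc x" using \<open>I ys s\<close> unfolding I_def by auto
              have sz: "esize ?w \<le> poly Q ?n" "esize (f x y ?w) \<le> poly Q ?n"
                using bound[of x ys "y # zs"] bound[of x "ys @ [y]" zs] L by auto
              have ly: "esize (y # zs) \<le> poly p ?n" using computes_size[OF l, of x] unfolding L esize_append by simp
              let ?R = "poly r (poly ([:2, 1:] + p + Q) ?n)"
              show ?thesis
              proof (rule runs_Seq)
                show "runs (Assign (k+3) (ForkE (Var k) (ForkE (Hd (Var (k+1))) (Var (k+2))))) s
                  (6 + ?n + poly p ?n + poly Q ?n) (\<lambda>s'. s' = s(k+3 := enc (x, y, ?w)))"
                  by (rule runs_Assign) (use I sk sz ly in auto)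
                show "6 + ?n + poly p ?n + poly Q ?n + (?R + (1 + poly Q ?n + (2 + poly p ?n))) \<le> ?M"
                  by (simp add: poly_pcompose)
                fix t1 assume "t1 = s(k+3 := enc (x, y, ?w))"
                then have t1: "t1 (k+3) = enc (x, y, ?w)" "t1 k = enc x" "t1 (k+1) = enc (y # zs)"
                  "\<forall>j<k. t1 j = s j" using I sk by auto
                show "runs (Seq (B (k+3)) (Seq (Assign (k+2) (Var (k+3))) (Assign (k+1) (Tl (Var (k+1)))))) t1
                  (?R + (1 + poly Q ?n + (2 + poly p ?n))) (\<lambda>s'. I (ys @ [y]) s' \<and> s' (k+1) = enc zs)"
                proof (rule runs_Seq)
                  have "esize (x, y, ?w) \<le> poly ([:2, 1:] + p + Q) ?n" using sz ly by simp
                  then have "poly r (esize (x, y, ?w)) \<le> ?R" by (rule poly_nat_mono)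
                  then show "runs (B (k+3)) t1 ?R (\<lambda>s'. s' (k+3) = enc (f x y ?w) \<and> (\<forall>j<k+3. s' j = t1 j))"
                    by (intro runs_mono[OF b[of t1 "k+3" x y ?w, OF t1(1)]]) auto
                  fix t2 assume "t2 (k+3) = enc (f x y ?w) \<and> (\<forall>j<k+3. t2 j = t1 j)"
                  then have t2: "t2 (k+3) = enc (f x y ?w)" "t2 k = enc x" "t2 (k+1) = enc (y # zs)"
                    "\<forall>j<k. t2 j = s j" using t1 by auto
                  show "runs (Seq (Assign (k+2) (Var (k+3))) (Assign (k+1) (Tl (Var (k+1))))) t2
                    (1 + poly Q ?n + (2 + poly p ?n)) (\<lambda>s'. I (ys @ [y]) s' \<and> s' (k+1) = enc zs)"
                  proof (rule runs_Seq)
                    show "runs (Assign (k+2) (Var (k+3))) t2 (1 + poly Q ?n) (\<lambda>s'. s' = t2(k+2 := enc (f x y ?w)))"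
                      by (rule runs_Assign) (use t2 sz in auto)
                    fix t3 assume t3: "t3 = t2(k+2 := enc (f x y ?w))"
                    show "runs (Assign (k+1) (Tl (Var (k+1)))) t3 (2 + poly p ?n) (\<lambda>s'. I (ys @ [y]) s' \<and> s' (k+1) = enc zs)"
                      by (rule runs_Assign) (use t3 t2 ly \<open>I ys s\<close> in \<open>auto simp: I_def\<close>)
                  qed simp
                qed simp
              qed
            qed
            show "runs (Seq (While (Var (k+1)) (?body k)) (Assign k (Var (k+2)))) s4 (?W + (1 + poly Q ?n)) ?Q"
            proof (rule runs_Seq)
              have le: "length (l x) * (1 + esize (l x) + ?M) + 1 \<le> ?W"
                using computes_size[OF l, of x] length_le_esize[of "l x"] by (intro add_mono mult_mono) auto
              have W: "runs (While (Var (k+1)) (?body k)) s4 (length (l x) * (1 + esize (l x) + ?M) + 1) (\<lambda>s'. I (l x) s')"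
              proof (rule runs_While_list[where I = I and ys = "[]" and L = "l x"])
                fix s ys y zs assume "l x = ys @ y # zs" "I ys s" "s (k+1) = enc (y # zs)"
                from body[of ys y zs s, OF this] show "runs (?body k) s ?M (\<lambda>s'. I (ys @ [y]) s' \<and> s' (k+1) = enc zs)" .
              next
                show "l x = [] @ l x" "I [] s4" "s4 (k+1) = enc (l x)" using s4 by simp_all
              qed
              show "runs (While (Var (k+1)) (?body k)) s4 ?W (\<lambda>s'. I (l x) s')"
                by (rule runs_mono[OF W le])
              fix s5 assume "I (l x) s5"
              then show "runs (Assign k (Var (k+2))) s5 (1 + poly Q ?n) ?Q"
                using bound[of x "l x" "[]"] by (intro runs_Assign) (auto simp: I_def)
            qed simp
          qed simp
        qed simp
      qed simp
    qed
  qed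
qed

lemma pt_poly_bound:
  assumes "pt f"
  obtains q :: "nat poly" where "\<And>x. esize (f x) \<le> poly q (esize x)"
  using pt_computes[OF assms] computes_size by blast

text \<open>The growth of a step may depend on the fixed argument x but not on the accumulator, so
  it adds up linearly over the list.\<close>

lemma pt_fold_add:
  fixes l :: "'a::enc \<Rightarrow> 'b::enc list" and a :: "'a \<Rightarrow> 'c::enc"
  assumes "pt l" "pt a" "pt (\<lambda>z. f (fst z) (fst (snd z)) (snd (snd z)))"
    and add: "\<And>x y w. y \<in> set (l x) \<Longrightarrow> esize (f x y w) \<le> esize w + poly Q (esize x)"
  shows "pt (\<lambda>x. fold (f x) (l x) (a x))"
proof -
  obtain p where p: "\<And>x. esize (l x) \<le> poly p (esize x)" using pt_poly_bound[OF assms(1)] by blast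
  obtain q where q: "\<And>x. esize (a x) \<le> poly q (esize x)" using pt_poly_bound[OF assms(2)] by blast
  show ?thesis
  proof (rule pt_fold[OF assms(1-3), of "q + p * Q"])
    fix x ys zs assume L: "l x = ys @ zs"
    have "set ys \<subseteq> set (l x) \<Longrightarrow> esize (fold (f x) ys w) \<le> esize w + length ys * poly Q (esize x)" for w
    proof (induction ys arbitrary: w)
      case (Cons y ys)
      then have "esize (f x y w) \<le> esize w + poly Q (esize x)"
        "esize (fold (f x) ys (f x y w)) \<le> esize (f x y w) + length ys * poly Q (esize x)"
        using add[of y x w] Cons.IH by auto
      then have "esize (fold (f x) ys (f x y w)) \<le> esize w + poly Q (esize x) + length ys * poly Q (esize x)"
        by linarith
      then show ?case by simp
    qed simp
    then have "esize (fold (f x) ys (a x)) \<le> esize (a x) + length ys * poly Q (esize x)" using L by simp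
    also have "\<dots> \<le> poly q (esize x) + poly p (esize x) * poly Q (esize x)"
      using q p[of x] L length_le_esize[of "l x"] by (intro add_mono mult_right_mono) auto
    finally show "esize (fold (f x) ys (a x)) \<le> poly (q + p * Q) (esize x)" by simp
  qed
qed

section \<open>Maximality of a matching: contraction of blossoms\<close>

text \<open>Even alternating paths, listed from the tip to the exposed root.\<close>

inductive alt :: "'a set set \<Rightarrow> 'a set set \<Rightarrow> 'a list \<Rightarrow> bool" for E M where
  root: "r \<notin> \<Union>M \<Longrightarrow> alt E M [r]"
| step: "alt E M p \<Longrightarrow> {hd p, s} \<in> E \<Longrightarrow> {s, t} \<in> M \<Longrightarrow> s \<notin> set p \<Longrightarrow> t \<notin> set p \<Longrightarrow> s \<noteq> t \<Longrightarrow>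
    alt E M (t # s # p)"

lemma alt_nonempty: "alt E M p \<Longrightarrow> p \<noteq> []"
  by (induction rule: alt.induct) auto

lemma alt_distinct: "alt E M p \<Longrightarrow> distinct p"
  by (induction rule: alt.induct) auto

lemma alt_odd: "alt E M p \<Longrightarrow> odd (length p)"
  by (induction rule: alt.induct) auto

lemma alt_step_iff:
  "alt E M (t # s # p) \<longleftrightarrow> alt E M p \<and> {hd p, s} \<in> E \<and> {s, t} \<in> M \<and> s \<notin> set p \<and> t \<notin> set p \<and> s \<noteq> t"
  by (subst alt.simps) auto

lemma alt_single_iff: "alt E M [r] \<longleftrightarrow> r \<notin> \<Union>M"
  by (subst alt.simps) auto

lemma even_list_cases:
  assumes "even (length a)"
  obtains "a = []" | t s a' where "a = t # s # a'" "even (length a')"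
  using assms by (cases a; cases "tl a") auto

lemma alt_suffix: "even (length a) \<Longrightarrow> alt E M (a @ v # b) \<Longrightarrow> alt E M (v # b)"
proof (induction "length a" arbitrary: a rule: less_induct)
  case less
  from less.prems(1) show ?case
  proof (cases rule: even_list_cases)
    case 1 then show ?thesis using less.prems by simp
  next
    case (2 t s a')
    then show ?thesis using less.hyps[of a'] less.prems(2) by (simp add: alt_step_iff)
  qed
qed

text \<open>Used to show that two branches cannot first meet at an inner vertex: its mate would then
  lie on both of them.\<close>

lemma alt_odd_position: "odd (length a) \<Longrightarrow> alt E M (a @ v # b) \<Longrightarrow> {v, last a} \<in> M"
proof (induction "length a" arbitrary: a rule: less_induct)
  case less
  show ?case
  proof (cases a rule: remdups_adj.cases)
    case 1 then show ?thesis using less.prems by simp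
  next
    case (2 t)
    then show ?thesis using less.prems by (simp add: alt_step_iff)
  next
    case (3 t s a')
    then have "odd (length a')" using less.prems by simp
    then have "a' \<noteq> []" by auto
    then show ?thesis using less.hyps[of a'] less.prems(2) 3 \<open>odd (length a')\<close> by (simp add: alt_step_iff)
  qed
qed

text \<open>This keeps a path alternating when the matching is changed only along a disjoint
  path.\<close>

lemma alt_transfer:
  assumes "alt E M p" "\<And>r. r \<in> set p \<Longrightarrow> r \<notin> \<Union>M \<Longrightarrow> r \<notin> \<Union>N" "\<And>e. e \<in> M \<Longrightarrow> e \<subseteq> set p \<Longrightarrow> e \<in> N"
  shows "alt E N p"
  using assms
proof (induction)
  case (step p s t)
  have "alt E N p"
  proof (rule step.IH)
    fix r assume "r \<in> set p" "r \<notin> \<Union>M"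
    then show "r \<notin> \<Union>N" by (intro step.prems(1)) simp_all
  next
    fix e assume "e \<in> M" "e \<subseteq> set p"
    then show "e \<in> N" by (intro step.prems(2)) auto
  qed
  moreover have "{s, t} \<in> N" by (rule step.prems(2)[OF step.hyps(3)]) simp
  ultimately show ?case by (intro alt.step step.hyps)
qed (auto intro: alt.root)

text \<open>The stem beyond v can be cut off when v is exposed in N, since v then serves as root.
  This turns the branches of a blossom into alternating paths for the matching inside it.\<close>

lemma alt_restrict:
  assumes "even (length a)" "alt E M (a @ v # b)" "v \<notin> \<Union>N" "\<And>e. e \<in> M \<Longrightarrow> e \<subseteq> set a \<Longrightarrow> e \<in> N"
  shows "alt E N (a @ [v])"
  using assms
proof (induction "length a" arbitrary: a rule: less_induct)
  case less
  from less.prems(1) show ?case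
  proof (cases rule: even_list_cases)
    case 1 then show ?thesis using less.prems by (simp add: alt_single_iff)
  next
    case (2 t s a')
    have "alt E N (a' @ [v])"
    proof (rule less.hyps)
      show "\<And>e. e \<in> M \<Longrightarrow> e \<subseteq> set a' \<Longrightarrow> e \<in> N" using less.prems(4) 2 by auto
    qed (use less.prems 2 in \<open>auto simp: alt_step_iff\<close>)
    moreover have "hd (a' @ [v]) = hd (a' @ v # b)" by (cases a') auto
    moreover have "{s, t} \<in> N" using less.prems(2,4) 2 by (auto simp: alt_step_iff)
    ultimately show ?thesis using less.prems(2) 2 by (auto simp: alt_step_iff)
  qed
qed

text \<open>Exchanging the edges along the path moves the exposed vertex from the root to the tip
  and keeps the cardinality. The last two properties say that the change is confined to the path and
  that no edge of the new matching leaves it.\<close>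

lemma alt_flip:
  assumes "alt E M p" "matching M" "finite M"
  obtains N where "matching N" "finite N" "card N = card M" "N \<subseteq> M \<union> E" "hd p \<notin> \<Union>N"
    "\<And>e. e \<inter> set p = {} \<Longrightarrow> e \<in> N \<longleftrightarrow> e \<in> M" "\<And>e. e \<in> N \<Longrightarrow> e \<inter> set p \<noteq> {} \<Longrightarrow> e \<subseteq> set p"
proof -
  have "\<exists>N. matching N \<and> finite N \<and> card N = card M \<and> N \<subseteq> M \<union> E \<and> hd p \<notin> \<Union>N \<and>
    (\<forall>e. e \<inter> set p = {} \<longrightarrow> (e \<in> N \<longleftrightarrow> e \<in> M)) \<and> (\<forall>e\<in>N. e \<inter> set p \<noteq> {} \<longrightarrow> e \<subseteq> set p)"
    using assms(1)
  proof (induction)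
    case (root r)
    then show ?case using assms by (intro exI[of _ M]) auto
  next
    case (step p s t)
    obtain N where N: "matching N" "finite N" "card N = card M" "N \<subseteq> M \<union> E" "hd p \<notin> \<Union>N"
      "\<And>e. e \<inter> set p = {} \<Longrightarrow> e \<in> N \<longleftrightarrow> e \<in> M" "\<And>e. e \<in> N \<Longrightarrow> e \<inter> set p \<noteq> {} \<Longrightarrow> e \<subseteq> set p"
      using step.IH by metis
    have hp: "hd p \<in> set p" using alt_nonempty[OF step.hyps(1)] by simp
    have st: "{s, t} \<in> N" using N(6)[of "{s, t}"] step.hyps by auto
    let ?N = "N - {{s, t}}"
    have s: "s \<notin> \<Union>?N" and t: "t \<notin> \<Union>?N"
    proof -
      have *: "\<And>w g. w \<in> {s, t} \<Longrightarrow> g \<in> N \<Longrightarrow> w \<in> g \<Longrightarrow> g = {s, t}"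
        using matching_unique[OF N(1)] st by metis
      show "s \<notin> \<Union>?N" "t \<notin> \<Union>?N" using * by blast+
    qed
    have x: "hd p \<notin> \<Union>?N" using N(5) by blast
    have xs: "hd p \<noteq> s" "hd p \<noteq> t" using hp step.hyps by auto
    let ?N' = "insert {hd p, s} ?N"
    have new: "{hd p, s} \<notin> ?N" using s by blast
    show ?case
    proof (intro exI[of _ ?N'] conjI allI impI ballI)
      show "matching ?N'" using matching_subset[OF N(1), of ?N] s x xs by (intro matching_insert) auto
      show "finite ?N'" using N(2) by simp
      show "card ?N' = card M"
        using new N(2,3) st by (metis card_Suc_Diff1 card_insert_disjoint finite_Diff)
      show "?N' \<subseteq> M \<union> E" using N(4) step.hyps by blast
      have "t \<notin> \<Union>?N'" using t xs step.hyps(6) by blast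
      then show "hd (t # s # p) \<notin> \<Union>?N'" by simp
    next
      fix e assume "e \<inter> set (t # s # p) = {}"
      then have "e \<inter> set p = {}" "s \<notin> e" "t \<notin> e" by auto
      then show "e \<in> ?N' \<longleftrightarrow> e \<in> M" using N(6)[of e] by auto
    next
      fix e assume that: "e \<in> ?N'" "e \<inter> set (t # s # p) \<noteq> {}"
      show "e \<subseteq> set (t # s # p)"
      proof (cases "e = {hd p, s}")
        case False
        then have e: "e \<in> ?N" using that by blast
        then have "s \<notin> e" "t \<notin> e" using s t by blast+
        then have "e \<inter> set p \<noteq> {}" using that(2) by simp
        then have "e \<subseteq> set p" using N(7) e by blast
        then show ?thesis by auto
      qed (use hp in auto)
    qed
  qed
  then show ?thesis using that by metis
qed

text \<open>Flipping both paths exposes both tips, and their edge can be added. Disjointness keeps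
  each flip from disturbing the other.\<close>

lemma augment_two_alt:
  assumes "matching M" "finite M" "M \<subseteq> E" "alt E M p" "alt E M q" "set p \<inter> set q = {}" "{hd p, hd q} \<in> E"
  shows "\<exists>N. matching N \<and> N \<subseteq> E \<and> card M < card N"
proof -
  obtain N where N: "matching N" "finite N" "card N = card M" "N \<subseteq> M \<union> E" "hd p \<notin> \<Union>N"
    "\<And>e. e \<inter> set p = {} \<Longrightarrow> e \<in> N \<longleftrightarrow> e \<in> M" "\<And>e. e \<in> N \<Longrightarrow> e \<inter> set p \<noteq> {} \<Longrightarrow> e \<subseteq> set p"
    using alt_flip[OF assms(4,1,2)] by metis
  have q: "alt E N q"
  proof (rule alt_transfer[OF assms(5)])
    fix r assume r: "r \<in> set q" "r \<notin> \<Union>M"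
    show "r \<notin> \<Union>N"
    proof
      assume "r \<in> \<Union>N"
      then obtain e where e: "e \<in> N" "r \<in> e" by blast
      then show False using N(6)[of e] N(7)[of e] r assms(6) by blast
    qed
  next
    fix e assume "e \<in> M" "e \<subseteq> set q"
    then show "e \<in> N" using N(6)[of e] assms(6) by blast
  qed
  obtain N' where N': "matching N'" "finite N'" "card N' = card N" "N' \<subseteq> N \<union> E" "hd q \<notin> \<Union>N'"
    "\<And>e. e \<inter> set q = {} \<Longrightarrow> e \<in> N' \<longleftrightarrow> e \<in> N" "\<And>e. e \<in> N' \<Longrightarrow> e \<inter> set q \<noteq> {} \<Longrightarrow> e \<subseteq> set q"
    using alt_flip[OF q N(1,2)] by metis
  have hp: "hd p \<in> set p" "hd q \<in> set q"
    using alt_nonempty[OF assms(4)] alt_nonempty[OF assms(5)] by simp_all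
  have p': "hd p \<notin> \<Union>N'"
  proof
    assume "hd p \<in> \<Union>N'"
    then obtain e where e: "e \<in> N'" "hd p \<in> e" by blast
    then have "\<not> e \<subseteq> set q" using hp assms(6) by blast
    then have "e \<in> N" using N'(6)[of e] N'(7)[of e] e by blast
    then show False using N(5) e by blast
  qed
  have ne: "hd p \<noteq> hd q" using hp assms(6) by auto
  have "matching (insert {hd p, hd q} N')" using matching_insert[OF N'(1) ne p' N'(5)] .
  moreover have "card (insert {hd p, hd q} N') = Suc (card M)"
    using p' N' N(3) by (subst card_insert_disjoint) auto
  moreover have "insert {hd p, hd q} N' \<subseteq> E" using N'(4) N(4) assms(3,7) by blast
  ultimately show ?thesis by (metis lessI)
qed

text \<open>
  A forest of alternating paths that cannot grow and has no edge between tips certifies that the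
  matching is maximum: an augmenting path would have to alternate between tips and inner vertices.
\<close>

lemma no_aug_path_of_labels:
  assumes "aug_path E M xs" "M \<subseteq> M0" "hd xs \<in> Out"
    and "\<And>x y. x \<in> Out \<Longrightarrow> {x, y} \<in> E \<Longrightarrow> y \<in> Inn" "\<And>y z. y \<in> Inn \<Longrightarrow> {y, z} \<in> M0 \<Longrightarrow> z \<in> Out"
  shows "last xs \<in> Inn"
  using assms
proof (induction)
  case (step M y z zs x)
  have "y \<in> Inn" using step.prems(2,3) step.hyps(4) by simp
  moreover have "{y, z} \<in> M0" using step.hyps(2) step.prems(1) by blast
  ultimately have "z \<in> Out" using step.prems(4) by simp
  have "last (z # zs) \<in> Inn" by (rule step.IH) (use step.prems \<open>z \<in> Out\<close> in auto)
  then show ?case by simp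
qed auto

text \<open>A forest is stored as the set of its paths from tips to roots, so tips are exactly the
  vertices at even distance. The last clause says that a vertex determines the rest of every path
  through it: paths that meet stay together down to the root.\<close>

definition forest :: "'a set set \<Rightarrow> 'a set set \<Rightarrow> 'a list set \<Rightarrow> bool" where
  "forest E M P \<longleftrightarrow> (\<forall>p\<in>P. alt E M p) \<and> (\<forall>t s p. t # s # p \<in> P \<longrightarrow> p \<noteq> [] \<longrightarrow> p \<in> P) \<and>
     (\<forall>p\<in>P. \<forall>q\<in>P. \<forall>a b c d v. p = a @ v # b \<longrightarrow> q = c @ v # d \<longrightarrow> b = d)"

section \<open>Alternating forests as certificates\<close>

lemma forest_alt: "forest E M P \<Longrightarrow> p \<in> P \<Longrightarrow> alt E M p"
  unfolding forest_def by blast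

lemma forest_tl: "forest E M P \<Longrightarrow> t # s # p \<in> P \<Longrightarrow> p \<noteq> [] \<Longrightarrow> p \<in> P"
  unfolding forest_def by blast

lemma forest_unique:
  "forest E M P \<Longrightarrow> p \<in> P \<Longrightarrow> q \<in> P \<Longrightarrow> p = a @ v # b \<Longrightarrow> q = c @ v # d \<Longrightarrow> b = d"
  unfolding forest_def by blast

lemma forest_suffix:
  assumes "forest E M P" "a @ v # b \<in> P" "even (length a)"
  shows "v # b \<in> P"
  using assms(2,3)
proof (induction "length a" arbitrary: a rule: less_induct)
  case less
  from less.prems(2) show ?case
  proof (cases rule: even_list_cases)
    case 1 then show ?thesis using less.prems by simp
  next
    case (2 t s a')
    then have "a' @ v # b \<in> P" using forest_tl[OF assms(1), of t s "a' @ v # b"] less.prems by simp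
    then show ?thesis using less.hyps[of a'] 2 by simp
  qed
qed

lemma forest_vertex:
  assumes F: "forest E M P" and v: "p \<in> P" "v \<in> set p"
  obtains b where "v # b \<in> P" | t b where "t # v # b \<in> P"
proof -
  obtain a b where p: "p = a @ v # b" using v(2) by (meson split_list)
  show ?thesis
  proof (cases "even (length a)")
    case True then show ?thesis using forest_suffix[OF F] p v(1) that(1) by blast
  next
    case False
    then obtain a' t where "a = a' @ [t]" "even (length a')" by (cases a rule: rev_cases) auto
    then show ?thesis using forest_suffix[OF F, of a' t "v # b"] p v(1) that(2) by simp
  qed
qed

text \<open>By the labelling argument an augmenting path, which starts at a root, would end at an
  inner vertex. Inner vertices are covered by M, whereas the end of an augmenting path is
  exposed.\<close>

lemma stuck_forest_maximum:
  assumes M: "matching M" "finite M" "M \<subseteq> E" and F: "forest E M P"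
    and roots: "\<And>r e. e \<in> E \<Longrightarrow> r \<in> e \<Longrightarrow> r \<notin> \<Union>M \<Longrightarrow> [r] \<in> P"
    and grown: "\<And>p s t. p \<in> P \<Longrightarrow> {hd p, s} \<in> E \<Longrightarrow> {s, t} \<in> M \<Longrightarrow> \<exists>q\<in>P. s \<in> set q"
    and tips: "\<And>p q. p \<in> P \<Longrightarrow> q \<in> P \<Longrightarrow> {hd p, hd q} \<notin> E"
    and N: "matching N" "N \<subseteq> E"
  shows "card N \<le> card M"
proof (rule ccontr)
  assume "\<not> card N \<le> card M"
  then obtain xs where "aug_path (M \<union> N) M xs" using berge[OF M(1,2) N(1)] by auto
  then have ap: "aug_path E M xs" using aug_path_mono M(3) N(2) by (metis Un_least)
  let ?Out = "hd ` P" and ?In = "{s. \<exists>t b. t # s # b \<in> P}"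
  have "{hd xs, hd (tl xs)} \<in> E"
    using aug_path_edges[OF ap] aug_path_length[OF ap] by (cases xs; cases "tl xs") auto
  then have "[hd xs] \<in> P" using roots aug_path_hd[OF ap] by blast
  then have hd: "hd xs \<in> ?Out" by (metis image_eqI list.sel(1))
  have last: "last xs \<in> ?In"
  proof (rule no_aug_path_of_labels[OF ap order_refl hd])
    fix x y assume "x \<in> ?Out" and xy: "{x, y} \<in> E"
    then obtain p where p: "p \<in> P" "x = hd p" by blast
    have "\<exists>q\<in>P. y \<in> set q"
    proof (cases "y \<in> \<Union>M")
      case True
      then obtain e where e: "e \<in> M" "y \<in> e" by blast
      then have "card e = 2" using M(1) unfolding matching_def by blast
      then obtain z where "e = {y, z}" using e(2) by (auto simp: card_2_iff)
      then show ?thesis using grown[OF p(1), of y z] xy p(2) e(1) by simp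
    next
      case False
      then have "[y] \<in> P" using roots[OF xy] by blast
      then show ?thesis by force
    qed
    then obtain q where q: "q \<in> P" "y \<in> set q" by blast
    show "y \<in> ?In"
      using forest_vertex[OF F q] tips[OF p(1)] xy p(2) by (metis (mono_tags, lifting) list.sel(1) mem_Collect_eq)
  next
    fix y z assume "y \<in> ?In" and yz: "{y, z} \<in> M"
    then obtain t b where tb: "t # y # b \<in> P" by blast
    then have "alt E M (t # y # b)" using F unfolding forest_def by blast
    then have yt: "{y, t} \<in> M" by (subst (asm) alt.simps) auto
    have "{y, z} = {y, t}" using matching_unique[OF M(1) yz yt, of y] by simp
    then have "z = t" by (auto simp: doubleton_eq_iff)
    then show "z \<in> ?Out" using tb by force
  qed
  then obtain t b where tb: "t # last xs # b \<in> P" by blast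
  then have "alt E M (t # last xs # b)" using F unfolding forest_def by blast
  then have "{last xs, t} \<in> M" by (subst (asm) alt.simps) auto
  then show False using aug_path_last[OF ap M(1)] by blast
qed

text \<open>The mate t of a new vertex s is new as well. As a tip, t would be an exposed root or
  would come with its mate s on the path; as an inner vertex, it would be followed by its mate
  s.\<close>

lemma forest_grow:
  assumes F: "forest E M P" and p: "p \<in> P" and e: "{hd p, s} \<in> E" "{s, t} \<in> M"
    and M: "matching M" and new: "\<And>q. q \<in> P \<Longrightarrow> s \<notin> set q"
  shows "forest E M (insert (t # s # p) P)" "\<And>q. q \<in> P \<Longrightarrow> t \<notin> set q"
proof -
  have alt: "alt E M q" if "q \<in> P" for q using F that unfolding forest_def by blast
  have st: "s \<noteq> t" using matching_edge_neq[OF M e(2)] .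
  show t: "t \<notin> set q" if q: "q \<in> P" for q
  proof
    assume "t \<in> set q"
    then consider b where "t # b \<in> P" | u b where "u # t # b \<in> P" using forest_vertex[OF F q] by metis
    then show False
    proof cases
      case 1
      from alt[OF 1] show False
      proof cases
        case root
        then show False using e(2) by blast
      next
        case (step p' s')
        then have "{s', t} = {s, t}" using matching_unique[OF M _ e(2), of "{s', t}" t] by blast
        then have "s' = s" using st by (auto simp: doubleton_eq_iff)
        then show False using new[OF 1] step by simp
      qed
    next
      case 2
      then have "{t, u} \<in> M" using alt[OF 2] by (subst (asm) alt.simps) auto
      then have "{t, u} = {s, t}" using matching_unique[OF M _ e(2), of "{t, u}" t] by blast
      then have "u = s" using st by (auto simp: doubleton_eq_iff)
      then show False using new[OF 2] by simp
    qed
  qed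
  have a: "alt E M (t # s # p)" using alt[OF p] e new[OF p] t[OF p] st by (intro alt.step) auto
  have cons: "b = d" if "q \<in> P" "q' \<in> P" "q = x @ v # b" "q' = c @ v # d" for q q' x v b c d
    using forest_unique[OF F that] .
  have cons1: "b = d" if q: "t # s # p = x @ v # b" and q': "q' \<in> P" "q' = c @ v # d" for q' x v b c d
  proof -
    have v: "v \<in> set q'" using q'(2) by simp
    then have "v \<noteq> s" "v \<noteq> t" using new[OF q'(1)] t[OF q'(1)] by auto
    then obtain x' where "p = x' @ v # b" using q by (cases x; cases "tl x") auto
    then show ?thesis using cons[OF p q'(1) _ q'(2)] by blast
  qed
  have cons2: "b = d" if q: "t # s # p = x @ v # b" "t # s # p = c @ v # d" for x v b c d
  proof -
    have "distinct (t # s # p)" using alt_distinct[OF a] .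
    then have "distinct (x @ v # b)" "distinct (c @ v # d)" using q by simp_all
    moreover have "x @ v # b = c @ v # d" using q by simp
    ultimately show ?thesis by (simp add: append_eq_append_conv2 append_eq_Cons_conv Cons_eq_append_conv) auto
  qed
  show "forest E M (insert (t # s # p) P)"
    unfolding forest_def
  proof (intro conjI ballI allI impI)
    fix q assume "q \<in> insert (t # s # p) P"
    then show "alt E M q" using a alt by blast
  next
    fix t' s' q assume "t' # s' # q \<in> insert (t # s # p) P" "q \<noteq> []"
    then show "q \<in> insert (t # s # p) P" using forest_tl[OF F, of t' s' q] p by auto
  next
    fix q q' x b c d v
    assume q: "q \<in> insert (t # s # p) P" "q' \<in> insert (t # s # p) P" "q = x @ v # b" "q' = c @ v # d"
    then consider "q \<in> P" "q' \<in> P" | "q = t # s # p" "q' \<in> P" | "q' = t # s # p" "q \<in> P"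
      | "q = t # s # p" "q' = t # s # p" by blast
    then show "b = d"
    proof cases
      case 1 then show ?thesis using cons q(3,4) by blast
    next
      case 2 
      then have "t # s # p = x @ v # b" using q(3) by simp
      then show ?thesis by (rule cons1[OF _ 2(2) q(4)])
    next
      case 3
      then have "t # s # p = c @ v # d" using q(4) by simp
      from cons1[OF this 3(2) q(3)] show ?thesis by simp
    next
      case 4
      then have "t # s # p = x @ v # b" "t # s # p = c @ v # d" using q(3,4) by simp_all
      then show ?thesis by (rule cons2)
    qed
  qed
qed

text \<open>Two tips joined by an edge whose paths merge at v and share the stem b. The branches
  have even length, so they form an odd cycle together with v. One branch may be empty, hence
  \<open>hd (a @ [v])\<close>.\<close>

locale blossom =
  fixes E M :: "'a set set" and a c b :: "'a list" and v :: 'a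
  assumes E2: "\<And>e. e \<in> E \<Longrightarrow> card e = 2"
    and M: "matching M" "finite M" "M \<subseteq> E"
    and p: "alt E M (a @ v # b)" and q: "alt E M (c @ v # b)"
    and even: "even (length a)" "even (length c)" and disj: "set a \<inter> set c = {}"
    and edge: "{hd (a @ [v]), hd (c @ [v])} \<in> E"
begin

definition B where "B = set a \<union> set c \<union> {v}"
definition MB where "MB = {e\<in>M. e \<subseteq> B}"

section \<open>The matching inside a blossom\<close>

lemma dist: "v \<notin> set a" "v \<notin> set c" "set a \<inter> set b = {}" "set c \<inter> set b = {}" "v \<notin> set b"
  using alt_distinct[OF p] alt_distinct[OF q] by auto

lemma covered: "even (length l) \<Longrightarrow> alt E M (l @ v # b) \<Longrightarrow> x \<in> set l \<Longrightarrow> \<exists>y\<in>set l. {x, y} \<in> M"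
proof (induction "length l" arbitrary: l rule: less_induct)
  case less
  from less.prems(1) show ?case
  proof (cases rule: even_list_cases)
    case 1 then show ?thesis using less.prems by simp
  next
    case (2 t s l')
    then have st: "{s, t} \<in> M" "alt E M (l' @ v # b)" using less.prems(2) by (auto simp: alt_step_iff)
    consider "x = t" | "x = s" | "x \<in> set l'" using less.prems(3) 2 by auto
    then show ?thesis
    proof cases
      case 1 then show ?thesis using st 2 by (intro bexI[of _ s]) (auto simp: insert_commute)
    next
      case xs: 2 then show ?thesis using st 2 by (intro bexI[of _ t]) auto
    next
      case 3
      then show ?thesis using less.hyps[of l'] 2 st by auto
    qed
  qed
qed

lemma v_mate:
  assumes "e \<in> M" "v \<in> e"
  shows "e \<inter> B = {v}"
proof -
  have "x \<notin> e" if x: "x \<in> set a \<or> x \<in> set c" for x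
  proof
    assume "x \<in> e"
    obtain y where y: "y \<in> set a \<union> set c" "{x, y} \<in> M"
      using covered[OF even(1) p, of x] covered[OF even(2) q, of x] x by blast
    then have "e = {x, y}" using matching_unique[OF M(1) assms(1) y(2) \<open>x \<in> e\<close>] by simp
    then show False using assms(2) dist y(1) x by auto
  qed
  then show ?thesis unfolding B_def using assms(2) by blast
qed

text \<open>All vertices of the branches are matched within their branch, so only the edge at the
  base v can leave the blossom.\<close>

lemma M_cross:
  assumes "e \<in> M" "e \<inter> B \<noteq> {}"
  shows "e \<subseteq> B - {v} \<or> e \<inter> B = {v}"
proof (cases "v \<in> e")
  case True then show ?thesis using v_mate assms by blast
next
  case False
  then obtain x where x: "x \<in> e" "x \<in> set a \<or> x \<in> set c" using assms(2) unfolding B_def by auto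
  obtain y where y: "y \<in> set a \<union> set c" "{x, y} \<in> M"
    using covered[OF even(1) p] covered[OF even(2) q] x(2) by blast
  then have "e = {x, y}" using matching_unique[OF M(1) assms(1) y(2) x(1)] by simp
  then show ?thesis using x y dist unfolding B_def by auto
qed

lemma MB: "matching MB" "finite MB" "MB \<subseteq> E" "\<Union>MB = B - {v}"
proof -
  show "matching MB" by (rule matching_subset[OF M(1)]) (auto simp: MB_def)
  show "finite MB" "MB \<subseteq> E" using M unfolding MB_def by auto
  show "\<Union>MB = B - {v}"
  proof
    show "\<Union>MB \<subseteq> B - {v}" 
    proof
      fix x assume "x \<in> \<Union>MB"
      then obtain e where e: "e \<in> M" "e \<subseteq> B" "x \<in> e" unfolding MB_def by blast
      then have "card e = 2" using M(1) unfolding matching_def by blast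
      moreover have "e \<subseteq> B - {v} \<or> e \<inter> B = {v}" using M_cross e by blast
      ultimately have "e \<subseteq> B - {v}" using e(2) by (metis Int_absorb2 card_1_singleton_iff One_nat_def numeral_eq_one_iff semiring_norm(85))
      then show "x \<in> B - {v}" using e(3) by blast
    qed
    show "B - {v} \<subseteq> \<Union>MB"
    proof
      fix x assume x: "x \<in> B - {v}"
      consider "x \<in> set a" | "x \<in> set c" using x unfolding B_def by blast
      then obtain y where "y \<in> set a \<union> set c" "{x, y} \<in> M"
        using covered[OF even(1) p] covered[OF even(2) q] by cases blast+
      then have "{x, y} \<in> MB" unfolding MB_def B_def using x unfolding B_def by auto
      then show "x \<in> \<Union>MB" by blast
    qed
  qed
qed

lemma finite_B: "finite B" unfolding B_def by simp

lemma card_MB: "2 * card MB + 1 = card B"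
proof -
  have "v \<in> B" unfolding B_def by simp
  then show ?thesis
    using card_Union_matching[OF MB(1,2)] MB(4) finite_B by (metis Suc_eq_plus1 card_Suc_Diff1)
qed

lemma v_MB: "v \<notin> \<Union>MB" using MB(4) by blast

lemma alt_a: "alt E MB (a @ [v])" and alt_c: "alt E MB (c @ [v])"
  using alt_restrict[OF even(1) p v_MB] alt_restrict[OF even(2) q v_MB] unfolding MB_def B_def by auto

end

text \<open>The vertices of a at odd positions are reached the other way round: along the other
  branch l, across the joining edge, and then from the tip of a backwards.\<close>

lemma alt_around:
  assumes "alt E N (a @ [v])" "alt E N l" "set a \<inter> set l = {}" "{hd (a @ [v]), hd l} \<in> E"
    "a = a1 @ a2" "even (length a1)"
  shows "alt E N (rev a1 @ l)"
  using assms(5,6)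
proof (induction "length a1" arbitrary: a1 a2 rule: less_induct)
  case less
  show ?case
  proof (cases a1 rule: rev_cases)
    case Nil then show ?thesis using assms by simp
  next
    case (snoc a' s)
    then obtain a'' t where a1: "a1 = a'' @ [t, s]" "even (length a'')" using less.prems by (cases a' rule: rev_cases) auto
    have IH: "alt E N (rev a'' @ l)" using less.hyps[of a'' "t # s # a2"] less.prems a1 by simp
    have "alt E N (t # (s # a2 @ [v]))" using alt_suffix[OF a1(2), of E N t "s # a2 @ [v]"] assms(1) less.prems(1) a1 by simp
    then have st: "{s, t} \<in> N" "s \<noteq> t" by (simp_all add: alt_step_iff)
    have "{hd (rev a'' @ l), t} \<in> E"
    proof (cases a'' rule: rev_cases)
      case Nil then show ?thesis using assms(4) less.prems(1) a1 by (simp add: insert_commute)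
    next
      case (snoc d s')
      then obtain d' t' where d: "a'' = d' @ [t', s']" "even (length d')" using a1(2) by (cases d rule: rev_cases) auto
      have "alt E N (t' # s' # t # s # a2 @ [v])"
        using alt_suffix[OF d(2), of E N t' "s' # t # s # a2 @ [v]"] assms(1) less.prems(1) a1 d by simp
      then show ?thesis using d by (simp add: alt_step_iff insert_commute)
    qed
    moreover have "distinct (a @ [v])" using alt_distinct[OF assms(1)] .
    ultimately show ?thesis using IH st a1 less.prems(1) assms(3) by (auto simp: alt_step_iff insert_commute)
  qed
qed

context blossom
begin

text \<open>A vertex at an even position of its branch is the tip of the remaining branch; one at an
  odd position is reached around the cycle.\<close>

lemma alt_to:
  assumes "u \<in> B"
  shows "\<exists>l. alt E MB l \<and> hd l = u \<and> set l \<subseteq> B"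
proof -
  have side: "\<exists>l. alt E MB l \<and> hd l = u \<and> set l \<subseteq> B"
    if x: "alt E MB (x @ [v])" "alt E MB (y @ [v])" "set x \<inter> set (y @ [v]) = {}"
      "{hd (x @ [v]), hd (y @ [v])} \<in> E" "u \<in> set x" "set x \<union> set y \<subseteq> B" for x y
  proof -
    obtain x1 x2 where u: "x = x1 @ u # x2" using x(5) by (meson split_list)
    have vB: "v \<in> B" unfolding B_def by simp
    show ?thesis
    proof (cases "even (length x1)")
      case True
      then have "alt E MB (u # x2 @ [v])" using alt_suffix[of x1 E MB u "x2 @ [v]"] x(1) u by simp
      then show ?thesis using u x(6) vB by (intro exI[of _ "u # x2 @ [v]"]) auto
    next
      case False
      then have "alt E MB (rev (x1 @ [u]) @ y @ [v])"
        using alt_around[OF x(1,2,3,4), of "x1 @ [u]" x2] u by simp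
      then show ?thesis using u x(6) vB by (intro exI[of _ "rev (x1 @ [u]) @ y @ [v]"]) auto
    qed
  qed
  consider "u = v" | "u \<in> set a" | "u \<in> set c" using assms unfolding B_def by auto
  then show ?thesis
  proof cases
    case 1
    then show ?thesis using v_MB by (intro exI[of _ "[v]"]) (auto simp: alt_single_iff B_def)
  next
    case 2
    then show ?thesis using side[OF alt_a alt_c _ edge] disj dist unfolding B_def by auto
  next
    case 3
    then show ?thesis using side[OF alt_c alt_a] edge disj dist unfolding B_def by (auto simp: insert_commute)
  qed
qed

text \<open>Flipping the path that leads to u inside the blossom exposes u instead of v. By
  counting, all other vertices of the blossom are then covered.\<close>

lemma factor_critical:
  assumes "u \<in> B"
  obtains N where "matching N" "finite N" "N \<subseteq> E" "\<Union>N = B - {u}" "card N = card MB"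
proof -
  obtain l where l: "alt E MB l" "hd l = u" "set l \<subseteq> B" using alt_to[OF assms] by blast
  obtain N where N: "matching N" "finite N" "card N = card MB" "N \<subseteq> MB \<union> E" "hd l \<notin> \<Union>N"
    "\<And>e. e \<inter> set l = {} \<Longrightarrow> e \<in> N \<longleftrightarrow> e \<in> MB" "\<And>e. e \<in> N \<Longrightarrow> e \<inter> set l \<noteq> {} \<Longrightarrow> e \<subseteq> set l"
    using alt_flip[OF l(1) MB(1,2)] by metis
  have "e \<subseteq> B" if "e \<in> N" for e
  proof (cases "e \<inter> set l = {}")
    case True then show ?thesis using N(6) that unfolding MB_def by auto
  next
    case False then show ?thesis using N(7)[OF that] l(3) by blast
  qed
  then have sub: "\<Union>N \<subseteq> B - {u}" using N(5) l(2) by blast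
  have "card (\<Union>N) = card (B - {u})"
    using card_Union_matching[OF N(1,2)] N(3) card_MB assms finite_B by simp
  then have "\<Union>N = B - {u}" using sub finite_B by (intro card_subset_eq) auto
  moreover have "N \<subseteq> E" using N(4) MB(3) by blast
  ultimately show ?thesis by (intro that[OF N(1,2)] N(3))
qed

text \<open>The contracted vertex reuses the name v, so the edges of M that survive contraction are
  unchanged, see \<open>contract_M\<close>.\<close>

definition \<rho> :: "'a \<Rightarrow> 'a" where "\<rho> x = (if x \<in> B then v else x)"
definition contract :: "'a set set \<Rightarrow> 'a set set" where
  "contract F = {\<rho> ` e | e. e \<in> F \<and> \<not> e \<subseteq> B}"

lemma contractI: "f \<in> F \<Longrightarrow> \<not> f \<subseteq> B \<Longrightarrow> e = \<rho> ` f \<Longrightarrow> e \<in> contract F"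
  unfolding contract_def by blast

lemma contract_M: "contract M = {e\<in>M. \<not> e \<subseteq> B}"
proof -
  have "\<rho> ` e = e" if "e \<in> M" "\<not> e \<subseteq> B" for e
  proof -
    have "e \<inter> B = {} \<or> e \<inter> B = {v}" using M_cross[OF that(1)] that(2) by blast
    then show ?thesis unfolding \<rho>_def by force
  qed
  then show ?thesis unfolding contract_def by force
qed

lemma matching_contract_M: "matching (contract M)" "finite (contract M)" "contract M \<subseteq> contract E"
proof -
  show "matching (contract M)" by (rule matching_subset[OF M(1)]) (auto simp: contract_M)
  show "finite (contract M)" using M(2) unfolding contract_M by simp
  show "contract M \<subseteq> contract E" using M(3) unfolding contract_def by blast
qed

lemma card_contract_M: "card M = card (contract M) + card MB"
proof -
  have "M = contract M \<union> MB" "contract M \<inter> MB = {}" unfolding contract_M MB_def by auto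
  then show ?thesis using matching_contract_M(2) MB(2) by (metis card_Un_disjoint)
qed

text \<open>At most one edge of N meets the contracted vertex. It is lifted to an edge of E that
  enters the blossom at some u, and the rest of the blossom is matched perfectly. If no edge meets
  it, the base is left out instead. Either way \<open>card MB\<close> edges are added.\<close>

lemma expand_larger:
  assumes N: "matching N" "N \<subseteq> contract E" "card (contract M) < card N"
  shows "\<exists>N'. matching N' \<and> N' \<subseteq> E \<and> card M < card N'"
proof -
  have finN: "finite N" using N(3) by (metis card.infinite not_less0)
  have out: "e \<in> E \<and> e \<inter> B = {}" if e: "e \<in> N" "v \<notin> e" for e
  proof -
    obtain f where f: "e = \<rho> ` f" "f \<in> E" using e(1) N(2) unfolding contract_def by blast
    have "x \<notin> B" if "x \<in> f" for x
    proof
      assume "x \<in> B"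
      then have "\<rho> x = v" unfolding \<rho>_def by simp
      then show False using e(2) f(1) that by force
    qed
    then have "\<rho> ` f = f" unfolding \<rho>_def by force
    then show ?thesis using f \<open>\<And>x. x \<in> f \<Longrightarrow> x \<notin> B\<close> by auto
  qed
  define N0 where "N0 = {e\<in>N. v \<notin> e}"
  have N0: "matching N0" "finite N0" "N0 \<subseteq> E" "\<Union>N0 \<inter> B = {}"
    using matching_subset[OF N(1)] finN out unfolding N0_def by auto
  show ?thesis
  proof (cases "N = N0")
    case True
    have "v \<in> B" unfolding B_def by simp
    obtain Q where Q: "matching Q" "finite Q" "Q \<subseteq> E" "\<Union>Q = B - {v}" "card Q = card MB"
      using factor_critical[OF \<open>v \<in> B\<close>] by metis
    have "\<Union>N0 \<inter> \<Union>Q = {}" using N0(4) Q(4) by blast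
    then have "matching (N0 \<union> Q)" using matching_Un N0(1) Q(1) by blast
    moreover have "N0 \<inter> Q = {}"
    proof (rule equals0I)
      fix e assume e: "e \<in> N0 \<inter> Q"
      then have "card e = 2" using N0(1) unfolding matching_def by blast
      then have "e \<noteq> {}" by auto
      then show False using e \<open>\<Union>N0 \<inter> \<Union>Q = {}\<close> by blast
    qed
    then have "card (N0 \<union> Q) = card N0 + card Q" using N0(2) Q(2) by (rule card_Un_disjoint[rotated 2])
    then have "card M < card (N0 \<union> Q)" using N(3) True Q(5) card_contract_M by simp
    ultimately show ?thesis using N0(3) Q(3) by blast
  next
    case False
    then obtain e where e: "e \<in> N" "v \<in> e" unfolding N0_def by blast
    have eq: "g = e" if "g \<in> N" "v \<in> g" for g using matching_unique[OF N(1) that(1) e(1) that(2) e(2)] .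
    have "g \<in> insert e N0" if "g \<in> N" for g
      using eq[OF that] that unfolding N0_def by (cases "v \<in> g") simp_all
    then have Ne: "N = insert e N0" "e \<notin> N0" using e by (auto simp: N0_def)
    obtain f where f: "e = \<rho> ` f" "f \<in> E" "\<not> f \<subseteq> B" using e(1) N(2) unfolding contract_def by blast
    obtain u where u: "u \<in> f" "\<rho> u = v" using e(2) f(1) by auto
    then have uB: "u \<in> B" unfolding \<rho>_def B_def by (auto split: if_splits)
    obtain w where w: "w \<in> f" "w \<notin> B" using f(3) by blast
    then have we: "w \<in> e" "w \<noteq> v" using f(1) unfolding \<rho>_def B_def by force+
    have "card e = 2" using N(1) e(1) unfolding matching_def by blast
    then have evw: "e = {v, w}" using e(2) we by (auto simp: card_2_iff)
    obtain Q where Q: "matching Q" "finite Q" "Q \<subseteq> E" "\<Union>Q = B - {u}" "card Q = card MB"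
      using factor_critical[OF uB] by metis
    have wN0: "w \<notin> \<Union>N0"
    proof
      assume "w \<in> \<Union>N0"
      then obtain g where "g \<in> N" "w \<in> g" "v \<notin> g" unfolding N0_def by blast
      then show False using matching_unique[OF N(1) _ e(1) _ we(1), of g] e(2) by simp
    qed
    have dis: "\<Union>N0 \<inter> \<Union>Q = {}" using N0(4) Q(4) by blast
    then have m1: "matching (N0 \<union> Q)" using matching_Un N0(1) Q(1) by blast
    have "N0 \<inter> Q = {}"
    proof (rule equals0I)
      fix e assume e: "e \<in> N0 \<inter> Q"
      then have "card e = 2" using N0(1) unfolding matching_def by blast
      then have "e \<noteq> {}" by auto
      then show False using e dis by blast
    qed
    then have c1: "card (N0 \<union> Q) = card N0 + card Q" using N0(2) Q(2) by (rule card_Un_disjoint[rotated 2])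
    have un: "u \<notin> \<Union>(N0 \<union> Q)" "w \<notin> \<Union>(N0 \<union> Q)"
      using N0(4) Q(4) uB w(2) wN0 unfolding Union_Un_distrib by blast+
    have uw: "u \<noteq> w" using uB w by blast
    show ?thesis
    proof (intro exI[of _ "insert {u, w} (N0 \<union> Q)"] conjI)
      show "matching (insert {u, w} (N0 \<union> Q))" using matching_insert[OF m1 uw un] .
      have "{u, w} \<notin> N0 \<union> Q" using un by blast
      then have "card (insert {u, w} (N0 \<union> Q)) = Suc (card N0 + card Q)" using c1 N0(2) Q(2) by simp
      also have "\<dots> = card N + card MB" using Ne N0(2) Q(5) by simp
      finally show "card M < card (insert {u, w} (N0 \<union> Q))" using N(3) card_contract_M by simp
      have "f = {u, w}" using E2[OF f(2)] u(1) w(1) uw by (auto simp: card_2_iff)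
      then show "insert {u, w} (N0 \<union> Q) \<subseteq> E" using f(2) N0(3) Q(3) by blast
    qed
  qed
qed

text \<open>Follow the path until it first enters the blossom and stop there. The contracted vertex
  is exposed, because no edge of N crosses the boundary of B.\<close>

lemma aug_path_contract:
  assumes "aug_path E N xs" "hd xs \<notin> B" "\<And>e. e \<in> N \<Longrightarrow> e \<inter> B \<noteq> {} \<Longrightarrow> e \<subseteq> B"
  shows "\<exists>ys. aug_path (contract E) {e\<in>N. e \<inter> B = {}} ys \<and> hd ys = hd xs \<and> set ys \<subseteq> set xs \<union> {v}"
  using assms
proof (induction)
  case (base x y N)
  have vB: "v \<in> B" unfolding B_def by simp
  have xv: "x \<noteq> v" using base vB by auto
  have e: "\<rho> ` {x, y} \<in> contract E" by (rule contractI[of "{x, y}"]) (use base in auto)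
  show ?case
  proof (cases "y \<in> B")
    case True
    then have "{x, v} \<in> contract E" using e base unfolding \<rho>_def by simp
    then have "aug_path (contract E) {e\<in>N. e \<inter> B = {}} [x, v]"
      using base xv vB by (intro aug_path.base) auto
    then show ?thesis by (intro exI[of _ "[x, v]"]) auto
  next
    case False
    then have "{x, y} \<in> contract E" using e base unfolding \<rho>_def by simp
    then have "aug_path (contract E) {e\<in>N. e \<inter> B = {}} [x, y]"
      using base by (intro aug_path.base) auto
    then show ?thesis by (intro exI[of _ "[x, y]"]) auto
  qed
next
  case (step N y z zs x)
  have vB: "v \<in> B" unfolding B_def by simp
  have xB: "x \<notin> B" using step.prems by simp
  have xv: "x \<noteq> v" using xB vB by auto
  have e: "\<rho> ` {x, y} \<in> contract E" by (rule contractI[of "{x, y}"]) (use step.hyps(4) xB in auto)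
  show ?case
  proof (cases "y \<in> B")
    case True
    then have "{x, v} \<in> contract E" using e xB unfolding \<rho>_def by simp
    then have "aug_path (contract E) {e\<in>N. e \<inter> B = {}} [x, v]"
      using step.hyps(6) xv vB by (intro aug_path.base) auto
    then show ?thesis by (intro exI[of _ "[x, v]"]) auto
  next
    case False
    then have xy: "{x, y} \<in> contract E" using e xB unfolding \<rho>_def by simp
    have zB: "z \<notin> B" using step.prems(2)[of "{y, z}"] step.hyps(2) False by auto
    have yz: "{y, z} \<in> contract E"
    proof -
      have "\<rho> ` {y, z} = {y, z}" using False zB unfolding \<rho>_def by simp
      then show ?thesis using contractI[OF step.hyps(3), of "{y, z}"] False by simp
    qed
    obtain ys where ys: "aug_path (contract E) {e\<in>N - {{y, z}}. e \<inter> B = {}} ys" "hd ys = z" "set ys \<subseteq> set (z # zs) \<union> {v}"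
      using step.IH zB step.prems(2) by auto
    obtain ys' where ys': "ys = z # ys'" using aug_path_length[OF ys(1)] ys(2) by (cases ys) auto
    have eq: "{e\<in>N - {{y, z}}. e \<inter> B = {}} = {e\<in>N. e \<inter> B = {}} - {{y, z}}" by blast
    have "x \<notin> set ys" "y \<notin> set ys" using ys(3) step.hyps(7,8) xv False vB by auto
    then have "aug_path (contract E) {e\<in>N. e \<inter> B = {}} (x # y # z # ys')"
      using ys(1) ys' eq step.hyps xy yz zB False by (intro aug_path.step) auto
    then show ?thesis using ys(3) ys' by (intro exI[of _ "x # y # z # ys'"]) auto
  qed
qed

text \<open>Flipping the stem gives a matching of the same size that exposes the base, so no
  matching edge leaves the blossom. An augmenting path for it has an end outside the blossom;
  followed from that end, it yields an augmenting path in the contracted graph.\<close>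

lemma contract_larger:
  assumes N: "matching N" "N \<subseteq> E" "card M < card N"
  shows "\<exists>N'. matching N' \<and> N' \<subseteq> contract E \<and> card (contract M) < card N'"
proof -
  have stem: "alt E M (v # b)" using alt_suffix[OF even(1) p] .
  obtain M1 where M1: "matching M1" "finite M1" "card M1 = card M" "M1 \<subseteq> M \<union> E" "v \<notin> \<Union>M1"
    "\<And>e. e \<inter> set (v # b) = {} \<Longrightarrow> e \<in> M1 \<longleftrightarrow> e \<in> M" "\<And>e. e \<in> M1 \<Longrightarrow> e \<inter> set (v # b) \<noteq> {} \<Longrightarrow> e \<subseteq> set (v # b)"
    using alt_flip[OF stem M(1,2)] by (metis list.sel(1))
  have MB1: "{e\<in>M1. e \<subseteq> B} = MB"
  proof -
    have sub: "e \<inter> set (v # b) = {}" if "e \<subseteq> B" "v \<notin> e" for e using that dist unfolding B_def by auto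
    show ?thesis
    proof (rule set_eqI)
      fix e
      show "e \<in> {e\<in>M1. e \<subseteq> B} \<longleftrightarrow> e \<in> MB"
      proof (cases "e \<subseteq> B \<and> v \<notin> e")
        case True
        then have "e \<in> M1 \<longleftrightarrow> e \<in> M" using M1(6) sub by blast
        then show ?thesis using True unfolding MB_def by simp
      next
        case False
        then show ?thesis using M1(5) v_MB unfolding MB_def by blast
      qed
    qed
  qed
  have cross: "e \<subseteq> B" if e: "e \<in> M1" "e \<inter> B \<noteq> {}" for e
  proof -
    have v: "v \<notin> e" using M1(5) e by blast
    then obtain x where x: "x \<in> e" "x \<in> set a \<union> set c" using e(2) unfolding B_def by auto
    have "e \<inter> set (v # b) = {}" using M1(7)[OF e(1)] x dist by fastforce
    then have "e \<in> M" using M1(6) e(1) by blast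
    then show ?thesis using M_cross e(2) v by blast
  qed
  define M1' where "M1' = {e\<in>M1. e \<inter> B = {}}"
  have ne: "e \<noteq> {}" if "e \<in> M1" for e using M1(1) that unfolding matching_def by fastforce
  have "e \<inter> B = {} \<longleftrightarrow> \<not> e \<subseteq> B" if "e \<in> M1" for e using cross[OF that] ne[OF that] by blast
  then have "M1 = M1' \<union> MB" "M1' \<inter> MB = {}" unfolding M1'_def MB1[symmetric] by auto
  then have "card M1 = card M1' + card MB" using M1(2) by (metis card_Un_disjoint finite_Un)
  then have c: "card M1' = card (contract M)" using M1(3) card_contract_M by simp
  have "card M1 < card N" using N(3) M1(3) by simp
  then obtain xs where "aug_path (M1 \<union> N) M1 xs" using berge[OF M1(1,2) N(1)] by blast
  then have ap: "aug_path E M1 xs" using aug_path_mono M1(4) M(3) N(2) by (metis Un_least subset_Un_eq)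
  have only: "x = v" if "x \<in> B" "x \<notin> \<Union>M1" for x
    using that MB(4) MB1 by blast
  \<comment> \<open>The only exposed vertex of the blossom is its base, so one of the two ends lies
    outside; reverse the path if necessary.\<close>
  obtain zs where zs: "aug_path E M1 zs" "hd zs \<notin> B"
  proof (cases "hd xs \<in> B")
    case True
    then have v: "hd xs = v" using only aug_path_hd[OF ap] by blast
    have "xs \<noteq> []" "hd xs \<noteq> last xs"
      using aug_path_length[OF ap] aug_path_distinct[OF ap] by (cases xs; cases "tl xs"; auto)+
    then have "hd (rev xs) \<notin> B" using v only aug_path_last[OF ap M1(1)] by (metis hd_rev)
    then show ?thesis using that aug_path_rev[OF M1(1) ap] by blast
  next
    case False then show ?thesis using that ap by blast
  qed
  obtain ys where ys: "aug_path (contract E) M1' ys"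
    using aug_path_contract[OF zs cross] unfolding M1'_def by blast
  have m: "matching M1'" "finite M1'" using matching_subset[OF M1(1)] M1(2) unfolding M1'_def by auto
  have "M1' \<subseteq> contract E"
  proof
    fix e assume e: "e \<in> M1'"
    then have "\<rho> ` e = e" "e \<in> E" "\<not> e \<subseteq> B" using ne M1(4) M(3) unfolding M1'_def \<rho>_def by force+
    then show "e \<in> contract E" unfolding contract_def by blast
  qed
  then show ?thesis
    using aug_path_augments[OF ys m] aug_path_edges[OF ys] c
    by (intro exI[of _ "(M1' - path_edges ys) \<union> (path_edges ys - M1')"]) auto
qed

end

section \<open>Logical connectives, lists and unary numbers\<close>

lemma pt_comp2:
  assumes "pt (\<lambda>z. h (fst z) (snd z))" "pt f" "pt g"
  shows "pt (\<lambda>x. h (f x) (g x))"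
  using pt_comp[OF assms(1) pt_Pair[OF assms(2,3)]] by simp

lemma pt_comp3:
  assumes "pt (\<lambda>z. h (fst z) (fst (snd z)) (snd (snd z)))" "pt f" "pt g" "pt k"
  shows "pt (\<lambda>x. h (f x) (g x) (k x))"
  using pt_comp[OF assms(1) pt_Pair[OF assms(2) pt_Pair[OF assms(3,4)]]] by simp

lemma pt_eq: "pt f \<Longrightarrow> pt g \<Longrightarrow> pt (\<lambda>x. f x = g x)"
  by (rule pt_comp2[OF pt_eq0])

lemma pt_conj: assumes "pt P" "pt Q" shows "pt (\<lambda>x. P x \<and> Q x)"
  by (rule pt_coerce[OF pt_If[OF assms pt_const[of False]]]) simp

lemma pt_disj: assumes "pt P" "pt Q" shows "pt (\<lambda>x. P x \<or> Q x)"
  by (rule pt_coerce[OF pt_If[OF assms(1) pt_const[of True] assms(2)]]) simp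

lemma pt_not: assumes "pt P" shows "pt (\<lambda>x. \<not> P x)"
  by (rule pt_coerce[OF pt_If[OF assms pt_const[of False] pt_const[of True]]]) simp

lemma pt_Cons: "pt f \<Longrightarrow> pt g \<Longrightarrow> pt (\<lambda>x. f x # g x)"
  by (rule pt_coerce[of "\<lambda>x. (f x, g x)"]) (auto intro: pt_Pair)

lemmas pt_basic = pt_id pt_fst pt_snd pt_tl pt_pred pt_Suc pt_Pair pt_If pt_eq pt_conj pt_disj pt_not pt_Cons
  pt_case_list

lemma pt_rev:
  fixes l :: "'a::enc \<Rightarrow> 'b::enc list"
  assumes "pt l"
  shows "pt (\<lambda>x. rev (l x))"
proof -
  obtain q where q: "\<And>x. esize (l x) \<le> poly q (esize x)" using pt_poly_bound[OF assms] by blast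
  have "pt (\<lambda>x. fold (\<lambda>y w. y # w) (l x) [])"
  proof (rule pt_fold_add[of _ _ _ "q + 1"])
    fix x y and w :: "'b list" assume "y \<in> set (l x)"
    then show "esize (y # w) \<le> esize w + poly (q + 1) (esize x)" using q[of x] esize_mem[of y "l x"] by simp
  qed (intro assms pt_const pt_basic)+
  then show ?thesis by (simp add: fold_Cons_rev)
qed

lemma pt_append:
  fixes f g :: "'a::enc \<Rightarrow> 'b::enc list"
  assumes "pt f" "pt g"
  shows "pt (\<lambda>x. f x @ g x)"
proof -
  obtain q where q: "\<And>x. esize (rev (f x)) \<le> poly q (esize x)" using pt_poly_bound[OF pt_rev[OF assms(1)]] by blast
  have "pt (\<lambda>x. fold (\<lambda>y w. y # w) (rev (f x)) (g x))"
  proof (rule pt_fold_add[of _ _ _ "q + 1"])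
    fix x y and w :: "'b list" assume "y \<in> set (rev (f x))"
    then show "esize (y # w) \<le> esize w + poly (q + 1) (esize x)" using q[of x] esize_mem[of y "rev (f x)"] by simp
  qed (intro assms pt_rev pt_const pt_basic)+
  moreover have "fold (\<lambda>y w. y # w) (rev xs) ys = xs @ ys" for xs ys :: "'b list"
    by (induction xs) auto
  ultimately show ?thesis by simp
qed

text \<open>The predicate and the function may depend on the environment x, so they are required to
  be polynomial-time as functions of pairs. Maps, filters and bounded quantifiers are special
  cases.\<close>

lemma pt_filter_map:
  fixes l :: "'a::enc \<Rightarrow> 'b::enc list" and f :: "'a \<Rightarrow> 'b \<Rightarrow> 'c::enc"
  assumes "pt l" "pt (\<lambda>z. P (fst z) (snd z))" "pt (\<lambda>z. f (fst z) (snd z))"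
  shows "pt (\<lambda>x. map (f x) (filter (P x) (l x)))"
proof -
  obtain q where q: "\<And>x. esize (l x) \<le> poly q (esize x)" using pt_poly_bound[OF assms(1)] by blast
  obtain r where r: "\<And>z. esize (f (fst z) (snd z)) \<le> poly r (esize z)" using pt_poly_bound[OF assms(3)] by blast
  have P: "pt (\<lambda>z. P (fst z) (fst (snd z)))"
    using pt_comp[OF assms(2), of "\<lambda>z. (fst z, fst (snd z))"] by (simp add: pt_basic)
  have f: "pt (\<lambda>z. f (fst z) (fst (snd z)))"
    using pt_comp[OF assms(3), of "\<lambda>z. (fst z, fst (snd z))"] by (simp add: pt_basic)
  have "pt (\<lambda>x. fold (\<lambda>y w. if P x y then f x y # w else w) (l x) [])"
  proof (rule pt_fold_add[of _ _ _ "pcompose r (q + [:1, 1:]) + 1"])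
    fix x y and w :: "'c list" assume "y \<in> set (l x)"
    then have "esize (x, y) \<le> poly (q + [:1, 1:]) (esize x)" using q[of x] esize_mem[of y "l x"] by simp
    then have "poly r (esize (x, y)) \<le> poly r (poly (q + [:1, 1:]) (esize x))" by (rule poly_nat_mono)
    then have "esize (f x y) \<le> poly r (poly (q + [:1, 1:]) (esize x))"
      using r[of "(x, y)"] by (simp del: enc_simps)
    then show "esize (if P x y then f x y # w else w) \<le> esize w + poly (pcompose r (q + [:1, 1:]) + 1) (esize x)"
      by (simp add: poly_pcompose)
  qed (intro assms P f pt_const pt_basic)+
  moreover have "fold (\<lambda>y w. if P x y then f x y # w else w) xs ws = rev (map (f x) (filter (P x) xs)) @ ws" for x xs ws
    by (induction xs arbitrary: ws) auto
  ultimately have "pt (\<lambda>x. rev (map (f x) (filter (P x) (l x))))" by simp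
  from pt_rev[OF this] show ?thesis by simp
qed

lemma pt_map: "pt l \<Longrightarrow> pt (\<lambda>z. f (fst z) (snd z)) \<Longrightarrow> pt (\<lambda>x. map (f x) (l x))"
  using pt_filter_map[of l "\<lambda>_ _. True" f] by (simp add: pt_const)

lemma pt_filter: "pt l \<Longrightarrow> pt (\<lambda>z. P (fst z) (snd z)) \<Longrightarrow> pt (\<lambda>x. filter (P x) (l x))"
  using pt_filter_map[of l P "\<lambda>_ y. y"] by (simp add: pt_snd pt_id)

lemma pt_bex: "pt l \<Longrightarrow> pt (\<lambda>z. P (fst z) (snd z)) \<Longrightarrow> pt (\<lambda>x. \<exists>y\<in>set (l x). P x y)"
  by (rule pt_coerce[of "\<lambda>x. filter (P x) (l x) \<noteq> []"]) (intro pt_filter pt_basic pt_const, auto simp: filter_empty_conv)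

lemma pt_ball: "pt l \<Longrightarrow> pt (\<lambda>z. P (fst z) (snd z)) \<Longrightarrow> pt (\<lambda>x. \<forall>y\<in>set (l x). P x y)"
  by (rule pt_coerce[of "\<lambda>x. filter (\<lambda>y. \<not> P x y) (l x) = []"]) (intro pt_filter pt_basic pt_const, auto simp: filter_empty_conv)

lemma pt_mem: "pt f \<Longrightarrow> pt l \<Longrightarrow> pt (\<lambda>x. f x \<in> set (l x))"
  by (rule pt_coerce[of "\<lambda>x. \<exists>y\<in>set (l x). y = f x"])
    (intro pt_bex pt_basic pt_comp[of f fst] pt_fst0, auto)

lemma pt_concat:
  fixes l :: "'a::enc \<Rightarrow> 'b::enc list list"
  assumes "pt l"
  shows "pt (\<lambda>x. concat (l x))"
proof -
  obtain q where q: "\<And>x. esize (l x) \<le> poly q (esize x)" using pt_poly_bound[OF assms] by blast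
  have "pt (\<lambda>x. fold (\<lambda>y w. w @ y) (l x) [])"
  proof (rule pt_fold_add[of _ _ _ q])
    fix x y and w :: "'b list" assume "y \<in> set (l x)"
    then show "esize (w @ y) \<le> esize w + poly q (esize x)"
      using q[of x] esize_mem[of y "l x"] by (simp add: esize_append)
  qed (intro assms pt_append pt_const pt_basic)+
  moreover have "fold (\<lambda>y w. w @ y) xs ws = ws @ concat xs" for xs :: "'b list list" and ws
    by (induction xs arbitrary: ws) auto
  ultimately show ?thesis by simp
qed

lemma pt_length:
  assumes "pt l"
  shows "pt (\<lambda>x. length (l x))"
proof -
  have "pt (\<lambda>x. fold (\<lambda>_ n. Suc n) (l x) 0)"
    by (rule pt_fold_add[of _ _ _ 1]) (intro assms pt_const pt_basic | simp)+
  moreover have "fold (\<lambda>_ n. Suc n) xs k = k + length xs" for xs :: "'b list" and k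
    by (induction xs arbitrary: k) auto
  ultimately show ?thesis by simp
qed

text \<open>A unary number is literally the encoding of a list of units, so folds over lists also
  provide counted loops.\<close>

lemma enc_replicate_unit: "enc (replicate n ()) = enc n"
  by (induction n) auto

lemma pt_units: "pt f \<Longrightarrow> pt (\<lambda>x. replicate (f x) ())"
  by (rule pt_coerce[of f]) (auto simp: enc_replicate_unit)

lemma pt_diff:
  assumes "pt f" "pt g"
  shows "pt (\<lambda>x. f x - g x :: nat)"
proof -
  have "pt (\<lambda>x. fold (\<lambda>_ n. n - 1) (replicate (g x) ()) (f x))"
    by (rule pt_fold_add[of _ _ _ 0]) (intro assms pt_units pt_const pt_basic | simp)+
  moreover have "fold (\<lambda>_ n. n - 1) (replicate m ()) k = k - m" for m k :: nat
    by (induction m arbitrary: k) auto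
  ultimately show ?thesis by simp
qed

lemma pt_le: "pt f \<Longrightarrow> pt g \<Longrightarrow> pt (\<lambda>x. f x \<le> (g x :: nat))"
  by (rule pt_coerce[of "\<lambda>x. f x - g x = 0"]) (intro pt_diff pt_basic pt_const, auto)

lemma pt_less: "pt f \<Longrightarrow> pt g \<Longrightarrow> pt (\<lambda>x. f x < (g x :: nat))"
  by (rule pt_coerce[of "\<lambda>x. Suc (f x) \<le> g x"]) (intro pt_le pt_basic, auto simp: Suc_le_eq)

lemma pt_upt:
  assumes "pt f"
  shows "pt (\<lambda>x. [0..<f x])"
proof -
  obtain q where q: "\<And>x. esize (f x) \<le> poly q (esize x)" using pt_poly_bound[OF assms] by blast
  have eq: "fold (\<lambda>_ w. w @ [length w]) (replicate m ()) [] = [0..<m]" for m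
    by (induction m) (simp_all add: replicate_append_same[symmetric] del: replicate.simps)
  have sz: "esize [0..<m] \<le> m * m" for m
    by (induction m) (auto simp: esize_append)
  have "pt (\<lambda>x. fold (\<lambda>_ w. w @ [length w]) (replicate (f x) ()) [])"
  proof (rule pt_fold[of _ _ _ "q * q"])
    fix x and ys zs :: "unit list" assume "replicate (f x) () = ys @ zs"
    then have "ys = replicate (length ys) ()" "length ys \<le> f x"
      by (metis (full_types) length_replicate old.unit.exhaust replicate_eqI, metis le_add1 length_append length_replicate)
    then have "esize (fold (\<lambda>_ w. w @ [length w]) ys []) \<le> f x * f x"
      using eq[of "length ys"] sz[of "length ys"] by (metis mult_le_mono order_trans)
    also have "\<dots> \<le> poly (q * q) (esize x)" using q[of x] by (simp add: mult_le_mono)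
    finally show "esize (fold (\<lambda>_ w. w @ [length w]) ys []) \<le> poly (q * q) (esize x)" .
  qed (intro assms pt_units pt_const pt_basic pt_append pt_length)+
  then show ?thesis unfolding eq .
qed

definition nub :: "'b list \<Rightarrow> 'b list" where
  "nub l = fold List.insert l []"

lemma pt_nub:
  fixes l :: "'a::enc \<Rightarrow> 'b::enc list"
  assumes "pt l"
  shows "pt (\<lambda>x. nub (l x))"
proof -
  obtain q where q: "\<And>x. esize (l x) \<le> poly q (esize x)" using pt_poly_bound[OF assms] by blast
  show ?thesis
    unfolding nub_def
  proof (rule pt_fold_add[of _ _ _ "q + 1"])
    fix x y and w :: "'b list" assume "y \<in> set (l x)"
    then show "esize (List.insert y w) \<le> esize w + poly (q + 1) (esize x)"
      using q[of x] esize_mem[of y "l x"] by (simp add: List.insert_def)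
  next
    show "pt (\<lambda>z :: 'a \<times> 'b \<times> 'b list. List.insert (fst (snd z)) (snd (snd z)))"
      unfolding List.insert_def by (intro pt_basic pt_mem)
  qed (rule assms pt_const)+
qed

lemma distinct_nub [simp]: "distinct (nub l)" and set_nub [simp]: "set (nub l) = set l"
proof -
  have "distinct w \<Longrightarrow> distinct (fold List.insert l w) \<and> set (fold List.insert l w) = set l \<union> set w" for w
    by (induction l arbitrary: w) auto
  from this[of "[]"] show "distinct (nub l)" "set (nub l) = set l" unfolding nub_def by auto
qed

lemmas pt_rules = pt_basic pt_rev pt_append pt_map pt_filter pt_bex pt_ball pt_mem pt_concat pt_length pt_diff
  pt_le pt_less pt_upt pt_nub

section \<open>Deciding maximality of a matching in polynomial time\<close>

definition dirs :: "('a \<times> 'a) list \<Rightarrow> ('a \<times> 'a) list" where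
  "dirs E = E @ map (\<lambda>e. (snd e, fst e)) E"

text \<open>A comparison with \<open>hd\<close> that avoids its unspecified value on the empty list,
  about which no program could be right.\<close>

definition tip_is :: "'a list \<Rightarrow> 'a \<Rightarrow> bool" where
  "tip_is p x \<longleftrightarrow> (case p of [] \<Rightarrow> False | y # ys \<Rightarrow> y = x)"

definition growths :: "('a \<times> 'a) list \<Rightarrow> ('a \<times> 'a) list \<Rightarrow> 'a list list \<Rightarrow> 'a list list" where
  "growths E M P = concat (map (\<lambda>p. concat (map (\<lambda>e. map (\<lambda>m. snd m # snd e # p)
     (filter (\<lambda>m. fst m = snd e) (dirs M)))
     (filter (\<lambda>e. tip_is p (fst e) \<and> snd e \<notin> set (concat P)) (dirs E)))) P)"

text \<open>Only one growth is used per round, because two growths of the same forest may reach the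
  same vertex.\<close>

definition grow :: "('a \<times> 'a) list \<Rightarrow> ('a \<times> 'a) list \<Rightarrow> 'a list list \<Rightarrow> 'a list list" where
  "grow E M P = (case growths E M P of [] \<Rightarrow> P | q # qs \<Rightarrow> q # P)"

definition roots :: "('a \<times> 'a) list \<Rightarrow> ('a \<times> 'a) list \<Rightarrow> 'a list list" where
  "roots E M = map (\<lambda>v. [v]) (filter (\<lambda>v. v \<notin> set (map fst (dirs M))) (map fst (dirs E)))"

text \<open>M merely serves as a loop counter: each growth touches a matching edge not touched
  before, so the forest is stuck after \<open>length M\<close> rounds.\<close>

definition search :: "('a \<times> 'a) list \<Rightarrow> ('a \<times> 'a) list \<Rightarrow> 'a list list" where
  "search E M = fold (\<lambda>_ P. grow E M P) M (roots E M)"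

definition clashes :: "('a \<times> 'a) list \<Rightarrow> 'a list list \<Rightarrow> ('a list \<times> 'a list) list" where
  "clashes E P = concat (map (\<lambda>p. map (\<lambda>q. (p, q))
     (filter (\<lambda>q. \<exists>e\<in>set (dirs E). tip_is p (fst e) \<and> tip_is q (snd e)) P)) P)"

definition rename :: "'a \<Rightarrow> 'a list \<Rightarrow> ('a \<times> 'a) list \<Rightarrow> ('a \<times> 'a) list" where
  "rename v Bs F = filter (\<lambda>e. fst e \<noteq> snd e)
     (map (\<lambda>e. (if fst e \<in> set Bs then v else fst e, if snd e \<in> set Bs then v else snd e)) F)"

text \<open>The first component of a state is empty or contains the verdict.\<close>

definition blossom_round :: "bool list \<times> ('a \<times> 'a) list \<times> ('a \<times> 'a) list \<Rightarrow> bool list \<times> ('a \<times> 'a) list \<times> ('a \<times> 'a) list" where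
  "blossom_round s = (if fst s \<noteq> [] then s else
     (case clashes (fst (snd s)) (search (fst (snd s)) (snd (snd s))) of
        [] \<Rightarrow> ([False], snd s)
      | c # cs \<Rightarrow> (case filter (\<lambda>x. x \<in> set (snd c)) (fst c) of
          [] \<Rightarrow> ([True], snd s)
        | v # vs \<Rightarrow> ([],
            rename v (filter (\<lambda>x. x \<notin> set (snd c)) (fst c) @ filter (\<lambda>x. x \<notin> set (fst c)) (snd c)) (fst (snd s)),
            rename v (filter (\<lambda>x. x \<notin> set (snd c)) (fst c) @ filter (\<lambda>x. x \<notin> set (fst c)) (snd c)) (snd (snd s))))))"

text \<open>Each contraction removes a matching edge, so after \<open>length M\<close> rounds the
  matching is empty or the verdict is known. The extra round decides the former case.\<close>

definition larger :: "('a \<times> 'a) list \<Rightarrow> ('a \<times> 'a) list \<Rightarrow> bool" where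
  "larger E M \<longleftrightarrow> fst (blossom_round (fold (\<lambda>_ s. blossom_round s) M ([], E, M))) = [True]"

section \<open>Running time of the decision procedure\<close>

lemma pt_dirs0: "pt dirs"
  unfolding dirs_def by (intro pt_rules)
lemmas pt_dirs = pt_comp[OF pt_dirs0]

lemma pt_tip_is0: "pt (\<lambda>z. tip_is (fst z) (snd z))"
  unfolding tip_is_def by (intro pt_rules pt_const)
lemmas pt_tip_is = pt_comp2[OF pt_tip_is0]

lemma pt_growths0: "pt (\<lambda>z. growths (fst z) (fst (snd z)) (snd (snd z)))"
  unfolding growths_def by (intro pt_rules pt_dirs pt_tip_is)
lemmas pt_growths = pt_comp3[OF pt_growths0]

lemma pt_grow0: "pt (\<lambda>z. grow (fst z) (fst (snd z)) (snd (snd z)))"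
  unfolding grow_def by (intro pt_rules pt_growths)
lemmas pt_grow = pt_comp3[OF pt_grow0]

lemma pt_roots0: "pt (\<lambda>z. roots (fst z) (snd z))"
  unfolding roots_def by (intro pt_rules pt_dirs pt_const)
lemmas pt_roots = pt_comp2[OF pt_roots0]

lemma esize_sym_mem: "e \<in> set (dirs F) \<Longrightarrow> esize (fst e) \<le> esize F \<and> esize (snd e) \<le> esize F"
proof -
  assume "e \<in> set (dirs F)"
  then have "(fst e, snd e) \<in> set F \<or> (snd e, fst e) \<in> set F" unfolding dirs_def by auto
  then show ?thesis
  proof
    assume "(fst e, snd e) \<in> set F"
    from esize_mem[OF this] show ?thesis by (cases e) simp
  next
    assume "(snd e, fst e) \<in> set F"
    from esize_mem[OF this] show ?thesis by simp
  qed
qed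

lemma growths_cases:
  assumes "q \<in> set (growths E M P)"
  obtains p e m where "p \<in> set P" "e \<in> set (dirs E)" "m \<in> set (dirs M)" "fst m = snd e" "tip_is p (fst e)"
    "snd e \<notin> set (concat P)" "q = snd m # snd e # p"
  using assms unfolding growths_def by auto

text \<open>Both bounds are needed together: a new path extends an old one, so single paths grow
  linearly and the whole list quadratically. The fixed N makes the increment of the second bound
  independent of the round.\<close>

lemma esize_search_prefix:
  fixes E M :: "('a::enc \<times> 'a) list"
  assumes "n = length ys" "n \<le> N"
  defines "R \<equiv> roots E M" and "P \<equiv> fold (\<lambda>_ P. grow E M P) ys (roots E M)"
  shows "(\<forall>p\<in>set P. esize p \<le> esize R + n * (esize E + esize M + 2)) \<and>
    esize P \<le> esize R + n * (esize R + N * (esize E + esize M + 2) + 1)"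
  using assms(1,2) unfolding P_def
proof (induction ys arbitrary: n rule: rev_induct)
  case Nil
  then show ?case using esize_mem[of _ "roots E M"] unfolding R_def by fastforce
next
  case (snoc y ys)
  let ?P = "fold (\<lambda>_ P. grow E M P) ys (roots E M)"
  let ?k = "esize E + esize M + 2"
  have n: "n = Suc (length ys)" using snoc.prems by simp
  have IH: "\<forall>p\<in>set ?P. esize p \<le> esize R + length ys * ?k"
    "esize ?P \<le> esize R + length ys * (esize R + N * ?k + 1)"
    using snoc.IH[of "length ys"] snoc.prems by auto
  have g: "esize q \<le> esize R + n * ?k" if q: "q \<in> set (growths E M ?P)" for q
  proof -
    obtain p e m where *: "p \<in> set ?P" "e \<in> set (dirs E)" "m \<in> set (dirs M)" "fst m = snd e" "tip_is p (fst e)"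
      "snd e \<notin> set (concat ?P)" "q = snd m # snd e # p"
      using q by (rule growths_cases)
    then have "esize q \<le> ?k + esize p" using esize_sym_mem[OF *(2)] esize_sym_mem[OF *(3)] by simp
    also have "\<dots> \<le> ?k + (esize R + length ys * ?k)" using IH(1) *(1) by simp
    finally show ?thesis unfolding n by simp
  qed
  show ?case
  proof (cases "growths E M ?P")
    case Nil
    then have eq: "fold (\<lambda>_ P. grow E M P) (ys @ [y]) (roots E M) = ?P" by (simp add: grow_def)
    have "length ys * ?k \<le> n * ?k" "length ys * (esize R + N * ?k + 1) \<le> n * (esize R + N * ?k + 1)"
      unfolding n by (intro mult_le_mono1; simp)+
    then show ?thesis unfolding eq using IH by (meson add_left_mono order_trans)
  next
    case (Cons q qs)
    then have eq: "fold (\<lambda>_ P. grow E M P) (ys @ [y]) (roots E M) = q # ?P" by (simp add: grow_def)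
    have q: "esize q \<le> esize R + n * ?k" using g Cons by simp
    also have "\<dots> \<le> esize R + N * ?k" using snoc.prems by (intro add_left_mono mult_le_mono1) simp
    finally have "esize (q # ?P) \<le> esize R + n * (esize R + N * ?k + 1)" using IH(2) unfolding n by simp
    moreover have "length ys * ?k \<le> n * ?k" unfolding n by (intro mult_le_mono1) simp
    then have "\<forall>p\<in>set ?P. esize p \<le> esize R + n * ?k" using IH(1) by (meson add_left_mono order_trans)
    ultimately show ?thesis unfolding eq using q by auto
  qed
qed

lemma pt_search0: "pt (\<lambda>z :: ('a::enc \<times> 'a) list \<times> ('a \<times> 'a) list. search (fst z) (snd z))"
proof -
  obtain q where q: "\<And>z :: ('a \<times> 'a) list \<times> ('a \<times> 'a) list. esize (roots (fst z) (snd z)) \<le> poly q (esize z)"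
    using pt_poly_bound[OF pt_roots0] by blast
  let ?X = "[:0, 1:] :: nat poly"
  show ?thesis
    unfolding search_def
  proof (rule pt_fold[of _ _ _ "q + ?X * (q + ?X * (?X + ?X + 2) + 1)"])
    fix z :: "('a \<times> 'a) list \<times> ('a \<times> 'a) list" and ys zs assume L: "snd z = ys @ zs"
    let ?n = "esize z"
    have len: "length ys \<le> length (snd z)" using L by simp
    have l2: "length (snd z) \<le> ?n" using length_le_esize[of "snd z"] by (cases z) simp
    have EM: "esize (fst z) \<le> ?n" "esize (snd z) \<le> ?n" by (cases z; simp)+
    have "esize (fold (\<lambda>_ P. grow (fst z) (snd z) P) ys (roots (fst z) (snd z)))
        \<le> esize (roots (fst z) (snd z)) + length ys *
          (esize (roots (fst z) (snd z)) + length (snd z) * (esize (fst z) + esize (snd z) + 2) + 1)"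
      using esize_search_prefix[OF refl len, of "fst z" "snd z"] by blast
    also have "\<dots> \<le> poly q ?n + ?n * (poly q ?n + ?n * (?n + ?n + 2) + 1)"
      using q[of z] len l2 EM by (intro add_mono mult_le_mono) simp_all
    finally show "esize (fold (\<lambda>_ P. grow (fst z) (snd z) P) ys (roots (fst z) (snd z)))
        \<le> poly (q + ?X * (q + ?X * (?X + ?X + 2) + 1)) ?n" by simp
  qed (intro pt_rules pt_grow pt_roots)+
qed
lemmas pt_search = pt_comp2[OF pt_search0]

lemma pt_clashes0: "pt (\<lambda>z. clashes (fst z) (snd z))"
  unfolding clashes_def by (intro pt_rules pt_dirs pt_tip_is)
lemmas pt_clashes = pt_comp2[OF pt_clashes0]

lemma pt_rename0: "pt (\<lambda>z. rename (fst z) (fst (snd z)) (snd (snd z)))"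
  unfolding rename_def by (intro pt_rules)
lemmas pt_rename = pt_comp3[OF pt_rename0]

lemma pt_blossom_round0: "pt blossom_round"
  unfolding blossom_round_def by (intro pt_rules pt_const pt_clashes pt_search pt_rename)
lemmas pt_blossom_round = pt_comp[OF pt_blossom_round0]

text \<open>Renaming keeps the number of edges and takes the new vertex names from the old ones.\<close>

definition names_in :: "nat \<Rightarrow> nat \<Rightarrow> ('a::enc \<times> 'a) list \<Rightarrow> bool" where
  "names_in L K F \<longleftrightarrow> length F \<le> L \<and> (\<forall>e\<in>set F. esize (fst e) \<le> K \<and> esize (snd e) \<le> K)"

lemma esize_names_in: "names_in L K F \<Longrightarrow> esize F \<le> L * (2 * K + 2)"
proof -
  assume *: "names_in L K F"
  have "(\<forall>e\<in>set F. esize (fst e) \<le> K \<and> esize (snd e) \<le> K) \<Longrightarrow> esize F \<le> length F * (2 * K + 2)"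
  proof (induction F)
    case (Cons e F) then show ?case by (cases e) auto
  qed simp
  then have "esize F \<le> length F * (2 * K + 2)" using * unfolding names_in_def by blast
  also have "\<dots> \<le> L * (2 * K + 2)" using * unfolding names_in_def by (intro mult_le_mono1) blast
  finally show ?thesis .
qed

lemma names_in_rename:
  assumes "names_in L K F" "esize v \<le> K"
  shows "names_in L K (rename v Bs F)"
proof -
  have "length (rename v Bs F) \<le> length F" unfolding rename_def
    by (rule order_trans[OF length_filter_le]) simp
  moreover have "\<forall>e\<in>set (rename v Bs F). esize (fst e) \<le> K \<and> esize (snd e) \<le> K"
    using assms unfolding names_in_def rename_def by auto
  ultimately show ?thesis using assms(1) unfolding names_in_def by auto
qed

text \<open>The name of a contracted blossom is taken from such a path, so names do not grow from
  one round to the next.\<close>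

lemma search_names:
  assumes "names_in L K E" "names_in L K M" "p \<in> set (search E M)" "x \<in> set p"
  shows "esize x \<le> K"
proof -
  have symK: "esize (fst e) \<le> K \<and> esize (snd e) \<le> K" if "e \<in> set (dirs E) \<or> e \<in> set (dirs M)" for e
    using that assms(1,2) unfolding dirs_def names_in_def by auto
  have grow: "\<forall>p\<in>set (grow E M P). \<forall>x\<in>set p. esize x \<le> K" if P: "\<forall>p\<in>set P. \<forall>x\<in>set p. esize x \<le> K" for P
  proof (cases "growths E M P")
    case (Cons q qs)
    then have "q \<in> set (growths E M P)" by simp
    then obtain p e m where "p \<in> set P" "e \<in> set (dirs E)" "m \<in> set (dirs M)" "q = snd m # snd e # p"
      by (rule growths_cases)
    then have "\<forall>x\<in>set q. esize x \<le> K" using symK P by auto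
    then show ?thesis using P Cons by (simp add: grow_def)
  qed (use P in \<open>simp add: grow_def\<close>)
  have "\<forall>p\<in>set P. \<forall>x\<in>set p. esize x \<le> K \<Longrightarrow> \<forall>p\<in>set (fold (\<lambda>_ P. grow E M P) ys P). \<forall>x\<in>set p. esize x \<le> K" for ys :: "'b list" and P
  proof (induction ys arbitrary: P)
    case (Cons y ys)
    from Cons.IH[OF grow[OF Cons.prems]] show ?case by simp
  qed simp
  moreover have "\<forall>p\<in>set (roots E M). \<forall>x\<in>set p. esize x \<le> K" unfolding roots_def using symK by auto
  ultimately show ?thesis using assms(3,4) unfolding search_def by blast
qed

lemma round_names:
  assumes "names_in L K (fst (snd s))" "names_in L K (snd (snd s))" "length (fst s) \<le> 1"
  shows "names_in L K (fst (snd (blossom_round s))) \<and> names_in L K (snd (snd (blossom_round s))) \<and> length (fst (blossom_round s)) \<le> 1"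
proof (cases "fst s \<noteq> []")
  case True then show ?thesis using assms unfolding blossom_round_def by simp
next
  case False
  show ?thesis
  proof (cases "clashes (fst (snd s)) (search (fst (snd s)) (snd (snd s)))")
    case Nil then show ?thesis using assms False unfolding blossom_round_def by simp
  next
    case (Cons c cs)
    then have "c \<in> set (clashes (fst (snd s)) (search (fst (snd s)) (snd (snd s))))" by simp
    then have c: "fst c \<in> set (search (fst (snd s)) (snd (snd s)))" unfolding clashes_def by auto
    show ?thesis
    proof (cases "filter (\<lambda>x. x \<in> set (snd c)) (fst c)")
      case Nil then show ?thesis using assms False Cons unfolding blossom_round_def by simp
    next
      case C: (Cons v vs)
      then have "v \<in> set (filter (\<lambda>x. x \<in> set (snd c)) (fst c))" by simp
      then have "esize v \<le> K" using search_names[OF assms(1,2) c] by simp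
      then show ?thesis using assms False Cons C names_in_rename unfolding blossom_round_def by auto
    qed
  qed
qed

lemma pt_larger0: "pt (\<lambda>z :: ('a::enc \<times> 'a) list \<times> ('a \<times> 'a) list. larger (fst z) (snd z))"
proof -
  let ?X = "[:0, 1:] :: nat poly"
  have "pt (\<lambda>z :: ('a \<times> 'a) list \<times> ('a \<times> 'a) list. fold (\<lambda>_ s. blossom_round s) (snd z) ([], fst z, snd z))"
  \<comment> \<open>The 4 is two for the pairing of the three components plus two for a verdict list
    of length at most one. Each edge list has at most n entries with names of size at most
    n.\<close>
  proof (rule pt_fold[of _ _ _ "4 + 2 * (?X * (2 * ?X + 2))"])
    fix z :: "('a \<times> 'a) list \<times> ('a \<times> 'a) list" and ys zs :: "('a \<times> 'a) list"
    let ?n = "esize z"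
    have nm: "names_in ?n ?n F" if "esize F \<le> ?n" for F :: "('a \<times> 'a) list"
    proof -
      have "esize (fst e) \<le> ?n \<and> esize (snd e) \<le> ?n" if "e \<in> set F" for e
        using esize_mem[OF that] \<open>esize F \<le> ?n\<close> by (cases e) auto
      then show ?thesis unfolding names_in_def using length_le_esize[of F] that by auto
    qed
    have inv: "names_in ?n ?n (fst (snd s)) \<and> names_in ?n ?n (snd (snd s)) \<and> length (fst s) \<le> 1 \<Longrightarrow>
      names_in ?n ?n (fst (snd (fold (\<lambda>_ s. blossom_round s) ys s))) \<and> names_in ?n ?n (snd (snd (fold (\<lambda>_ s. blossom_round s) ys s)))
      \<and> length (fst (fold (\<lambda>_ s. blossom_round s) ys s)) \<le> 1" for s :: "bool list \<times> ('a \<times> 'a) list \<times> ('a \<times> 'a) list"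
    proof (induction ys arbitrary: s)
      case (Cons y ys)
      have "names_in ?n ?n (fst (snd (blossom_round s))) \<and> names_in ?n ?n (snd (snd (blossom_round s)))
          \<and> length (fst (blossom_round s)) \<le> 1"
        by (rule round_names) (use Cons.prems in auto)
      from Cons.IH[OF this] show ?case by simp
    qed simp
    let ?s = "fold (\<lambda>_ s. blossom_round s) ys ([], fst z, snd z)"
    have "esize (fst z) \<le> ?n" "esize (snd z) \<le> ?n" by (cases z; simp)+
    then have i: "names_in ?n ?n (fst (snd ?s))" "names_in ?n ?n (snd (snd ?s))" "length (fst ?s) \<le> 1"
      using inv[of "([], fst z, snd z)"] nm by auto
    have "esize (fst ?s) \<le> 2" using i(3) by (cases "fst ?s"; cases "hd (fst ?s)") auto
    moreover have "esize ?s = 2 + esize (fst ?s) + esize (fst (snd ?s)) + esize (snd (snd ?s))"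
      by (simp add: enc_prod_def)
    ultimately show "esize ?s \<le> poly (4 + 2 * (?X * (2 * ?X + 2))) ?n"
      using esize_names_in[OF i(1)] esize_names_in[OF i(2)] by (simp add: algebra_simps)
  qed (intro pt_rules pt_const pt_blossom_round)+
  then show ?thesis unfolding larger_def by (intro pt_rules pt_blossom_round pt_const)
qed
lemmas pt_larger = pt_comp2[OF pt_larger0]

definition ed :: "('a \<times> 'a) list \<Rightarrow> 'a set set" where
  "ed F = (\<lambda>e. {fst e, snd e}) ` set F"

definition loopless :: "('a \<times> 'a) list \<Rightarrow> bool" where
  "loopless F \<longleftrightarrow> (\<forall>e\<in>set F. fst e \<noteq> snd e)"

definition good :: "('a \<times> 'a) list \<Rightarrow> ('a \<times> 'a) list \<Rightarrow> bool" where
  "good E M \<longleftrightarrow> loopless E \<and> loopless M \<and> ed M \<subseteq> ed E \<and> matching (ed M)"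

definition has_larger :: "'a set set \<Rightarrow> 'a set set \<Rightarrow> bool" where
  "has_larger E M \<longleftrightarrow> (\<exists>N. matching N \<and> N \<subseteq> E \<and> card M < card N)"

section \<open>Correctness of the decision procedure\<close>

lemma finite_ed [simp]: "finite (ed F)"
  unfolding ed_def by simp

lemma card_ed_le: "card (ed F) \<le> length F"
proof -
  have "card (ed F) \<le> card (set F)" unfolding ed_def by (rule card_image_le) simp
  also have "\<dots> \<le> length F" by (rule card_length)
  finally show ?thesis .
qed

lemma mem_dirs: "(x, y) \<in> set (dirs F) \<longleftrightarrow> {x, y} \<in> ed F"
  unfolding dirs_def ed_def by (force simp: doubleton_eq_iff image_iff)

lemma mem_dirs': "e \<in> set (dirs F) \<longleftrightarrow> {fst e, snd e} \<in> ed F"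
  using mem_dirs[of "fst e" "snd e"] by simp

lemma loopless_card: "loopless F \<Longrightarrow> e \<in> ed F \<Longrightarrow> card e = 2"
  unfolding loopless_def ed_def by auto

lemma fst_dirs: "set (map fst (dirs F)) = \<Union>(ed F)"
  unfolding dirs_def ed_def by force

lemma tip_is_iff: "tip_is p x \<longleftrightarrow> p \<noteq> [] \<and> hd p = x"
  unfolding tip_is_def by (cases p) auto

lemma roots_iff: "p \<in> set (roots E M) \<longleftrightarrow> (\<exists>v. p = [v] \<and> v \<in> \<Union>(ed E) \<and> v \<notin> \<Union>(ed M))"
  unfolding roots_def using fst_dirs[of E] fst_dirs[of M] by auto

lemma growths_iff:
  "q \<in> set (growths E M P) \<longleftrightarrow> (\<exists>p\<in>set P. \<exists>s t. p \<noteq> [] \<and> {hd p, s} \<in> ed E \<and> {s, t} \<in> ed M \<and>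
     (\<forall>p'\<in>set P. s \<notin> set p') \<and> q = t # s # p)" (is "?L \<longleftrightarrow> ?R")
proof
  assume ?L
  then obtain p e m where *: "p \<in> set P" "e \<in> set (dirs E)" "m \<in> set (dirs M)" "fst m = snd e" "tip_is p (fst e)"
    "snd e \<notin> set (concat P)" "q = snd m # snd e # p" by (rule growths_cases)
  then show ?R
    by (intro bexI[of _ p] exI[of _ "snd e"] exI[of _ "snd m"]) (auto simp: tip_is_iff mem_dirs')
next
  assume ?R
  then obtain p s t where *: "p \<in> set P" "p \<noteq> []" "{hd p, s} \<in> ed E" "{s, t} \<in> ed M"
    "\<forall>p'\<in>set P. s \<notin> set p'" "q = t # s # p" by blast
  have 1: "(hd p, s) \<in> set (dirs E)" "(s, t) \<in> set (dirs M)" using * by (simp_all add: mem_dirs)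
  have cm: "z \<in> set (concat (map f ys))" if "y \<in> set ys" "z \<in> set (f y)" for z y ys and f :: "'y \<Rightarrow> 'z list"
    using that by auto
  have 2: "(hd p, s) \<in> set (filter (\<lambda>e. tip_is p (fst e) \<and> snd e \<notin> set (concat P)) (dirs E))"
    using 1 * by (simp add: tip_is_iff)
  have 3: "q \<in> set (map (\<lambda>m. snd m # snd (hd p, s) # p) (filter (\<lambda>m. fst m = snd (hd p, s)) (dirs M)))"
    unfolding set_map using 1(2) *(6) by (intro image_eqI[of _ _ "(s, t)"]) simp_all
  let ?g = "\<lambda>p e. map (\<lambda>m. snd m # snd e # p) (filter (\<lambda>m. fst m = snd e) (dirs M))"
  let ?h = "\<lambda>p. concat (map (?g p) (filter (\<lambda>e. tip_is p (fst e) \<and> snd e \<notin> set (concat P)) (dirs E)))"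
  show ?L unfolding growths_def by (rule cm[OF *(1), of q ?h, OF cm[OF 2, of q "?g p", OF 3]])
qed

text \<open>As long as the search is not stuck, the number of matching edges touched by the forest
  is at least the number of rounds.\<close>

lemma search_prefix:
  assumes "good E M"
  defines "P ys \<equiv> fold (\<lambda>_ P. grow E M P) ys (roots E M)"
  shows "forest (ed E) (ed M) (set (P ys)) \<and> set (roots E M) \<subseteq> set (P ys) \<and>
    (growths E M (P ys) = [] \<or> length ys \<le> card {m\<in>ed M. m \<inter> (\<Union>p\<in>set (P ys). set p) \<noteq> {}})"
proof (induction ys rule: rev_induct)
  case Nil
  have "forest (ed E) (ed M) (set (roots E M))"
    unfolding forest_def
  proof (intro conjI ballI allI impI)
    fix p assume "p \<in> set (roots E M)"
    then obtain v where "p = [v]" "v \<in> \<Union>(ed E)" "v \<notin> \<Union>(ed M)" unfolding roots_iff by (elim exE conjE)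
    then show "alt (ed E) (ed M) p" by (simp add: alt_single_iff)
  next
    fix t s p assume "t # s # p \<in> set (roots E M)"
    then show "p \<in> set (roots E M)" unfolding roots_iff by simp
  next
    fix p q a b c d v
    assume "p \<in> set (roots E M)" "q \<in> set (roots E M)" "p = a @ v # b" "q = c @ v # d"
    then have "length (a @ v # b) = 1" "length (c @ v # d) = 1" unfolding roots_iff by (metis length_Cons list.size(3) One_nat_def)+
    then show "b = d" by simp
  qed
  then show ?case unfolding P_def by simp
next
  case (snoc y ys)
  have P: "P (ys @ [y]) = grow E M (P ys)" unfolding P_def by simp
  show ?case
  proof (cases "growths E M (P ys)")
    case Nil
    then have "grow E M (P ys) = P ys" by (simp add: grow_def)
    then show ?thesis using snoc Nil P by simp
  next
    case (Cons q qs)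
    then have q: "P (ys @ [y]) = q # P ys" unfolding P by (simp add: grow_def)
    have "q \<in> set (growths E M (P ys))" using Cons by simp
    then obtain p s t where *: "p \<in> set (P ys)" "{hd p, s} \<in> ed E" "{s, t} \<in> ed M"
      "\<And>p'. p' \<in> set (P ys) \<Longrightarrow> s \<notin> set p'" "q = t # s # p" unfolding growths_iff by blast
    have m: "matching (ed M)" using assms unfolding good_def by blast
    note fg = forest_grow[OF conjunct1[OF snoc] *(1,2,3) m *(4)]
    let ?C = "\<lambda>P. {m\<in>ed M. m \<inter> (\<Union>p\<in>set P. set p) \<noteq> {}}"
    have "{s, t} \<inter> (\<Union>p\<in>set (P ys). set p) = {}" using *(4) fg(2) by blast
    then have new: "{s, t} \<notin> ?C (P ys)" by simp
    have "insert {s, t} (?C (P ys)) \<subseteq> ?C (q # P ys)" using *(3,5) by auto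
    then have "card (insert {s, t} (?C (P ys))) \<le> card (?C (q # P ys))" by (intro card_mono) simp_all
    moreover have "card (insert {s, t} (?C (P ys))) = Suc (card (?C (P ys)))" using new by (intro card_insert_disjoint) simp_all
    moreover have "length ys \<le> card (?C (P ys))" using snoc Cons by simp
    ultimately have "length (ys @ [y]) \<le> card (?C (q # P ys))" by simp
    moreover have "forest (ed E) (ed M) (set (q # P ys))" using fg(1) *(5) by simp
    moreover have "set (roots E M) \<subseteq> set (q # P ys)" using snoc by auto
    ultimately show ?thesis unfolding q by blast
  qed
qed

text \<open>If a growth were still possible after \<open>length M\<close> rounds, all matching edges
  would be touched; but a growth uses an untouched one.\<close>

lemma search_spec:
  assumes "good E M"
  shows "forest (ed E) (ed M) (set (search E M))" "set (roots E M) \<subseteq> set (search E M)"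
    "growths E M (search E M) = []"
proof -
  let ?P = "search E M" and ?C = "{m\<in>ed M. m \<inter> (\<Union>p\<in>set (search E M). set p) \<noteq> {}}"
  have *: "forest (ed E) (ed M) (set ?P)" "set (roots E M) \<subseteq> set ?P" "growths E M ?P = [] \<or> length M \<le> card ?C"
    using search_prefix[OF assms, of M] unfolding search_def by blast+
  show "forest (ed E) (ed M) (set ?P)" "set (roots E M) \<subseteq> set ?P" using * by blast+
  show "growths E M ?P = []"
  proof (rule ccontr)
    assume n: "growths E M ?P \<noteq> []"
    then have "length M \<le> card ?C" using * by blast
    moreover have "card (ed M) \<le> length M" by (rule card_ed_le)
    ultimately have "?C = ed M" by (intro card_seteq) auto
    obtain q where "q \<in> set (growths E M ?P)" using n by (cases "growths E M ?P") auto
    then obtain p s t where g: "p \<in> set ?P" "{hd p, s} \<in> ed E" "{s, t} \<in> ed M"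
      "\<And>p'. p' \<in> set ?P \<Longrightarrow> s \<notin> set p'" unfolding growths_iff by blast
    have m: "matching (ed M)" using assms unfolding good_def by blast
    have "t \<notin> set q" if "q \<in> set ?P" for q using forest_grow(2)[OF *(1) g(1,2,3) m g(4) that] .
    then have "{s, t} \<inter> (\<Union>p\<in>set ?P. set p) = {}" using g(4) by simp
    moreover have "{s, t} \<in> ?C" using \<open>?C = ed M\<close> g(3) by simp
    ultimately show False by simp
  qed
qed

lemma clashes_iff:
  "c \<in> set (clashes E P) \<longleftrightarrow> fst c \<in> set P \<and> snd c \<in> set P \<and> fst c \<noteq> [] \<and> snd c \<noteq> [] \<and> {hd (fst c), hd (snd c)} \<in> ed E"
proof -
  have "(\<exists>e\<in>set (dirs E). tip_is p (fst e) \<and> tip_is q (snd e)) \<longleftrightarrow> p \<noteq> [] \<and> q \<noteq> [] \<and> {hd p, hd q} \<in> ed E" for p q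
  proof
    assume "p \<noteq> [] \<and> q \<noteq> [] \<and> {hd p, hd q} \<in> ed E"
    then show "\<exists>e\<in>set (dirs E). tip_is p (fst e) \<and> tip_is q (snd e)"
      by (intro bexI[of _ "(hd p, hd q)"]) (auto simp: tip_is_iff mem_dirs)
  qed (auto simp: tip_is_iff mem_dirs')
  then show ?thesis unfolding clashes_def by (cases c) auto
qed

text \<open>This identifies \<open>rename\<close> with contraction: an edge becomes a loop and is
  dropped exactly if both its ends lie in the blossom.\<close>

lemma ed_rename:
  assumes "loopless F" "v \<notin> set Bs"
  shows "ed (rename v Bs F) = {(\<lambda>x. if x \<in> insert v (set Bs) then v else x) ` e | e. e \<in> ed F \<and> \<not> e \<subseteq> insert v (set Bs)}"
    "loopless (rename v Bs F)"
proof -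
  let ?r = "\<lambda>x. if x \<in> insert v (set Bs) then v else x"
  have r: "(if x \<in> set Bs then v else x) = ?r x" for x by auto
  have eq: "?r x = ?r y \<longleftrightarrow> x = y \<or> {x, y} \<subseteq> insert v (set Bs)" for x y by auto
  show "loopless (rename v Bs F)" unfolding loopless_def rename_def by auto
  show "ed (rename v Bs F) = {?r ` e | e. e \<in> ed F \<and> \<not> e \<subseteq> insert v (set Bs)}" (is "_ = ?R")
  proof (intro set_eqI iffI)
    fix X assume "X \<in> ed (rename v Bs F)"
    then obtain e where e: "e \<in> set F" "?r (fst e) \<noteq> ?r (snd e)" "X = {?r (fst e), ?r (snd e)}"
      unfolding ed_def rename_def r set_filter set_map by auto
    have "{fst e, snd e} \<in> ed F" unfolding ed_def using e(1) by (rule imageI)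
    moreover have "\<not> {fst e, snd e} \<subseteq> insert v (set Bs)" using e(2) by (metis eq)
    moreover have "X = ?r ` {fst e, snd e}" using e(3) by simp
    ultimately show "X \<in> ?R" by (intro CollectI exI[of _ "{fst e, snd e}"] conjI)
  next
    fix X assume "X \<in> ?R"
    then obtain e where e: "e \<in> set F" "\<not> {fst e, snd e} \<subseteq> insert v (set Bs)" "X = ?r ` {fst e, snd e}"
      unfolding ed_def by (elim CollectE exE conjE imageE) simp
    have "?r (fst e) \<noteq> ?r (snd e)" using e(1,2) assms(1) unfolding loopless_def eq by simp
    then have "(?r (fst e), ?r (snd e)) \<in> set (rename v Bs F)" using e(1) unfolding rename_def r by simp
    from imageI[OF this, of "\<lambda>e. {fst e, snd e}"] have "{?r (fst e), ?r (snd e)} \<in> ed (rename v Bs F)"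
      unfolding ed_def fst_conv snd_conv .
    then show "X \<in> ed (rename v Bs F)" unfolding e(3) image_insert image_empty .
  qed
qed

text \<open>The forest property makes both paths continue equally from their first common vertex v,
  so filtering out the other path returns the two branches. Path lengths are odd, hence the branches
  have equal parity. Odd branches would both end in the mate of v, contradicting
  disjointness.\<close>

lemma forest_clash_split:
  assumes M: "matching M" and F: "forest E M P" and pq: "p \<in> P" "q \<in> P" and v: "filter (\<lambda>x. x \<in> set q) p = v # vs"
  obtains a b c where "p = a @ v # b" "q = c @ v # b" "filter (\<lambda>x. x \<notin> set q) p = a"
    "filter (\<lambda>x. x \<notin> set p) q = c" "set a \<inter> set c = {}" "even (length a)" "even (length c)"
proof -
  obtain a b where p: "p = a @ v # b" "\<forall>u\<in>set a. u \<notin> set q" "v \<in> set q"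
    using v by (auto simp: filter_eq_Cons_iff)
  obtain c d where q: "q = c @ v # d" using p(3) by (meson split_list)
  have bd: "b = d" using forest_unique[OF F pq p(1) q] .
  have ap: "alt E M p" and aq: "alt E M q" using forest_alt[OF F] pq by blast+
  have dp: "distinct p" and dq: "distinct q" using alt_distinct[OF ap] alt_distinct[OF aq] .
  have cp: "w \<notin> set p" if w: "w \<in> set c" for w
  proof
    assume "w \<in> set p"
    then obtain x y where xy: "p = x @ w # y" by (meson split_list)
    obtain c1 c2 where c: "c = c1 @ w # c2" using w by (meson split_list)
    have "y = c2 @ v # b" using forest_unique[OF F pq xy, of c1 "c2 @ v # b"] q c bd by simp
    then have e: "x @ w # c2 @ v # b = a @ v # b" using xy p(1) by simp
    have "w \<in> set a"
    proof (rule ccontr)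
      assume "w \<notin> set a"
      then have "w = v \<or> w \<in> set b" using \<open>w \<in> set p\<close> p(1) by auto
      then show False using dq q bd w by auto
    qed
    then show False using p(2) q c by auto
  qed
  have fa: "filter (\<lambda>x. x \<notin> set q) p = a"
    using p q bd by (auto simp: filter_empty_conv intro: filter_True)
  have fc: "filter (\<lambda>x. x \<notin> set p) q = c"
    using p(1) q bd cp by (auto simp: filter_empty_conv intro: filter_True)
  have disj: "set a \<inter> set c = {}" using p(2) q by auto
  have par: "even (length a) \<longleftrightarrow> even (length c)"
    using alt_odd[OF ap] alt_odd[OF aq] p(1) q bd by simp
  have ev: "even (length a)"
  proof (rule ccontr)
    assume o: "odd (length a)"
    then have oc: "odd (length c)" using par by simp
    have "{v, last a} \<in> M" "{v, last c} \<in> M"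
      using alt_odd_position[OF o] alt_odd_position[OF oc] ap aq p(1) q by blast+
    moreover have "a \<noteq> []" "c \<noteq> []" using o oc by auto
    then have "last a \<in> set a" "last c \<in> set c" by auto
    moreover have "last a = last c"
      using matching_unique[OF M calculation(1,2), of v] by (auto simp: doubleton_eq_iff)
    ultimately show False using disj by auto
  qed
  show ?thesis using that[of a b c] p(1) q bd fa fc disj ev par by simp
qed

text \<open>Without adjacent tips the stuck forest proves maximality; adjacent tips of disjoint
  paths give a larger matching; otherwise there is a blossom, whose contraction preserves the answer
  and shrinks the matching.\<close>

lemma round_spec:
  assumes g: "good E M"
  shows "fst (blossom_round ([], E, M)) = [has_larger (ed E) (ed M)] \<or>
    (\<exists>E' M'. blossom_round ([], E, M) = ([], E', M') \<and> good E' M' \<and>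
      (has_larger (ed E') (ed M') \<longleftrightarrow> has_larger (ed E) (ed M)) \<and> card (ed M') < card (ed M))"
proof -
  let ?P = "search E M"
  note S = search_spec[OF g]
  have m: "matching (ed M)" "finite (ed M)" "ed M \<subseteq> ed E" using g unfolding good_def by auto
  have E2: "card e = 2" if "e \<in> ed E" for e using g loopless_card that unfolding good_def by blast
  have ne: "p \<noteq> []" if "p \<in> set ?P" for p using alt_nonempty[OF forest_alt[OF S(1) that]] .
  show ?thesis
  proof (cases "clashes E ?P")
    case Nil
    have "card N \<le> card (ed M)" if N: "matching N" "N \<subseteq> ed E" for N
    proof (rule stuck_forest_maximum[OF m S(1) _ _ _ N])
      fix r e assume "e \<in> ed E" "r \<in> e" "r \<notin> \<Union>(ed M)"
      then have "[r] \<in> set (roots E M)" unfolding roots_iff by blast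
      then show "[r] \<in> set ?P" using S(2) by blast
    next
      fix p s t assume pst: "p \<in> set ?P" "{hd p, s} \<in> ed E" "{s, t} \<in> ed M"
      show "\<exists>q\<in>set ?P. s \<in> set q"
      proof (rule ccontr)
        assume "\<not> (\<exists>q\<in>set ?P. s \<in> set q)"
        then have "t # s # p \<in> set (growths E M ?P)" unfolding growths_iff using pst ne[OF pst(1)] by blast
        then show False using S(3) by simp
      qed
    next
      fix p q assume pq: "p \<in> set ?P" "q \<in> set ?P"
      show "{hd p, hd q} \<notin> ed E"
      proof
        assume "{hd p, hd q} \<in> ed E"
        then have "(p, q) \<in> set (clashes E ?P)" unfolding clashes_iff using pq ne by simp
        then show False using Nil by simp
      qed
    qed
    then have "\<not> has_larger (ed E) (ed M)" unfolding has_larger_def by (meson not_le)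
    then show ?thesis unfolding blossom_round_def using Nil by simp
  next
    case (Cons c cs)
    then have "c \<in> set (clashes E ?P)" by simp
    then have c: "fst c \<in> set ?P" "snd c \<in> set ?P" "{hd (fst c), hd (snd c)} \<in> ed E" unfolding clashes_iff by blast+
    show ?thesis
    proof (cases "filter (\<lambda>x. x \<in> set (snd c)) (fst c)")
      case Nil
      then have "set (fst c) \<inter> set (snd c) = {}" by (auto simp: filter_empty_conv)
      then have "has_larger (ed E) (ed M)" unfolding has_larger_def
        using augment_two_alt[OF m forest_alt[OF S(1) c(1)] forest_alt[OF S(1) c(2)] _ c(3)] by blast
      then show ?thesis unfolding blossom_round_def using Cons Nil by simp
    next
      case C: (Cons v vs)
      obtain a b d where s: "fst c = a @ v # b" "snd c = d @ v # b" "filter (\<lambda>x. x \<notin> set (snd c)) (fst c) = a"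
        "filter (\<lambda>x. x \<notin> set (fst c)) (snd c) = d" "set a \<inter> set d = {}" "even (length a)" "even (length d)"
        using forest_clash_split[OF m(1) S(1) c(1,2) C] .
      have hd: "hd (fst c) = hd (a @ [v])" "hd (snd c) = hd (d @ [v])" using s by (cases a; cases d; simp)+
      interpret blossom "ed E" "ed M" a d b v
      proof
        show "alt (ed E) (ed M) (a @ v # b)" "alt (ed E) (ed M) (d @ v # b)"
          using forest_alt[OF S(1) c(1)] forest_alt[OF S(1) c(2)] s by simp_all
        show "{hd (a @ [v]), hd (d @ [v])} \<in> ed E" using c(3) hd by simp
      qed (use E2 m s in auto)
      let ?E = "rename v (a @ d) E" and ?M = "rename v (a @ d) M"
      have vB: "v \<notin> set (a @ d)" using dist by simp
      have BB: "insert v (set (a @ d)) = B" unfolding B_def by auto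
      have con: "ed (rename v (a @ d) F) = contract (ed F)" if "loopless F" for F
        using ed_rename(1)[OF that vB] unfolding BB contract_def \<rho>_def .
      have lo: "loopless E" "loopless M" using g unfolding good_def by auto
      have g': "good ?E ?M"
        unfolding good_def con[OF lo(1)] con[OF lo(2)] using matching_contract_M ed_rename(2)[OF _ vB] lo by simp
      have "has_larger (ed ?E) (ed ?M) \<longleftrightarrow> has_larger (ed E) (ed M)"
        unfolding con[OF lo(1)] con[OF lo(2)] has_larger_def using expand_larger contract_larger by blast
      moreover have "card (ed ?M) < card (ed M)"
      proof -
        \<comment> \<open>Adjacent tips are distinct, so the blossom has a vertex besides its base
          and hence contains an edge of M.\<close>
        have "hd (a @ [v]) \<noteq> hd (d @ [v])" using E2[OF edge] by auto
        then have "a \<noteq> [] \<or> d \<noteq> []" by auto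
        then obtain x where "x \<in> set a \<union> set d" by (metis Un_iff ex_in_conv set_empty)
        then have "{x, v} \<subseteq> B" "x \<noteq> v" using dist unfolding B_def by auto
        then have "2 \<le> card B" using card_mono[OF finite_B, of "{x, v}"] by simp
        then show ?thesis using card_MB card_contract_M con[OF lo(2)] by simp
      qed
      moreover have "blossom_round ([], E, M) = ([], ?E, ?M)"
        unfolding blossom_round_def using Cons C s(3,4) by simp
      ultimately show ?thesis using g' by blast
    qed
  qed
qed

lemma rounds_spec:
  assumes "good E M"
  shows "fst (fold (\<lambda>_ s. blossom_round s) ys ([], E, M)) = [has_larger (ed E) (ed M)] \<or>
    (\<exists>E' M'. fold (\<lambda>_ s. blossom_round s) ys ([], E, M) = ([], E', M') \<and> good E' M' \<and>
      (has_larger (ed E') (ed M') \<longleftrightarrow> has_larger (ed E) (ed M)) \<and> card (ed M') + length ys \<le> card (ed M))"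
proof (induction ys rule: rev_induct)
  case (snoc y ys)
  let ?s = "fold (\<lambda>_ s. blossom_round s) ys ([], E, M)"
  from snoc show ?case
  proof
    assume "fst ?s = [has_larger (ed E) (ed M)]"
    then show ?thesis by (simp add: blossom_round_def)
  next
    assume "\<exists>E' M'. ?s = ([], E', M') \<and> good E' M' \<and>
      (has_larger (ed E') (ed M') \<longleftrightarrow> has_larger (ed E) (ed M)) \<and> card (ed M') + length ys \<le> card (ed M)"
    then obtain E' M' where s: "?s = ([], E', M')" "good E' M'"
      "has_larger (ed E') (ed M') \<longleftrightarrow> has_larger (ed E) (ed M)" "card (ed M') + length ys \<le> card (ed M)" by blast
    from round_spec[OF s(2)] show ?thesis
    proof
      assume "fst (blossom_round ([], E', M')) = [has_larger (ed E') (ed M')]"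
      then show ?thesis using s by simp
    next
      assume "\<exists>E'' M''. blossom_round ([], E', M') = ([], E'', M'') \<and> good E'' M'' \<and>
        (has_larger (ed E'') (ed M'') \<longleftrightarrow> has_larger (ed E') (ed M')) \<and> card (ed M'') < card (ed M')"
      then show ?thesis using s by auto
    qed
  qed
qed (use assms in simp)

text \<open>If no verdict was reached in \<open>length M\<close> rounds, the matching is empty; the
  last round cannot shrink it further and has to decide.\<close>

theorem larger_iff:
  assumes "good E M"
  shows "larger E M \<longleftrightarrow> has_larger (ed E) (ed M)"
proof -
  let ?s = "fold (\<lambda>_ s. blossom_round s) M ([], E, M)"
  have len: "card (ed M) \<le> length M" by (rule card_ed_le)
  have "fst (blossom_round ?s) = [has_larger (ed E) (ed M)]"
    using rounds_spec[OF assms, of M]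
  proof
    assume "fst ?s = [has_larger (ed E) (ed M)]"
    then show ?thesis by (simp add: blossom_round_def)
  next
    assume "\<exists>E' M'. ?s = ([], E', M') \<and> good E' M' \<and>
      (has_larger (ed E') (ed M') \<longleftrightarrow> has_larger (ed E) (ed M)) \<and> card (ed M') + length M \<le> card (ed M)"
    then obtain E' M' where s: "?s = ([], E', M')" "good E' M'"
      "has_larger (ed E') (ed M') \<longleftrightarrow> has_larger (ed E) (ed M)" "card (ed M') + length M \<le> card (ed M)" by blast
    then have "card (ed M') = 0" using len by linarith
    then show ?thesis using round_spec[OF s(2)] s by auto
  qed
  then show ?thesis unfolding larger_def by simp
qed

section \<open>The local search on lists\<close>

definition meets :: "'c \<times> 'a list \<Rightarrow> 'c \<times> 'a list \<Rightarrow> bool" where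
  "meets e f \<longleftrightarrow> (\<exists>a\<in>set (snd e). a \<in> set (snd f))"

definition next_to :: "'c \<times> 'a list \<Rightarrow> 'c \<times> 'a list \<Rightarrow> bool" where
  "next_to e f \<longleftrightarrow> fst e \<noteq> fst f \<and> meets e f"

definition claw_swap :: "('c \<times> 'a list) list \<Rightarrow> ('c \<times> 'a list) list \<Rightarrow> ('c \<times> 'a list) list" where
  "claw_swap A T = nub (filter (\<lambda>e. \<not> (\<exists>t\<in>set T. next_to e t)) (A @ T))"

text \<open>The sum of the squares of the list lengths, that is the potential \<open>w2plus\<close>,
  obtained as the length of a list so that no arithmetic has to be programmed.\<close>

definition val :: "('c \<times> 'a list) list \<Rightarrow> nat" where
  "val A = length (concat (map (\<lambda>e. concat (map (\<lambda>_. snd e) (snd e))) A))"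

text \<open>Entries may repeat, so triples represent all sets of one to three talons.\<close>

definition triples :: "'b list \<Rightarrow> 'b list list" where
  "triples xs = concat (map (\<lambda>x. concat (map (\<lambda>y. map (\<lambda>z. [x, y, z]) xs) xs)) xs)"

definition is_claw :: "('c \<times> 'a list) list \<Rightarrow> ('c \<times> 'a list) list \<Rightarrow> bool" where
  "is_claw fam T \<longleftrightarrow> (\<forall>x\<in>set T. \<forall>y\<in>set T. \<not> next_to x y) \<and>
     ((\<forall>x\<in>set T. \<forall>y\<in>set T. fst x = fst y) \<or> (\<exists>z\<in>set fam. \<forall>t\<in>set T. next_to z t))"

definition improving :: "('c \<times> 'a list) list \<Rightarrow> ('c \<times> 'a list) list \<Rightarrow> ('c \<times> 'a list) list list" where
  "improving fam A = filter (\<lambda>T. is_claw fam T \<and> val A < val (claw_swap A T)) (triples fam)"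

definition pairs :: "('c \<times> 'a list) list \<Rightarrow> ('c \<times> 'a list) list" where
  "pairs A = filter (\<lambda>e. length (snd e) = 2) A"

definition H_list :: "('c \<times> 'a list) list \<Rightarrow> ('c \<times> 'a list) list \<Rightarrow> ('c \<times> 'a list) list" where
  "H_list fam A = filter (\<lambda>e. \<forall>f\<in>set A. length (snd f) = 3 \<longrightarrow> \<not> meets e f) (pairs fam)"

definition edges :: "('c \<times> 'a list) list \<Rightarrow> ('a \<times> 'a) list" where
  "edges A = concat (map (\<lambda>e. case snd e of [] \<Rightarrow> [] | x # xs \<Rightarrow> (case xs of [] \<Rightarrow> [] | y # ys \<Rightarrow> [(x, y)])) A)"

text \<open>K contains the allowed non-matching edges. The matching is added on the left because the
  decision procedure expects it to be part of the graph.\<close>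

definition augmentable :: "('c \<times> 'a list) list \<Rightarrow> ('c \<times> 'a list) list \<Rightarrow> bool" where
  "augmentable A K \<longleftrightarrow> larger (edges (K @ pairs A)) (edges (pairs A))"

definition prune :: "('c \<times> 'a list) list \<Rightarrow> ('c \<times> 'a list) list \<Rightarrow> ('c \<times> 'a list) list" where
  "prune A L = fold (\<lambda>y K. if augmentable A (filter (\<lambda>e. e \<noteq> y) K) then filter (\<lambda>e. e \<noteq> y) K else K) L L"

text \<open>
  An inclusion-minimal set of edges that still permits augmentation consists of the non-matching
  edges of an augmenting path. So a procedure that decides maximality suffices to augment.
\<close>

definition augment :: "('c \<times> 'a list) list \<Rightarrow> ('c \<times> 'a list) list \<Rightarrow> ('c \<times> 'a list) list" where
  "augment fam A = (if augmentable A (H_list fam A)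
     then nub (filter (\<lambda>e. \<not> (\<exists>f\<in>set (prune A (H_list fam A)). meets e f)) A @ prune A (H_list fam A))
     else A)"

definition improve :: "('c \<times> 'a list) list \<Rightarrow> ('c \<times> 'a list) list \<Rightarrow> ('c \<times> 'a list) list" where
  "improve fam A = (case improving fam A of [] \<Rightarrow> augment fam A | T # Ts \<Rightarrow> claw_swap A T)"

text \<open>With the next lemma this shows that the matching edges on the path are exactly those
  that meet its new edges. So the members to be removed can be found without knowing the
  path.\<close>

lemma aug_path_matching_edge:
  "aug_path E M xs \<Longrightarrow> e \<in> path_edges xs \<Longrightarrow> e \<in> M \<Longrightarrow> \<exists>f\<in>path_edges xs - M. e \<inter> f \<noteq> {}"
proof (induction rule: aug_path.induct)
  case (step M y z zs x)
  have x: "{x, y} \<notin> M" using step.hyps by blast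
  consider "e = {x, y}" | "e = {y, z}" | "e \<in> path_edges (z # zs)" using step.prems(1) by auto
  then show ?case
  proof cases
    case 1 then show ?thesis using x step.prems by blast
  next
    case 2 then show ?thesis using x by (intro bexI[of _ "{x, y}"]) auto
  next
    case 3
    have ne: "f \<noteq> {y, z}" if "f \<in> path_edges (z # zs)" for f using path_edges_vertices[OF that] step.hyps by auto
    then obtain f where "f \<in> path_edges (z # zs)" "f \<notin> M - {{y, z}}" "e \<inter> f \<noteq> {}"
      using step.IH 3 step.prems(2) by blast
    then show ?thesis using ne by (intro bexI[of _ f]) auto
  qed
next
  case (base x y M) then show ?case by auto
qed

text \<open>A covered vertex of the path is not an end, so the path runs through its matching
  edge.\<close>

lemma aug_path_covered_vertex:
  "aug_path E M xs \<Longrightarrow> a \<in> set xs \<Longrightarrow> a \<in> \<Union>M \<Longrightarrow> \<exists>m\<in>path_edges xs \<inter> M. a \<in> m"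
proof (induction rule: aug_path.induct)
  case (step M y z zs x)
  show ?case
  proof (cases "a = y \<or> a = z")
    case True
    then show ?thesis using step.hyps(2) by (intro bexI[of _ "{y, z}"]) auto
  next
    case False
    then have "a \<in> set (z # zs)" "a \<in> \<Union>(M - {{y, z}})" using step.prems step.hyps by auto
    then obtain m where "m \<in> path_edges (z # zs)" "m \<in> M" "a \<in> m" using step.IH by blast
    then show ?thesis by (intro bexI[of _ m]) simp_all
  qed
next
  case (base x y M) then show ?case by auto
qed

lemma aug_path_restrict:
  assumes "aug_path E M xs" "matching M" "path_edges xs \<subseteq> F"
  shows "aug_path F M xs"
proof -
  have "augmenting_path (\<Union>E) E M xs" by (rule aug_path_imp_augmenting_path[OF assms(1,2)]) simp
  then have "augmenting_path (\<Union>E) F M xs" using assms(3) unfolding augmenting_path_def by blast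
  then show ?thesis by (rule augmenting_path_imp_aug_path[OF assms(2)])
qed

lemma has_larger_iff:
  assumes "matching M" "finite M" "M \<subseteq> E"
  shows "has_larger E M \<longleftrightarrow> (\<exists>xs. aug_path E M xs)"
proof
  assume "has_larger E M"
  then obtain N where "matching N" "N \<subseteq> E" "card M < card N" unfolding has_larger_def by blast
  then show "\<exists>xs. aug_path E M xs" using berge[OF assms(1,2)] aug_path_mono assms(3) by (metis Un_subset_iff)
next
  assume "\<exists>xs. aug_path E M xs"
  then obtain xs where xs: "aug_path E M xs" by blast
  note ap = aug_path_augments[OF xs assms(1,2)]
  have "(M - path_edges xs) \<union> (path_edges xs - M) \<subseteq> E" using aug_path_edges[OF xs] assms(3) by blast
  then show "has_larger E M" unfolding has_larger_def using ap by (metis lessI)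
qed

lemma ed_edges: "(\<And>e. e \<in> set A \<Longrightarrow> length (snd e) = 2) \<Longrightarrow> ed (edges A) = (\<lambda>e. set (snd e)) ` set A"
proof (induction A)
  case (Cons e A)
  have "length (snd e) = 2" using Cons.prems by simp
  then obtain x y where xy: "snd e = [x, y]" by (cases "snd e"; cases "tl (snd e)") auto
  have "ed (edges (e # A)) = insert {x, y} (ed (edges A))" unfolding ed_def edges_def by (simp add: xy)
  then show ?case using Cons by (simp add: xy)
qed (simp add: ed_def edges_def)

lemma loopless_edges: "(\<And>e. e \<in> set A \<Longrightarrow> distinct (snd e)) \<Longrightarrow> loopless (edges A)"
  unfolding loopless_def edges_def by (fastforce split: list.splits)

lemma mem_triples: "T \<in> set (triples xs) \<longleftrightarrow> (\<exists>x\<in>set xs. \<exists>y\<in>set xs. \<exists>z\<in>set xs. T = [x, y, z])"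
  unfolding triples_def by auto

text \<open>One pass gives a minimal set: by monotonicity, an element that could not be deleted
  earlier cannot be deleted from a smaller set either.\<close>

lemma set_prune:
  assumes "augmentable A L" "\<And>K K'. set K \<subseteq> set K' \<Longrightarrow> set K' \<subseteq> set L \<Longrightarrow> augmentable A K \<Longrightarrow> augmentable A K'"
  shows "set (prune A L) \<subseteq> set L \<and> augmentable A (prune A L) \<and>
    (\<forall>y\<in>set (prune A L). \<not> augmentable A (filter (\<lambda>e. e \<noteq> y) (prune A L)))"
proof -
  let ?f = "\<lambda>y K. if augmentable A (filter (\<lambda>e. e \<noteq> y) K) then filter (\<lambda>e. e \<noteq> y) K else K"
  have "set (fold ?f ys L) \<subseteq> set L \<and> augmentable A (fold ?f ys L) \<and>
    (\<forall>y\<in>set ys \<inter> set (fold ?f ys L). \<not> augmentable A (filter (\<lambda>e. e \<noteq> y) (fold ?f ys L)))" for ys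
  proof (induction ys rule: rev_induct)
    case Nil then show ?case using assms(1) by simp
  next
    case (snoc x ys)
    let ?K = "fold ?f ys L"
    show ?case
    proof (cases "augmentable A (filter (\<lambda>e. e \<noteq> x) ?K)")
      case True
      have "\<not> augmentable A (filter (\<lambda>e. e \<noteq> y) (filter (\<lambda>e. e \<noteq> x) ?K))"
        if y: "y \<in> set (ys @ [x])" "y \<in> set (filter (\<lambda>e. e \<noteq> x) ?K)" for y
      proof
        assume "augmentable A (filter (\<lambda>e. e \<noteq> y) (filter (\<lambda>e. e \<noteq> x) ?K))"
        then have "augmentable A (filter (\<lambda>e. e \<noteq> y) ?K)" by (rule assms(2)[rotated 2]) (use snoc in auto)
        then show False using y snoc by auto
      qed
      then show ?thesis using snoc True by auto
    next
      case False then show ?thesis using snoc by auto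
    qed
  qed
  from this[of L] show ?thesis unfolding prune_def by blast
qed

text \<open>A member is stored together with the list of its elements. The key alone determines the
  entry, and distinct keys may carry equal lists.\<close>

locale listed_packing = packing V U for V :: "'c set" and U :: "'c \<Rightarrow> 'a set" +
  fixes ul :: "'c \<Rightarrow> 'a list" and fam :: "('c \<times> 'a list) list"
  assumes ul: "v \<in> V \<Longrightarrow> set (ul v) = U v" "v \<in> V \<Longrightarrow> distinct (ul v)"
    and fam: "set fam = (\<lambda>v. (v, ul v)) ` V"
begin

lemma entry:
  assumes "e \<in> set fam"
  shows "fst e \<in> V" "set (snd e) = U (fst e)" "distinct (snd e)" "length (snd e) = card (U (fst e))"
    "e = (fst e, ul (fst e))"
proof -
  have e: "fst e \<in> V" "snd e = ul (fst e)" using assms unfolding fam by auto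
  then show "fst e \<in> V" "set (snd e) = U (fst e)" "distinct (snd e)" "e = (fst e, ul (fst e))"
    using ul by (simp_all add: prod_eq_iff)
  then show "length (snd e) = card (U (fst e))" using distinct_card by metis
qed

lemma entry_eq: "e \<in> set fam \<Longrightarrow> f \<in> set fam \<Longrightarrow> fst e = fst f \<Longrightarrow> e = f"
  using entry(5) by metis

abbreviation keys :: "('c \<times> 'a list) list \<Rightarrow> 'c set" where "keys A \<equiv> fst ` set A"

lemma keys_V: "set A \<subseteq> set fam \<Longrightarrow> keys A \<subseteq> V"
  using entry(1) by blast

lemma meets_iff: "e \<in> set fam \<Longrightarrow> f \<in> set fam \<Longrightarrow> meets e f \<longleftrightarrow> U (fst e) \<inter> U (fst f) \<noteq> {}"
  unfolding meets_def using entry(2) by auto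

lemma next_to_iff: "e \<in> set fam \<Longrightarrow> f \<in> set fam \<Longrightarrow> next_to e f \<longleftrightarrow> adjacent V U (fst e) (fst f)"
  unfolding next_to_def adjacent_iff using meets_iff entry(1) by blast

lemma set_claw_swap: "set (claw_swap A T) = {e\<in>set A \<union> set T. \<not> (\<exists>t\<in>set T. next_to e t)}" "distinct (claw_swap A T)"
  unfolding claw_swap_def by auto

lemma keys_claw_swap:
  assumes "set A \<subseteq> set fam" "set T \<subseteq> set fam"
  shows "keys (claw_swap A T) = (keys A \<union> keys T) - neighbours V U (keys T)"
proof -
  have adj: "next_to e t \<longleftrightarrow> adjacent V U (fst t) (fst e)" if "e \<in> set A \<union> set T" "t \<in> set T" for e t
  proof -
    have "e \<in> set fam" "t \<in> set fam" using that assms by blast+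
    then show ?thesis by (simp add: next_to_iff adjacent_iff Int_commute conj_ac eq_commute)
  qed
  have key: "(\<exists>t\<in>set T. next_to e t) \<longleftrightarrow> fst e \<in> neighbours V U (keys T)" if "e \<in> set A \<union> set T" for e
  proof -
    have "fst e \<in> V" using that assms entry(1) by blast
    then show ?thesis unfolding neighbours_def using adj[OF that] by blast
  qed
  have "set (claw_swap A T) = {e\<in>set A \<union> set T. fst e \<notin> neighbours V U (keys T)}"
    unfolding set_claw_swap using key by blast
  then show ?thesis by blast
qed

lemma val_eq:
  assumes "set A \<subseteq> set fam" "distinct A"
  shows "val A = w2plus U (keys A)"
proof -
  have "val A = (\<Sum>e\<leftarrow>A. (length (snd e))\<^sup>2)"
    unfolding val_def by (induction A) (simp_all add: length_concat sum_list_triv power2_eq_square o_def)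
  also have "\<dots> = (\<Sum>e\<in>set A. (card (U (fst e)))\<^sup>2)"
    unfolding sum_list_distinct_conv_sum_set[OF assms(2)] using entry(4) assms(1) by (intro sum.cong) auto
  also have "\<dots> = (\<Sum>v\<in>keys A. (card (U v))\<^sup>2)"
  proof -
    have "inj_on fst (set A)" by (rule inj_onI) (use assms(1) entry_eq in blast)
    then show ?thesis by (simp add: sum.reindex)
  qed
  finally show ?thesis using w2plus_eq keys_V[OF assms(1)] by metis
qed

lemma is_claw_iff:
  assumes "set T \<subseteq> set fam" "T \<noteq> []"
  shows "is_claw fam T \<longleftrightarrow> (\<exists>C. claw V U C (keys T))"
proof -
  have V: "keys T \<subseteq> V" by (rule keys_V[OF assms(1)])
  have ne: "keys T \<noteq> {}" "finite (keys T)" using assms(2) by auto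
  have nt: "next_to x y \<longleftrightarrow> adjacent V U (fst x) (fst y)" if "x \<in> set fam" "y \<in> set T" for x y
    using that assms(1) next_to_iff by blast
  have 1: "(\<forall>x\<in>set T. \<forall>y\<in>set T. \<not> next_to x y) \<longleftrightarrow> independent_set V U (keys T)"
  proof -
    have "(\<forall>x\<in>set T. \<forall>y\<in>set T. \<not> next_to x y) \<longleftrightarrow> (\<forall>x\<in>set T. \<forall>y\<in>set T. \<not> adjacent V U (fst x) (fst y))"
      using nt assms(1) by blast
    then show ?thesis unfolding independent_set_def using V by simp
  qed
  have 2: "(\<forall>x\<in>set T. \<forall>y\<in>set T. fst x = fst y) \<longleftrightarrow> (\<exists>v. keys T = {v})"
  proof
    assume a: "\<forall>x\<in>set T. \<forall>y\<in>set T. fst x = fst y"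
    obtain t where "t \<in> set T" using assms(2) by (cases T) auto
    then have "keys T = {fst t}" using a by blast
    then show "\<exists>v. keys T = {v}" by blast
  next
    assume "\<exists>v. keys T = {v}"
    then obtain v where "keys T = {v}" by blast
    then have "fst x = v" if "x \<in> set T" for x using that by blast
    then show "\<forall>x\<in>set T. \<forall>y\<in>set T. fst x = fst y" by simp
  qed
  have 3: "(\<exists>z\<in>set fam. \<forall>t\<in>set T. next_to z t) \<longleftrightarrow> (\<exists>z\<in>V. \<forall>t\<in>keys T. adjacent V U z t)"
  proof -
    have "(\<exists>z\<in>V. \<forall>t\<in>keys T. adjacent V U z t) \<longleftrightarrow> (\<exists>z\<in>set fam. \<forall>t\<in>set T. adjacent V U (fst z) (fst t))"
      unfolding fam by simp
    also have "\<dots> \<longleftrightarrow> (\<exists>z\<in>set fam. \<forall>t\<in>set T. next_to z t)" using nt by blast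
    finally show ?thesis by blast
  qed
  have 4: "z \<in> V \<and> z \<notin> keys T" if z: "\<forall>t\<in>keys T. adjacent V U z t" for z
  proof -
    obtain t where t: "t \<in> keys T" using ne by (metis ex_in_conv)
    have "z \<in> V" using bspec[OF z t] unfolding adjacent_iff by simp
    moreover have "z \<notin> keys T" using bspec[OF z, of z] unfolding adjacent_iff by blast
    ultimately show ?thesis by simp
  qed
  show ?thesis
  proof
    assume "is_claw fam T"
    then consider v where "independent_set V U (keys T)" "keys T = {v}"
      | z where "independent_set V U (keys T)" "\<forall>t\<in>keys T. adjacent V U z t" unfolding is_claw_def 1 2 3 by blast
    then show "\<exists>C. claw V U C (keys T)"
    proof cases
      case 1 then have "claw V U {v} (keys T)" unfolding claw_def using V ne by simp
      then show ?thesis by blast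
    next
      case (2 z)
      have "claw V U (insert z (keys T)) (keys T)"
        unfolding claw_def using V ne 2 4[OF 2(2)] by (intro conjI disjI2 exI[of _ z]) simp_all
      then show ?thesis by blast
    qed
  next
    assume "\<exists>C. claw V U C (keys T)"
    then have "independent_set V U (keys T) \<and> ((\<exists>v. keys T = {v}) \<or> (\<exists>z. \<forall>t\<in>keys T. adjacent V U z t))"
      unfolding claw_def by (elim exE conjE disjE) blast+
    then show "is_claw fam T" unfolding is_claw_def 1 2 3 using 4 by (elim conjE disjE exE) blast+
  qed
qed

text \<open>The talons are pairwise disjoint and each meets the set of the centre, in distinct
  elements; that set has at most 3 elements.\<close>

lemma claw_card: "claw V U C T \<Longrightarrow> card T \<le> 3"
proof -
  assume c: "claw V U C T"
  then consider v where "T = {v}" | z where "z \<in> V" "\<And>t. t \<in> T \<Longrightarrow> adjacent V U z t" unfolding claw_def by blast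
  then show "card T \<le> 3"
  proof cases
    case 2
    have ind: "indep T" using c unfolding claw_def by blast
    have "\<forall>t\<in>T. \<exists>a. a \<in> U z \<inter> U t" using 2(2) unfolding adjacent_iff by blast
    then obtain f where f: "\<And>t. t \<in> T \<Longrightarrow> f t \<in> U z \<inter> U t" by metis
    have "inj_on f T" using f indep_unique[OF ind] by (metis IntE inj_onI)
    then have "card T \<le> card (U z)" using f finite_U[OF 2(1)] by (intro card_inj_on_le) auto
    then show ?thesis using card_U[OF 2(1)] by auto
  qed simp
qed

lemma small_set_triple:
  assumes "card S \<le> 3" "finite S" "S \<noteq> {}"
  shows "\<exists>a b c. S = {a, b, c}"
proof -
  have "card S \<noteq> 0" using assms by simp
  then consider "card S = 1" | "card S = 2" | "card S = 3" using assms(1) by linarith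
  then show ?thesis
    by cases (auto simp: card_1_singleton_iff card_2_iff card_3_iff)
qed

lemma improving_sound:
  assumes A: "set A \<subseteq> set fam" "distinct A" and T: "T \<in> set (improving fam A)"
  shows "claw_step V U (keys A) (keys (claw_swap A T))" "set (claw_swap A T) \<subseteq> set fam"
proof -
  have T': "set T \<subseteq> set fam" "T \<noteq> []" "is_claw fam T" "val A < val (claw_swap A T)"
    using T unfolding improving_def by (auto simp: mem_triples)
  show s: "set (claw_swap A T) \<subseteq> set fam" using A(1) T'(1) unfolding set_claw_swap by blast
  obtain C where "claw V U C (keys T)" using T' is_claw_iff by blast
  moreover have "w2plus U (keys A) < w2plus U (keys (claw_swap A T))"
    using T'(4) unfolding val_eq[OF A] val_eq[OF s set_claw_swap(2)] .
  ultimately show "claw_step V U (keys A) (keys (claw_swap A T))"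
    unfolding claw_step_def using keys_claw_swap[OF A(1) T'(1)] by blast
qed

lemma improving_complete:
  assumes A: "set A \<subseteq> set fam" "distinct A" and none: "improving fam A = []"
  shows "\<nexists>B. claw_step V U (keys A) B"
proof
  assume "\<exists>B. claw_step V U (keys A) B"
  then obtain C S where c: "claw V U C S" and w: "w2plus U (keys A) < w2plus U ((keys A \<union> S) - neighbours V U S)"
    unfolding claw_step_def by blast
  have S: "S \<subseteq> V" "finite S" "S \<noteq> {}" using c unfolding claw_def independent_set_def by blast+
  obtain x y z where xyz: "S = {x, y, z}" using small_set_triple[OF claw_card[OF c] S(2,3)] by blast
  define T where "T = [(x, ul x), (y, ul y), (z, ul z)]"
  have T: "keys T = S" "set T \<subseteq> set fam" "T \<noteq> []" "T \<in> set (triples fam)"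
    using xyz S(1) unfolding T_def fam mem_triples by auto
  have sub: "set (claw_swap A T) \<subseteq> set fam" using A(1) T(2) unfolding set_claw_swap by blast
  have "is_claw fam T" using is_claw_iff[OF T(2,3)] c T(1) by blast
  moreover have "val A < val (claw_swap A T)"
    unfolding val_eq[OF A] val_eq[OF sub set_claw_swap(2)] keys_claw_swap[OF A(1) T(2)] T(1) by (rule w)
  ultimately have "T \<in> set (improving fam A)" using T(4) unfolding improving_def by simp
  then show False using none by simp
qed

lemma pairs_edges:
  assumes "set A \<subseteq> set fam"
  shows "ed (edges (pairs A)) = U ` light (keys A)" "loopless (edges (pairs A))"
proof -
  have e: "length (snd e) = card (U (fst e))" "set (snd e) = U (fst e)" "distinct (snd e)" if "e \<in> set A" for e
    using entry that assms by blast+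
  have p: "set (pairs A) = {e\<in>set A. card (U (fst e)) = 2}" unfolding pairs_def by (simp add: e cong: conj_cong)
  have "ed (edges (pairs A)) = (\<lambda>e. set (snd e)) ` set (pairs A)" by (rule ed_edges) (simp add: pairs_def)
  also have "\<dots> = (\<lambda>e. U (fst e)) ` {e\<in>set A. card (U (fst e)) = 2}"
    unfolding p by (intro image_cong refl) (simp add: e)
  also have "\<dots> = U ` light (keys A)" unfolding light_def by blast
  finally show "ed (edges (pairs A)) = U ` light (keys A)" .
  show "loopless (edges (pairs A))" by (rule loopless_edges) (simp add: p e)
qed

lemma H_list_mem:
  assumes "set A \<subseteq> set fam"
  shows "e \<in> set (H_list fam A) \<longleftrightarrow> e \<in> set fam \<and> U (fst e) \<in> H_edges V U (keys A)"
proof (cases "e \<in> set fam")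
  case e: True
  have f: "length (snd f) = card (U (fst f))" "meets e f \<longleftrightarrow> U (fst e) \<inter> U (fst f) \<noteq> {}" if "f \<in> set A" for f
    using entry(4) meets_iff[OF e] that assms by blast+
  have "(\<forall>f\<in>set A. length (snd f) = 3 \<longrightarrow> \<not> meets e f) \<longleftrightarrow>
      (\<forall>f\<in>set A. card (U (fst f)) = 3 \<longrightarrow> U (fst e) \<inter> U (fst f) = {})"
    by (intro ball_cong refl) (simp add: f)
  also have "\<dots> \<longleftrightarrow> U (fst e) \<inter> heavy_union U (keys A) = {}" unfolding heavy_union_eq heavy_def by blast
  finally show ?thesis
    unfolding H_list_def pairs_def H_edges_iff using e entry(1)[OF e] entry(4)[OF e] by auto
qed (simp add: H_list_def pairs_def)

lemma augmentable_iff: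
  assumes A: "set A \<subseteq> set fam" "indep (keys A)" and K: "set K \<subseteq> set (H_list fam A)"
  shows "augmentable A K \<longleftrightarrow>
    (\<exists>xs. aug_path ((\<lambda>e. U (fst e)) ` set K \<union> U ` light (keys A)) (U ` light (keys A)) xs)"
proof -
  let ?M = "U ` light (keys A)"
  have KF: "set K \<subseteq> set fam" using K H_list_mem[OF A(1)] by blast
  have K2: "length (snd e) = 2" if "e \<in> set K" for e using K that unfolding H_list_def pairs_def by auto
  have len: "length (snd e) = 2" if "e \<in> set (K @ pairs A)" for e using that K2[of e] by (simp add: pairs_def) blast
  have "ed (edges (K @ pairs A)) = (\<lambda>e. set (snd e)) ` set K \<union> ed (edges (pairs A))"
    using ed_edges[of "K @ pairs A", OF len] ed_edges[of "pairs A"] by (simp add: image_Un pairs_def)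
  also have "(\<lambda>e. set (snd e)) ` set K = (\<lambda>e. U (fst e)) ` set K"
    using KF entry(2) by (intro image_cong) auto
  finally have E: "ed (edges (K @ pairs A)) = (\<lambda>e. U (fst e)) ` set K \<union> ?M" unfolding pairs_edges(1)[OF A(1)] .
  have lo: "loopless (edges (K @ pairs A))"
    by (rule loopless_edges) (use KF A(1) entry(3) in \<open>auto simp: pairs_def\<close>)
  have m: "matching ?M" "finite ?M" using matching_light[OF A(2)] unfolding light_def by auto
  have good: "good (edges (K @ pairs A)) (edges (pairs A))"
    unfolding good_def E pairs_edges(1)[OF A(1)] using lo m pairs_edges(2)[OF A(1)] by blast
  show ?thesis
    unfolding augmentable_def larger_iff[OF good] E pairs_edges(1)[OF A(1)] by (rule has_larger_iff[OF m Un_upper2])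
qed

lemma H_matching_sub: "indep (keys A) \<Longrightarrow> U ` light (keys A) \<subseteq> H_edges V U (keys A)"
  using H_matching_eq unfolding H_matching_def by blast

lemma augment_complete:
  assumes A: "set A \<subseteq> set fam" "indep (keys A)" and "augment_step V U (keys A) B"
  shows "augmentable A (H_list fam A)"
proof -
  let ?M = "U ` light (keys A)"
  obtain xs where "augmenting_path (H_verts V U (keys A)) (H_edges V U (keys A)) ?M xs"
    using assms(3) unfolding augment_step_def Let_def H_matching_eq[OF A(2)] by blast
  then have "aug_path (H_edges V U (keys A)) ?M xs" by (rule augmenting_path_imp_aug_path[OF matching_light[OF A(2)]])
  moreover have "H_edges V U (keys A) \<subseteq> (\<lambda>e. U (fst e)) ` set (H_list fam A)"
  proof
    fix h assume h: "h \<in> H_edges V U (keys A)"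
    then obtain v where v: "v \<in> V" "U v = h" unfolding H_edges_iff by blast
    then have "(v, ul v) \<in> set (H_list fam A)" using h unfolding H_list_mem[OF A(1)] fam by auto
    then show "h \<in> (\<lambda>e. U (fst e)) ` set (H_list fam A)" using v(2) by force
  qed
  ultimately have "aug_path ((\<lambda>e. U (fst e)) ` set (H_list fam A) \<union> ?M) ?M xs" by (meson aug_path_mono le_supI1)
  then show ?thesis using augmentable_iff[OF A order_refl] by blast
qed

text \<open>Minimality of K makes its sets exactly the non-matching edges of an augmenting path,
  each occurring once. So replacing the members that meet K is an augmentation along that
  path.\<close>

lemma augment_sound:
  assumes A: "set A \<subseteq> set fam" "indep (keys A)" and aug: "augmentable A (H_list fam A)"
  shows "augment_step V U (keys A) (keys (augment fam A))" "set (augment fam A) \<subseteq> set fam" "distinct (augment fam A)"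
proof -
  let ?M = "U ` light (keys A)" and ?L = "H_list fam A" and ?u = "\<lambda>e :: 'c \<times> 'a list. U (fst e)"
  define K where "K = prune A ?L"
  have mM: "matching ?M" "finite ?M" using matching_light[OF A(2)] unfolding light_def by auto
  have K: "set K \<subseteq> set ?L" "augmentable A K" "\<And>y. y \<in> set K \<Longrightarrow> \<not> augmentable A (filter (\<lambda>e. e \<noteq> y) K)"
  proof -
    have mono: "augmentable A K2" if K: "set K1 \<subseteq> set K2" "set K2 \<subseteq> set ?L" "augmentable A K1" for K1 K2
    proof -
      obtain xs where "aug_path (?u ` set K1 \<union> ?M) ?M xs"
        using K(3) augmentable_iff[OF A order_trans[OF K(1,2)]] by blast
      then have "aug_path (?u ` set K2 \<union> ?M) ?M xs" by (rule aug_path_mono) (use K(1) in blast)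
      then show ?thesis using augmentable_iff[OF A K(2)] by blast
    qed
    have "set (prune A ?L) \<subseteq> set ?L \<and> augmentable A (prune A ?L) \<and>
      (\<forall>y\<in>set (prune A ?L). \<not> augmentable A (filter (\<lambda>e. e \<noteq> y) (prune A ?L)))"
      by (rule set_prune[OF aug]) (erule (2) mono)
    then show "set K \<subseteq> set ?L" "augmentable A K"
      "\<And>y. y \<in> set K \<Longrightarrow> \<not> augmentable A (filter (\<lambda>e. e \<noteq> y) K)" unfolding K_def by blast+
  qed
  have KF: "set K \<subseteq> set fam" using K(1) H_list_mem[OF A(1)] by blast
  obtain xs where xs: "aug_path (?u ` set K \<union> ?M) ?M xs" using K(2) augmentable_iff[OF A K(1)] by blast
  let ?P = "path_edges xs"
  have PK: "?P - ?M \<subseteq> ?u ` set K" using aug_path_edges[OF xs] by blast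
  \<comment> \<open>A proper part of K that still contained all new edges of the path would remain
    augmentable.\<close>
  have drop: "\<not> ?P - ?M \<subseteq> ?u ` (set K - {y})" if y: "y \<in> set K" for y
  proof
    assume "?P - ?M \<subseteq> ?u ` (set K - {y})"
    then have "?P \<subseteq> ?u ` set (filter (\<lambda>e. e \<noteq> y) K) \<union> ?M" by auto
    then have "aug_path (?u ` set (filter (\<lambda>e. e \<noteq> y) K) \<union> ?M) ?M xs" by (rule aug_path_restrict[OF xs mM(1)])
    moreover have "set (filter (\<lambda>e. e \<noteq> y) K) \<subseteq> set ?L" using K(1) by auto
    ultimately have "augmentable A (filter (\<lambda>e. e \<noteq> y) K)" using augmentable_iff[OF A] by blast
    then show False using K(3)[OF y] by simp
  qed
  have KP: "?u y \<in> ?P - ?M" if y: "y \<in> set K" for y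
  proof (rule ccontr)
    assume n: "?u y \<notin> ?P - ?M"
    have "?P - ?M \<subseteq> ?u ` (set K - {y})"
    proof
      fix p assume p: "p \<in> ?P - ?M"
      then obtain z where z: "z \<in> set K" "p = ?u z" using PK by blast
      then have "z \<noteq> y" using n p by blast
      then show "p \<in> ?u ` (set K - {y})" using z by blast
    qed
    then show False using drop[OF y] by blast
  qed
  have inj: "y = z" if yz: "y \<in> set K" "z \<in> set K" "?u y = ?u z" for y z
  proof (rule ccontr)
    assume "y \<noteq> z"
    then have "?u y \<in> ?u ` (set K - {y})" using yz by blast
    then have "?u ` set K \<subseteq> ?u ` (set K - {y})" by blast
    then have "?P - ?M \<subseteq> ?u ` (set K - {y})" using PK by (rule order_trans[rotated])
    then show False using drop[OF yz(1)] by (rule notE[rotated])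
  qed
  \<comment> \<open>The choice function of \<open>augment_step\<close> picks the only entry of K
    with the given edge; it is unique by \<open>inj\<close>.\<close>
  define g where "g h = fst (THE y. y \<in> set K \<and> ?u y = h)" for h
  have g: "g (?u y) = fst y" if "y \<in> set K" for y
    unfolding g_def using that inj by (intro arg_cong[where f = fst] the_equality) auto
  have "?P - ?M = ?u ` set K" using PK KP by (intro equalityI image_subsetI)
  then have gK: "g ` (?P - ?M) = keys K" by (simp add: image_image g)
  have KH: "?u y \<in> H_edges V U (keys A)" if "y \<in> set K" for y using that K(1) H_list_mem[OF A(1)] by blast
  have gV: "\<forall>e\<in>?P - ?M. g e \<in> V \<and> U (g e) = e"
  proof
    fix e assume "e \<in> ?P - ?M"
    then obtain y where "y \<in> set K" "e = ?u y" using PK by blast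
    then show "g e \<in> V \<and> U (g e) = e" using g[of y] KF entry(1)[of y] by auto
  qed
  have "aug_path (H_edges V U (keys A)) ?M xs"
    using xs by (rule aug_path_mono) (use KH H_matching_sub[OF A(2)] in blast)
  then have ap: "augmenting_path (H_verts V U (keys A)) (H_edges V U (keys A)) ?M xs"
    using aug_path_imp_augmenting_path[OF _ mM(1)] Union_H_edges by blast
  \<comment> \<open>Heavy members never meet K, since the edges of H avoid them. A light member that
    meets an edge of K has its own edge on the path, and conversely.\<close>
  have touched: "(\<exists>f\<in>set K. meets e f) \<longleftrightarrow> ?u e \<in> ?M \<inter> ?P" if e: "e \<in> set A" for e
  proof
    assume "\<exists>f\<in>set K. meets e f"
    then obtain f where f: "f \<in> set K" "?u e \<inter> ?u f \<noteq> {}" using meets_iff e A(1) KF by blast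
    then obtain a where a: "a \<in> ?u e" "a \<in> ?u f" by blast
    have "?u f \<inter> heavy_union U (keys A) = {}" using KH[OF f(1)] unfolding H_edges_iff by blast
    then have "fst e \<notin> heavy (keys A)" using a unfolding heavy_union_eq by blast
    then have eM: "?u e \<in> ?M" using light_heavy(1)[OF keys_V[OF A(1)]] e by blast
    have "?u f \<subseteq> set xs" using path_edges_vertices KP[OF f(1)] by blast
    then have "a \<in> set xs" using a by blast
    moreover have "a \<in> \<Union>?M" using a eM by blast
    ultimately obtain m where m: "m \<in> ?P \<inter> ?M" "a \<in> m" using aug_path_covered_vertex[OF xs] by blast
    then have "m = ?u e" using matching_unique[OF mM(1) _ eM, of m a] a by blast
    then show "?u e \<in> ?M \<inter> ?P" using m by blast
  next
    assume "?u e \<in> ?M \<inter> ?P"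
    then obtain p where p: "p \<in> ?P - ?M" "?u e \<inter> p \<noteq> {}" using aug_path_matching_edge[OF xs, of "?u e"] by (elim IntE) blast
    then obtain f where "f \<in> set K" "p = ?u f" using PK by blast
    then show "\<exists>f\<in>set K. meets e f" using meets_iff e A(1) KF p(2) by blast
  qed
  have eq: "set (augment fam A) = {e\<in>set A. \<not> (\<exists>f\<in>set K. meets e f)} \<union> set K"
    unfolding augment_def using aug by (auto simp: K_def)
  have "fst ` {e\<in>set A. \<not> (\<exists>f\<in>set K. meets e f)} = keys A - {v \<in> keys A. U v \<in> ?M \<inter> ?P}"
    using touched by (auto simp: image_iff)
  then have keys: "keys (augment fam A) = (keys A - {v \<in> keys A. U v \<in> ?M \<inter> ?P}) \<union> g ` (?P - ?M)"
    unfolding eq gK image_Un by simp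
  show "augment_step V U (keys A) (keys (augment fam A))"
    unfolding augment_step_def Let_def H_matching_eq[OF A(2)]
    by (intro exI[of _ xs] exI[of _ g] conjI ap gV keys)
  show "set (augment fam A) \<subseteq> set fam" unfolding eq using A(1) KF by blast
  show "distinct (augment fam A)" unfolding augment_def using aug by simp
qed

lemma improve_spec:
  assumes A: "set A \<subseteq> set fam" "distinct A" "indep (keys A)"
  shows "square_imp_step V U (keys A) (keys (improve fam A)) \<and> set (improve fam A) \<subseteq> set fam \<and> distinct (improve fam A) \<or>
    improve fam A = A \<and> (\<nexists>B. square_imp_step V U (keys A) B)"
proof (cases "improving fam A")
  case Nil
  then have i: "improve fam A = augment fam A" unfolding improve_def by simp
  have n: "\<nexists>B. claw_step V U (keys A) B" by (rule improving_complete[OF A(1,2) Nil])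
  show ?thesis
  proof (cases "augmentable A (H_list fam A)")
    case True
    then show ?thesis unfolding i square_imp_step_def using augment_sound[OF A(1,3)] n by blast
  next
    case False
    then have "augment fam A = A" unfolding augment_def by simp
    moreover have "\<nexists>B. augment_step V U (keys A) B" using augment_complete[OF A(1,3)] False by blast
    ultimately show ?thesis unfolding i square_imp_step_def using n by blast
  qed
next
  case (Cons T Ts)
  then have i: "improve fam A = claw_swap A T" and T: "T \<in> set (improving fam A)" unfolding improve_def by simp_all
  show ?thesis unfolding i square_imp_step_def using improving_sound[OF A(1,2) T] set_claw_swap(2) by blast
qed

lemma improve_iterate:
  defines "R ys \<equiv> fold (\<lambda>_ A. improve fam A) ys []"
  shows "set (R ys) \<subseteq> set fam \<and> distinct (R ys) \<and> (square_imp_step V U)\<^sup>*\<^sup>* {} (keys (R ys)) \<and>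
    ((square_imp_step V U ^^ length ys) {} (keys (R ys)) \<or> (\<nexists>B. square_imp_step V U (keys (R ys)) B))"
proof (induction ys rule: rev_induct)
  case Nil then show ?case unfolding R_def by simp
next
  case (snoc y ys)
  have R: "R (ys @ [y]) = improve fam (R ys)" unfolding R_def by simp
  have "\<exists>k. (square_imp_step V U ^^ k) {} (keys (R ys))" using snoc by (metis rtranclp_power)
  then have ind: "indep (keys (R ys))" using square_imp_steps_indep by blast
  have A: "set (R ys) \<subseteq> set fam" "distinct (R ys)" using snoc by blast+
  from improve_spec[OF A ind] show ?case
  proof
    assume s: "square_imp_step V U (keys (R ys)) (keys (improve fam (R ys))) \<and> set (improve fam (R ys)) \<subseteq> set fam \<and> distinct (improve fam (R ys))"
    then have "(square_imp_step V U ^^ length ys) {} (keys (R ys))" using snoc by blast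
    then have "(square_imp_step V U ^^ length (ys @ [y])) {} (keys (R (ys @ [y])))" unfolding R using s by auto
    then show ?thesis unfolding R using s snoc by (meson rtranclp.rtrancl_into_rtrancl)
  next
    assume "improve fam (R ys) = R ys \<and> (\<nexists>B. square_imp_step V U (keys (R ys)) B)"
    then show ?thesis unfolding R using snoc by simp
  qed
qed

text \<open>By \<open>improve_iterate\<close>, either every round performed a step, which is
  impossible for more rounds than the potential admits, or the current set can no longer be
  changed.\<close>

lemma improve_iterate_result:
  assumes "3 * card (\<Union>v\<in>V. U v) < length ys"
  shows "square_imp_result V U (keys (fold (\<lambda>_ A. improve fam A) ys []))"
  using improve_iterate[of ys] square_imp_steps_bound[of "length ys"] assms unfolding square_imp_result_def by fastforce

end

section \<open>The algorithm on lists\<close>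

instantiation candidate :: (enc) enc
begin
text \<open>The underlying node is the first component in both cases, so it is obtained by a single
  \<open>Hd\<close>.\<close>

definition enc_candidate :: "'a candidate \<Rightarrow> tree" where
  "enc_candidate x = (case x of Orig v \<Rightarrow> enc (v, [] :: 'a list) | Drop v u \<Rightarrow> enc (v, [u]))"
instance by standard (auto simp: enc_candidate_def split: candidate.splits)
end

lemma pt_Orig: "pt f \<Longrightarrow> pt (\<lambda>x. Orig (f x :: 'b::enc))"
  by (rule pt_coerce[of "\<lambda>x. (f x, [] :: 'b list)"]) (auto intro: pt_Pair pt_const simp: enc_candidate_def)

lemma pt_Drop: "pt f \<Longrightarrow> pt g \<Longrightarrow> pt (\<lambda>x. Drop (f x :: 'b::enc) (g x))"
  by (rule pt_coerce[of "\<lambda>x. (f x, [g x])"], intro pt_Pair pt_Cons pt_const) (simp_all add: enc_candidate_def)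

lemma pt_underlying0: "pt underlying"
  by (rule pt_expr[of "\<lambda>k. Hd (Var k)" _ "[:2, 1:]"]) (auto simp: enc_candidate_def split: candidate.splits)
lemmas pt_underlying = pt_comp[OF pt_underlying0]

section \<open>Running time of the local search\<close>

lemma pt_meets0: "pt (\<lambda>z. meets (fst z) (snd z))"
  unfolding meets_def by (intro pt_rules)
lemmas pt_meets = pt_comp2[OF pt_meets0]

lemma pt_next_to0: "pt (\<lambda>z. next_to (fst z) (snd z))"
  unfolding next_to_def by (intro pt_rules pt_meets)
lemmas pt_next_to = pt_comp2[OF pt_next_to0]

lemma pt_claw_swap0: "pt (\<lambda>z. claw_swap (fst z) (snd z))"
  unfolding claw_swap_def by (intro pt_rules pt_next_to)
lemmas pt_claw_swap = pt_comp2[OF pt_claw_swap0]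

lemma pt_val0: "pt val"
  unfolding val_def by (intro pt_rules)
lemmas pt_val = pt_comp[OF pt_val0]

lemma pt_triples0: "pt triples"
  unfolding triples_def by (intro pt_rules pt_const)
lemmas pt_triples = pt_comp[OF pt_triples0]

lemma pt_is_claw0: "pt (\<lambda>z. is_claw (fst z) (snd z))"
  unfolding is_claw_def by (intro pt_rules pt_next_to)
lemmas pt_is_claw = pt_comp2[OF pt_is_claw0]

lemma pt_improving0: "pt (\<lambda>z. improving (fst z) (snd z))"
  unfolding improving_def by (intro pt_rules pt_triples pt_is_claw pt_val pt_claw_swap)
lemmas pt_improving = pt_comp2[OF pt_improving0]

lemma pt_pairs0: "pt pairs"
  unfolding pairs_def by (intro pt_rules pt_const)
lemmas pt_pairs = pt_comp[OF pt_pairs0]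

lemma pt_imp: "pt P \<Longrightarrow> pt Q \<Longrightarrow> pt (\<lambda>x. P x \<longrightarrow> Q x)"
  unfolding imp_conv_disj by (intro pt_rules)

lemma pt_H_list0: "pt (\<lambda>z. H_list (fst z) (snd z))"
  unfolding H_list_def by (intro pt_rules pt_imp pt_meets pt_pairs pt_const)
lemmas pt_H_list = pt_comp2[OF pt_H_list0]

lemma pt_edges0: "pt edges"
  unfolding edges_def by (intro pt_rules pt_const)
lemmas pt_edges = pt_comp[OF pt_edges0]

lemma pt_augmentable0: "pt (\<lambda>z. augmentable (fst z) (snd z))"
  unfolding augmentable_def by (intro pt_rules pt_larger pt_edges pt_pairs)
lemmas pt_augmentable = pt_comp2[OF pt_augmentable0]

lemma esize_filter: "esize (filter P xs) \<le> esize xs"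
  by (induction xs) auto

lemma esize_nub: "esize (nub xs) \<le> esize xs"
proof -
  have "esize (fold List.insert xs w) \<le> esize xs + esize w" for w
  proof (induction xs arbitrary: w)
    case (Cons x xs)
    have "esize (List.insert x w) \<le> esize x + esize w + 1" by (simp add: List.insert_def)
    then show ?case using Cons[of "List.insert x w"] by simp
  qed simp
  from this[of "[]"] show ?thesis unfolding nub_def by simp
qed

lemma pt_prune0: "pt (\<lambda>z. prune (fst z) (snd z))"
  unfolding prune_def
  by (rule pt_fold_add[of _ _ _ 0]) (intro pt_rules pt_augmentable | simp add: esize_filter)+
lemmas pt_prune = pt_comp2[OF pt_prune0]

lemma pt_augment0: "pt (\<lambda>z. augment (fst z) (snd z))"
  unfolding augment_def by (intro pt_rules pt_augmentable pt_prune pt_meets pt_H_list)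
lemmas pt_augment = pt_comp2[OF pt_augment0]

lemma pt_improve0: "pt (\<lambda>z. improve (fst z) (snd z))"
  unfolding improve_def by (intro pt_rules pt_improving pt_augment pt_claw_swap)
lemmas pt_improve = pt_comp2[OF pt_improve0]

lemma esize_prune: "esize (prune A L) \<le> esize L"
proof -
  let ?f = "\<lambda>y K. if augmentable A (filter (\<lambda>e. e \<noteq> y) K) then filter (\<lambda>e. e \<noteq> y) K else K"
  have "esize (fold ?f ys K) \<le> esize K" for ys K
  proof (induction ys arbitrary: K)
    case (Cons y ys)
    have "esize (?f y K) \<le> esize K" by (simp add: esize_filter)
    then show ?case using Cons[of "?f y K"] by (metis (no_types, lifting) fold_simps(2) order_trans)
  qed simp
  then show ?thesis unfolding prune_def .
qed

text \<open>The growth of a round is bounded in terms of the fixed family only, as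
  \<open>pt_fold_add\<close> requires. A claw adds at most three entries and three list cells; an
  augmentation adds at most a part of the family.\<close>

lemma esize_improve: "esize (improve fam A) \<le> esize A + (3 * esize fam + 3)"
proof (cases "improving fam A")
  case Nil
  have "esize (augment fam A) \<le> esize A + esize fam"
  proof (cases "augmentable A (H_list fam A)")
    case True
    let ?A = "filter (\<lambda>e. \<not> (\<exists>f\<in>set (prune A (H_list fam A)). meets e f)) A" and ?K = "prune A (H_list fam A)"
    have "esize (augment fam A) = esize (nub (?A @ ?K))" unfolding augment_def using True by simp
    also have "\<dots> \<le> esize ?A + esize ?K" using esize_nub[of "?A @ ?K"] by (simp add: esize_append)
    also have "\<dots> \<le> esize A + esize fam"
    proof (rule add_mono[OF esize_filter])
      have "esize (H_list fam A) \<le> esize fam"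
        unfolding H_list_def pairs_def by (rule order_trans[OF esize_filter esize_filter])
      then show "esize ?K \<le> esize fam" using esize_prune by (rule order_trans[rotated])
    qed
    finally show ?thesis .
  qed (simp add: augment_def)
  then show ?thesis using Nil by (simp add: improve_def)
next
  case (Cons T Ts)
  have "T \<in> set (improving fam A)" using Cons by simp
  then obtain x y z where T: "T = [x, y, z]" "x \<in> set fam" "y \<in> set fam" "z \<in> set fam"
    unfolding improving_def by (auto simp: mem_triples)
  have "esize (improve fam A) = esize (claw_swap A T)" using Cons by (simp add: improve_def)
  also have "\<dots> \<le> esize (A @ T)"
    unfolding claw_swap_def by (rule order_trans[OF esize_nub esize_filter])
  also have "\<dots> \<le> esize A + (3 * esize fam + 3)"
    using T(1) esize_mem[OF T(2)] esize_mem[OF T(3)] esize_mem[OF T(4)] by (simp add: esize_append)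
  finally show ?thesis .
qed

definition avail_list :: "(nat \<times> nat) list \<Rightarrow> (nat \<times> nat) list \<Rightarrow> nat \<Rightarrow> (nat \<times> nat) list" where
  "avail_list as F v = filter (\<lambda>e. fst e = v \<and> snd e \<notin> set (map snd F)) as"

definition expand_list :: "nat \<Rightarrow> (nat \<times> nat) list \<Rightarrow> nat \<Rightarrow> (nat \<times> nat) list \<Rightarrow> (nat \<times> nat) list" where
  "expand_list t as v F =
     (if v \<notin> set (map fst F) \<and> t \<le> length (avail_list as F v) then F @ avail_list as F v else F)"

definition greedy_list :: "nat \<Rightarrow> nat \<Rightarrow> (nat \<times> nat) list \<Rightarrow> (nat \<times> nat) list \<Rightarrow> (nat \<times> nat) list" where
  "greedy_list t n as F = fold (expand_list t as) [0..<n] F"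

definition entries :: "nat \<Rightarrow> nat list \<Rightarrow> (nat candidate \<times> nat list) list" where
  "entries v h = (if 2 \<le> length h \<and> length h \<le> 3 then [(Orig v, h)] else []) @
     (if length h = 3 then map (\<lambda>u. (Drop v u, filter (\<lambda>x. x \<noteq> u) h)) h else [])"

definition candidate_list :: "nat \<Rightarrow> (nat \<times> nat) list \<Rightarrow> (nat \<times> nat) list \<Rightarrow> (nat candidate \<times> nat list) list" where
  "candidate_list n as F = concat (map (\<lambda>v. if v \<in> set (map fst F) then [] else entries v (map snd (avail_list as F v))) [0..<n])"

text \<open>One round more than the bound \<open>3 n\<close> on the number of changes of the current set.\<close>

definition search_list :: "nat \<Rightarrow> ('c \<times> 'a list) list \<Rightarrow> ('c \<times> 'a list) list" where
  "search_list n fam = fold (\<lambda>_ A. improve fam A) (0 # [0..<n] @ [0..<n] @ [0..<n]) []"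

definition selected_list :: "(nat candidate \<times> nat list) list \<Rightarrow> (nat \<times> nat) list" where
  "selected_list A = concat (map (\<lambda>e. map (\<lambda>u. (underlying (fst e), u)) (snd e)) A)"

text \<open>The final \<open>nub\<close> provides the distinct output list that is asked for, so
  distinctness need not be traced through the phases.\<close>

definition max_leaves_list :: "nat \<Rightarrow> (nat \<times> nat) list \<Rightarrow> (nat \<times> nat) list" where
  "max_leaves_list n as = nub (greedy_list 1 n as (greedy_list 4 n as [] @
     selected_list (search_list n (candidate_list n as (greedy_list 4 n as [])))))"

section \<open>Running time of the whole algorithm\<close>

lemma pt_avail_list0: "pt (\<lambda>z. avail_list (fst z) (fst (snd z)) (snd (snd z)))"
  unfolding avail_list_def by (intro pt_rules)
lemmas pt_avail_list = pt_comp3[OF pt_avail_list0]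

lemma pt_expand_list0: "pt (\<lambda>z. expand_list t (fst z) (fst (snd z)) (snd (snd z)))"
  unfolding expand_list_def by (intro pt_rules pt_avail_list pt_const)
lemmas pt_expand_list = pt_comp3[OF pt_expand_list0]

lemma pt_greedy_list0: "pt (\<lambda>z. greedy_list t (fst z) (fst (snd z)) (snd (snd z)))"
  unfolding greedy_list_def
proof (rule pt_fold_add[of _ _ _ "[:0, 1:]"])
  fix x :: "nat \<times> (nat \<times> nat) list \<times> (nat \<times> nat) list" and y :: nat and w :: "(nat \<times> nat) list"
  have "esize (avail_list (fst (snd x)) w y) \<le> esize (fst (snd x))" unfolding avail_list_def by (rule esize_filter)
  also have "\<dots> \<le> esize x" by (cases x) simp
  finally show "esize (expand_list t (fst (snd x)) y w) \<le> esize w + poly [:0, 1:] (esize x)"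
    unfolding expand_list_def by (simp add: esize_append)
qed (intro pt_rules pt_expand_list)+
lemmas pt_greedy_list = pt_comp3[OF pt_greedy_list0]

lemma pt_entries0: "pt (\<lambda>z. entries (fst z) (snd z))"
  unfolding entries_def by (intro pt_rules pt_const pt_Orig pt_Drop)
lemmas pt_entries = pt_comp2[OF pt_entries0]

lemma pt_candidate_list0: "pt (\<lambda>z. candidate_list (fst z) (fst (snd z)) (snd (snd z)))"
  unfolding candidate_list_def by (intro pt_rules pt_const pt_entries pt_avail_list)
lemmas pt_candidate_list = pt_comp3[OF pt_candidate_list0]

lemma pt_search_list0: "pt (\<lambda>z :: nat \<times> ('c::enc \<times> 'a::enc list) list. search_list (fst z) (snd z))"
  unfolding search_list_def
proof (rule pt_fold_add[of _ _ _ "[:3, 3:]"])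
  fix x :: "nat \<times> ('c \<times> 'a list) list" and w
  have "esize (improve (snd x) w) \<le> esize w + (3 * esize (snd x) + 3)" by (rule esize_improve)
  also have "\<dots> \<le> esize w + (3 * esize x + 3)" by (cases x) simp
  finally show "esize (improve (snd x) w) \<le> esize w + poly [:3, 3:] (esize x)" by simp
qed (intro pt_rules pt_const pt_improve)+
lemmas pt_search_list = pt_comp2[OF pt_search_list0]

lemma pt_selected_list0: "pt selected_list"
  unfolding selected_list_def by (intro pt_rules pt_underlying)
lemmas pt_selected_list = pt_comp[OF pt_selected_list0]

lemma pt_max_leaves_list: "pt (\<lambda>z. max_leaves_list (fst z) (snd z))"
  unfolding max_leaves_list_def
  by (intro pt_rules pt_const pt_greedy_list pt_selected_list pt_search_list pt_candidate_list)

abbreviation digraph_on :: "nat \<Rightarrow> (nat \<times> nat) list \<Rightarrow> nat pair_pre_digraph" where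
  "digraph_on n as \<equiv> \<lparr>pverts = {..<n}, parcs = set as\<rparr>"

text \<open>The nodes are visited in increasing order, which is one admissible order. Distinctness
  of the arc list makes list lengths agree with the cardinalities compared to the threshold.\<close>

lemma greedy_list_correct:
  assumes "rooted_dag (digraph_on n as)" "distinct as"
  shows "greedy_expand (digraph_on n as) t (digraph_on n F) (digraph_on n (greedy_list t n as F))"
proof -
  let ?D = "digraph_on n as"
  interpret dag ?D by standard (rule assms(1))
  have avail: "avail (digraph_on n F) v = set (avail_list as F v)" for F v
    unfolding avail_def avail_list_def by simp
  have card: "card (set (avail_list as F v)) = length (avail_list as F v)" for F v
    unfolding avail_list_def using assms(2) by (intro distinct_card) simp
  have step: "expand_node ?D t v (digraph_on n F) = digraph_on n (expand_list t as v F)" for v F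
  proof -
    have fin: "finite (parcs (digraph_on n F))" by simp
    show ?thesis unfolding expand_node_eq[OF fin] avail card expand_list_def by simp
  qed
  have "fold (expand_node ?D t) vs (digraph_on n F) = digraph_on n (fold (expand_list t as) vs F)" for vs F
    by (induction vs arbitrary: F) (simp_all add: step)
  then have "digraph_on n (greedy_list t n as F) = fold (expand_node ?D t) [0..<n] (digraph_on n F)"
    unfolding greedy_list_def by simp
  then show ?thesis unfolding greedy_expand_def by (intro exI[of _ "[0..<n]"]) (simp add: atLeast0LessThan)
qed

text \<open>The three phases are matched one by one. The middle phase interprets the candidate list
  as a \<open>listed_packing\<close>, and its 3 n + 1 rounds exceed the bound on the number of
  changes.\<close>

lemma max_leaves_list_correct:
  assumes "rooted_dag (digraph_on n as)" "distinct as"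
  shows "max_leaves_12mis (digraph_on n as) (digraph_on n (max_leaves_list n as))"
proof -
  let ?D = "digraph_on n as"
  define F where "F = greedy_list 4 n as []"
  have F1: "greedy_expand ?D 4 (no_arcs ?D) (digraph_on n F)"
    using greedy_list_correct[OF assms, of 4 "[]"] unfolding F_def no_arcs_def by simp
  interpret phase1 ?D "digraph_on n F" by standard (rule assms(1), rule F1)
  define h where "h v = map snd (avail_list as F v)" for v
  have h: "set (h v) = fh v" "distinct (h v)" "length (h v) = card (fh v)" for v
  proof -
    show s: "set (h v) = fh v" unfolding h_def fh_eq avail_list_def by force
    have "inj_on snd (set (avail_list as F v))" unfolding avail_list_def by (auto intro!: inj_onI simp: prod_eq_iff)
    then show d: "distinct (h v)" unfolding h_def distinct_map using assms(2) by (simp add: avail_list_def)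
    show "length (h v) = card (fh v)" using distinct_card[OF d] s by simp
  qed
  define ul where "ul x = (case x of Orig v \<Rightarrow> h v | Drop v u \<Rightarrow> filter (\<lambda>x. x \<noteq> u) (h v))" for x
  define fam where "fam = candidate_list n as F"
  have key: "(x, l) \<in> set fam \<longleftrightarrow> x \<in> V \<and> l = ul x" for x l
    by (cases x) (auto simp: fam_def candidate_list_def entries_def h_def[symmetric] ul_def Orig_in Drop_in h card_fh)
  interpret listed_packing V U ul fam
  proof
    show "set (ul v) = U v" "distinct (ul v)" for v by (cases v; auto simp: ul_def h)+
    show "set fam = (\<lambda>v. (v, ul v)) ` V" using key by auto
  qed
  define A where "A = search_list n fam"
  have "(\<Union>v\<in>V. U v) \<subseteq> {..<n}" using candidate_set_subset unfolding free_heads_def by fastforce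
  then have "card (\<Union>v\<in>V. U v) \<le> n" using card_mono[of "{..<n}"] by fastforce
  then have I: "square_imp_result V U (keys A)"
    unfolding A_def search_list_def by (intro improve_iterate_result) simp
  have A: "set A \<subseteq> set fam" unfolding A_def search_list_def using improve_iterate by blast
  have "{(underlying x, u) | x u. x \<in> keys A \<and> u \<in> U x} = set (selected_list A)"
  proof -
    have "set (snd e) = U (fst e)" if "e \<in> set A" for e using that A entry(2) by blast
    then show ?thesis unfolding selected_list_def by force
  qed
  then have F2: "add_selected ?D (digraph_on n F) (keys A) = digraph_on n (F @ selected_list A)"
    unfolding add_selected_def by simp
  have "greedy_expand ?D 1 (digraph_on n (F @ selected_list A)) (digraph_on n (max_leaves_list n as))"
    using greedy_list_correct[OF assms, of 1 "F @ selected_list A"]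
    unfolding max_leaves_list_def A_def fam_def F_def by simp
  then show ?thesis unfolding max_leaves_12mis_def using F1 I F2 by metis
qed

lemma esize_arcs:
  assumes "distinct as" "set as \<subseteq> {..<n} \<times> {..<n}"
  shows "esize as \<le> n * n * (2 * n + 2)"
proof -
  have "length as = card (set as)" using distinct_card[OF assms(1)] by simp
  also have "\<dots> \<le> card ({..<n} \<times> {..<n})" using assms(2) by (intro card_mono) simp_all
  finally have len: "length as \<le> n * n" by simp
  have "set as \<subseteq> {..<n} \<times> {..<n} \<Longrightarrow> esize as \<le> length as * (2 * n + 2)" by (induction as) auto
  also have "\<dots> \<le> n * n * (2 * n + 2)" using len by (rule mult_le_mono1)
  finally show ?thesis using assms(2) by blast
qed

theorem max_leaves_polynomial_time: "polynomial_time_implementable rooted_dag max_leaves_12mis"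
proof -
  obtain C p where C: "computes C (\<lambda>z. max_leaves_list (fst z) (snd z)) p"
    using pt_computes[OF pt_max_leaves_list] by blast
  \<comment> \<open>The inner polynomial 1 + n + n * n * (2 n + 2) bounds the size of the input, so
    the time is polynomial in n itself.\<close>
  let ?q = "pcompose p ([:1, 1:] + [:0, 1:] * [:0, 1:] * [:2, 2:])"
  show ?thesis
    unfolding polynomial_time_implementable_def
  proof (intro exI[of _ "C 0"] exI[of _ ?q] allI impI)
    fix n as assume as: "distinct as" "rooted_dag (digraph_on n as)"
    interpret dag "digraph_on n as" by standard (rule as(2))
    have "input_store n as 0 = enc (n, as)"
      by (simp add: input_store_def enc_encode_nat enc_encode_arcs)
    from computes_run[OF C, of "input_store n as" 0 "(n, as)", OF this]
    obtain t s where run: "exec (C 0) (input_store n as) t s"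
      "t \<le> poly p (esize (n, as))" "s 0 = enc (max_leaves_list n as)"
      unfolding runs_def fst_conv snd_conv by blast
    have "set as \<subseteq> {..<n} \<times> {..<n}" using arc_fst_in_verts arc_snd_in_verts by force
    then have "esize (n, as) \<le> poly ([:1, 1:] + [:0, 1:] * [:0, 1:] * [:2, 2:]) n"
      using esize_arcs[OF as(1), of n] by (simp add: algebra_simps)
    then have "t \<le> poly ?q n" unfolding poly_pcompose using run(2) poly_nat_mono order_trans by blast
    moreover have "s 0 = encode_arcs (max_leaves_list n as)" using run(3) by (simp add: enc_encode_arcs)
    moreover have "distinct (max_leaves_list n as)" unfolding max_leaves_list_def by simp
    ultimately show "\<exists>t s bs. exec (C 0) (input_store n as) t s \<and> t \<le> poly ?q n \<and> s 0 = encode_arcs bs \<and>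
        distinct bs \<and> max_leaves_12mis (digraph_on n as) (digraph_on n bs)"
      using run(1) max_leaves_list_correct[OF as(2,1)] by blast
  qed
qed

theorem theorem7:
  shows "(\<forall>D :: 'a pair_pre_digraph. \<forall>T. rooted_dag D \<longrightarrow> max_leaves_12mis D T \<longrightarrow>
            spanning_arborescence T D \<and>
            real (num_leaves T) \<ge> 1 / (7 / 5) * real (max_leaves D))
       \<and> (\<exists>p :: nat poly. \<forall>(D :: 'a pair_pre_digraph) F1 k A.
            rooted_dag D \<longrightarrow> greedy_expand D 4 (no_arcs D) F1 \<longrightarrow>
            (square_imp_step (candidates D F1) (candidate_set D F1) ^^ k) {} A \<longrightarrow>
            k \<le> poly p (card (pverts D)))
       \<and> polynomial_time_implementable rooted_dag max_leaves_12mis"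
  using approximation_guarantee square_imp_step_bound max_leaves_polynomial_time by blast

end
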